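(* Let $G$ be a group and let $R$ be a graded left Artinian $G$-graded ring. Then any graded projective left $R$-module (projective object of $R-gr$) is isomorphic in $R-gr$ to a direct sum of shifts of principal graded indecomposable left $R$-modules, and this representation is unique up to permutation and isomorphism of the terms.
   Context: Rings are associative with identity; a $G$-graded ring is $R=\bigoplus_{g\in G}R_g$ with $R_gR_h\subset R_{gh}$. $R-gr$ is the category of graded left $R$-modules $M=\bigoplus_gM_g$ ($R_gM_h\subset M_{gh}$) with degree-preserving $R$-linear maps. The shift $M(\sigma)$, $\sigma\in G$, is $M$ with grading $M(\sigma)_g=M_{g\sigma}$. Graded left Artinian means DCC on graded left ideals. If $R$ is graded left Artinian, $R$ is a finite direct sum of indecomposable graded left submodules, and this decomposition is unique up to isomorphism and permutation; the summands are called the principal graded indecomposable left $R$-modules. *)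

theory Defs
  imports "HOL-Algebra.AbelCoset" "HOL-Algebra.Module"
begin

text \<open>
  Left modules over a not necessarily commutative ring. The axioms are those of the locale
  \<^locale>\<open>module\<close>, which cannot be used itself because it requires a commutative ring.
\<close>

locale left_module = R?: ring R + M?: abelian_group M
  for R :: "('a, 'c) ring_scheme" (structure) and M :: "('a, 'b, 'd) module_scheme" (structure) +
  assumes smult_closed:
      "\<lbrakk>a \<in> carrier R; x \<in> carrier M\<rbrakk> \<Longrightarrow> a \<odot>\<^bsub>M\<^esub> x \<in> carrier M"
    and smult_l_distr:
      "\<lbrakk>a \<in> carrier R; b \<in> carrier R; x \<in> carrier M\<rbrakk> \<Longrightarrow>
        (a \<oplus>\<^bsub>R\<^esub> b) \<odot>\<^bsub>M\<^esub> x = a \<odot>\<^bsub>M\<^esub> x \<oplus>\<^bsub>M\<^esub> b \<odot>\<^bsub>M\<^esub> x"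
    and smult_r_distr:
      "\<lbrakk>a \<in> carrier R; x \<in> carrier M; y \<in> carrier M\<rbrakk> \<Longrightarrow>
        a \<odot>\<^bsub>M\<^esub> (x \<oplus>\<^bsub>M\<^esub> y) = a \<odot>\<^bsub>M\<^esub> x \<oplus>\<^bsub>M\<^esub> a \<odot>\<^bsub>M\<^esub> y"
    and smult_assoc:
      "\<lbrakk>a \<in> carrier R; b \<in> carrier R; x \<in> carrier M\<rbrakk> \<Longrightarrow>
        (a \<otimes>\<^bsub>R\<^esub> b) \<odot>\<^bsub>M\<^esub> x = a \<odot>\<^bsub>M\<^esub> (b \<odot>\<^bsub>M\<^esub> x)"
    and smult_one:
      "x \<in> carrier M \<Longrightarrow> \<one>\<^bsub>R\<^esub> \<odot>\<^bsub>M\<^esub> x = x"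

text \<open>
  The additive group of \<open>M\<close> is the internal direct sum of the subgroups \<open>H i\<close>, for \<open>i \<in> I\<close>:
  every element is the sum of a unique finitely supported family with \<open>i\<close>-th member in \<open>H i\<close>.
\<close>

definition internal_direct_sum :: "('b, 'c) ring_scheme \<Rightarrow> 'i set \<Rightarrow> ('i \<Rightarrow> 'b set) \<Rightarrow> bool" where
  "internal_direct_sum M I H \<longleftrightarrow>
     (\<forall>i\<in>I. additive_subgroup (H i) M) \<and>
     (\<forall>x\<in>carrier M. \<exists>!f. f \<in> (\<Pi>\<^sub>E i\<in>I. H i) \<and> finite {i\<in>I. f i \<noteq> \<zero>\<^bsub>M\<^esub>} \<and>
        x = (\<Oplus>\<^bsub>M\<^esub>i\<in>{i\<in>I. f i \<noteq> \<zero>\<^bsub>M\<^esub>}. f i))"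

locale graded_ring = G?: group G + R?: ring R
  for G :: "('g, 'e) monoid_scheme" (structure) and R :: "('a, 'c) ring_scheme" (structure)
    and A :: "'g \<Rightarrow> 'a set" +
  assumes ring_grading: "internal_direct_sum R (carrier G) A"
    and ring_grading_mult:
      "\<lbrakk>g \<in> carrier G; h \<in> carrier G; a \<in> A g; b \<in> A h\<rbrakk> \<Longrightarrow> a \<otimes>\<^bsub>R\<^esub> b \<in> A (g \<otimes>\<^bsub>G\<^esub> h)"

text \<open>
  As in the record \<open>module\<close>, the ring operations \<open>mult\<close> and \<open>one\<close> inherited by this record
  have no meaning for a module and are ignored throughout.
\<close>

record ('a, 'b, 'g) gr_module = "('a, 'b) module" +
  hcomp :: "'g \<Rightarrow> 'b set"

locale graded_module = graded_ring G R A + left_module R M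
  for G :: "('g, 'e) monoid_scheme" (structure) and R :: "('a, 'c) ring_scheme" (structure)
    and A :: "'g \<Rightarrow> 'a set" and M :: "('a, 'b, 'g) gr_module" (structure) +
  assumes module_grading: "internal_direct_sum M (carrier G) (hcomp M)"
    and module_grading_smult:
      "\<lbrakk>g \<in> carrier G; h \<in> carrier G; a \<in> A g; x \<in> hcomp M h\<rbrakk> \<Longrightarrow>
        a \<odot>\<^bsub>M\<^esub> x \<in> hcomp M (g \<otimes>\<^bsub>G\<^esub> h)"

definition gr_hom ::
  "('g, 'e) monoid_scheme \<Rightarrow> ('a, 'c) ring_scheme \<Rightarrow> ('a, 'm, 'g) gr_module \<Rightarrow> ('a, 'n, 'g) gr_module
    \<Rightarrow> ('m \<Rightarrow> 'n) set" where
  "gr_hom G R M N =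
     {f. f \<in> carrier M \<rightarrow> carrier N \<and>
         (\<forall>x\<in>carrier M. \<forall>y\<in>carrier M. f (x \<oplus>\<^bsub>M\<^esub> y) = f x \<oplus>\<^bsub>N\<^esub> f y) \<and>
         (\<forall>a\<in>carrier R. \<forall>x\<in>carrier M. f (a \<odot>\<^bsub>M\<^esub> x) = a \<odot>\<^bsub>N\<^esub> f x) \<and>
         (\<forall>g\<in>carrier G. f ` hcomp M g \<subseteq> hcomp N g)}"

definition gr_iso ::
  "('g, 'e) monoid_scheme \<Rightarrow> ('a, 'c) ring_scheme \<Rightarrow> ('a, 'm, 'g) gr_module \<Rightarrow> ('a, 'n, 'g) gr_module
    \<Rightarrow> bool" where
  "gr_iso G R M N \<longleftrightarrow>
     (\<exists>f\<in>gr_hom G R M N. \<exists>h\<in>gr_hom G R N M.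
        (\<forall>x\<in>carrier M. h (f x) = x) \<and> (\<forall>y\<in>carrier N. f (h y) = y))"

definition gr_shift ::
  "('g, 'e) monoid_scheme \<Rightarrow> ('a, 'b, 'g) gr_module \<Rightarrow> 'g \<Rightarrow> ('a, 'b, 'g) gr_module" where
  "gr_shift G M \<sigma> = M\<lparr>hcomp := \<lambda>g. hcomp M (g \<otimes>\<^bsub>G\<^esub> \<sigma>)\<rparr>"

definition gr_direct_sum ::
  "'i set \<Rightarrow> ('i \<Rightarrow> ('a, 'b, 'g) gr_module) \<Rightarrow> ('a, 'i \<Rightarrow> 'b, 'g) gr_module" where
  "gr_direct_sum I M =
     (let D = {x \<in> \<Pi>\<^sub>E i\<in>I. carrier (M i). finite {i\<in>I. x i \<noteq> \<zero>\<^bsub>M i\<^esub>}} in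
      \<lparr>carrier = D,
       monoid.mult = undefined,
       monoid.one = undefined,
       ring.zero = (\<lambda>i\<in>I. \<zero>\<^bsub>M i\<^esub>),
       ring.add = (\<lambda>x y. \<lambda>i\<in>I. x i \<oplus>\<^bsub>M i\<^esub> y i),
       module.smult = (\<lambda>a x. \<lambda>i\<in>I. a \<odot>\<^bsub>M i\<^esub> x i),
       hcomp = (\<lambda>g. {x \<in> D. \<forall>i\<in>I. x i \<in> hcomp (M i) g})\<rparr>)"

definition gr_submodule ::
  "('g, 'e) monoid_scheme \<Rightarrow> ('a, 'c) ring_scheme \<Rightarrow> ('a, 'b, 'g) gr_module \<Rightarrow> 'b set \<Rightarrow> bool" where
  "gr_submodule G R M N \<longleftrightarrow>
     additive_subgroup N M \<and>
     (\<forall>a\<in>carrier R. \<forall>x\<in>N. a \<odot>\<^bsub>M\<^esub> x \<in> N) \<and>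
     internal_direct_sum (M\<lparr>carrier := N\<rparr>) (carrier G) (\<lambda>g. N \<inter> hcomp M g)"

text \<open>The graded submodule \<open>N\<close> of \<open>M\<close>, as a graded module in its own right.\<close>

definition gr_restrict :: "('a, 'b, 'g) gr_module \<Rightarrow> 'b set \<Rightarrow> ('a, 'b, 'g) gr_module" where
  "gr_restrict M N = M\<lparr>carrier := N, hcomp := \<lambda>g. N \<inter> hcomp M g\<rparr>"

definition gr_indecomposable ::
  "('g, 'e) monoid_scheme \<Rightarrow> ('a, 'c) ring_scheme \<Rightarrow> ('a, 'b, 'g) gr_module \<Rightarrow> bool" where
  "gr_indecomposable G R M \<longleftrightarrow>
     carrier M \<noteq> {\<zero>\<^bsub>M\<^esub>} \<and>
     (\<forall>N N'. gr_submodule G R M N \<and> gr_submodule G R M N' \<and>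
        N <+>\<^bsub>M\<^esub> N' = carrier M \<and> N \<inter> N' = {\<zero>\<^bsub>M\<^esub>} \<longrightarrow> N = {\<zero>\<^bsub>M\<^esub>} \<or> N' = {\<zero>\<^bsub>M\<^esub>})"

text \<open>
  The ring as a graded left module over itself; its graded submodules are the graded left ideals.
\<close>

definition gr_regular :: "('a, 'c) ring_scheme \<Rightarrow> ('g \<Rightarrow> 'a set) \<Rightarrow> ('a, 'a, 'g) gr_module" where
  "gr_regular R A =
     \<lparr>carrier = carrier R, monoid.mult = undefined, monoid.one = undefined,
      ring.zero = \<zero>\<^bsub>R\<^esub>, ring.add = ring.add R, module.smult = monoid.mult R, hcomp = A\<rparr>"

definition gr_left_artinian ::
  "('g, 'e) monoid_scheme \<Rightarrow> ('a, 'c) ring_scheme \<Rightarrow> ('g \<Rightarrow> 'a set) \<Rightarrow> bool" where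
  "gr_left_artinian G R A \<longleftrightarrow>
     (\<forall>L :: nat \<Rightarrow> 'a set.
        (\<forall>n. gr_submodule G R (gr_regular R A) (L n)) \<and> (\<forall>n. L (Suc n) \<subseteq> L n) \<longrightarrow>
        (\<exists>m. \<forall>n\<ge>m. L n = L m))"

text \<open>
  A principal graded indecomposable is a summand occurring in some decomposition of \<open>R\<close> into a
  finite direct sum of indecomposable graded left ideals. No decomposition is singled out: the
  summands of any two of them agree up to isomorphism.
\<close>

definition principal_gr_indecomposable ::
  "('g, 'e) monoid_scheme \<Rightarrow> ('a, 'c) ring_scheme \<Rightarrow> ('g \<Rightarrow> 'a set) \<Rightarrow> 'a set \<Rightarrow> bool" where
  "principal_gr_indecomposable G R A U \<longleftrightarrow>
     (\<exists>(n::nat) V.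
        (\<forall>i<n. gr_submodule G R (gr_regular R A) (V i) \<and>
               gr_indecomposable G R (gr_restrict (gr_regular R A) (V i))) \<and>
        internal_direct_sum (gr_regular R A) {..<n} V \<and>
        (\<exists>i<n. U = V i))"

text \<open>
  Projective objects of the category of graded left modules: every morphism \<open>u : P \<rightarrow> N\<close> lifts
  along every epimorphism \<open>\<phi> : M \<rightarrow> N\<close>; epimorphisms of graded modules are the surjective
  morphisms. A HOL formula cannot quantify over all types of module elements, so \<open>M\<close> and \<open>N\<close> range
  over the graded modules with elements in \<^typ>\<open>'p \<times> 'g \<Rightarrow> 'a\<close> and in \<^typ>\<open>'p\<close>, where \<^typ>\<open>'p\<close>
  is the element type of \<open>P\<close>. This is no restriction: with \<open>\<phi>\<close> the canonical map onto \<open>P\<close> from the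
  free graded module on the pairs \<open>(x, g)\<close>, \<open>x \<in> hcomp P g\<close> (whose elements are families of type
  \<^typ>\<open>'p \<times> 'g \<Rightarrow> 'a\<close>), and \<open>u\<close> the identity, the condition says that \<open>P\<close> is a graded direct
  summand of a free graded module, and then \<open>P\<close> has the lifting property for modules over all types.
\<close>

definition gr_projective ::
  "('g, 'e) monoid_scheme \<Rightarrow> ('a, 'c) ring_scheme \<Rightarrow> ('g \<Rightarrow> 'a set) \<Rightarrow> ('a, 'p, 'g) gr_module \<Rightarrow> bool"
  where
  "gr_projective G R A P \<longleftrightarrow>
     graded_module G R A P \<and>
     (\<forall>(M :: ('a, 'p \<times> 'g \<Rightarrow> 'a, 'g) gr_module) (N :: ('a, 'p, 'g) gr_module) \<phi> u.
        graded_module G R A M \<and> graded_module G R A N \<and>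
        \<phi> \<in> gr_hom G R M N \<and> \<phi> ` carrier M = carrier N \<and> u \<in> gr_hom G R P N \<longrightarrow>
        (\<exists>v\<in>gr_hom G R P M. \<forall>x\<in>carrier P. \<phi> (v x) = u x))"

text \<open>
  A family, indexed by \<open>I\<close>, of shifts \<open>Q i(\<sigma> i)\<close> of principal graded indecomposable modules,
  given by the graded left ideals \<open>Q i\<close> and the group elements \<open>\<sigma> i\<close>.
\<close>

definition shifted_principal_family ::
  "('g, 'e) monoid_scheme \<Rightarrow> ('a, 'c) ring_scheme \<Rightarrow> ('g \<Rightarrow> 'a set) \<Rightarrow>
    'i set \<Rightarrow> ('i \<Rightarrow> 'a set) \<Rightarrow> ('i \<Rightarrow> 'g) \<Rightarrow> bool" where
  "shifted_principal_family G R A I Q \<sigma> \<longleftrightarrow>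
     (\<forall>i\<in>I. principal_gr_indecomposable G R A (Q i) \<and> \<sigma> i \<in> carrier G)"

definition shifted_ideal ::
  "('g, 'e) monoid_scheme \<Rightarrow> ('a, 'c) ring_scheme \<Rightarrow> ('g \<Rightarrow> 'a set) \<Rightarrow> 'a set \<Rightarrow> 'g
    \<Rightarrow> ('a, 'a, 'g) gr_module" where
  "shifted_ideal G R A U \<sigma> = gr_shift G (gr_restrict (gr_regular R A) U) \<sigma>"

end

theory Submission
  imports Defs
begin

text \<open>
  By Hopkins' argument every graded left ideal of \<open>R\<close> is nilpotent or contains a nonzero idempotent of
  degree \<open>1\<close>; so there is a largest nilpotent graded ideal \<open>J\<close>, and \<open>1\<close> is a sum of orthogonal primitive
  idempotents \<open>e\<close> of degree \<open>1\<close> for which \<open>R e / J e\<close> is simple. The principal graded indecomposables are the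
  modules \<open>R e\<close>. For a graded module \<open>P\<close>, the generators of shifted copies of the modules \<open>R e\<close> form
  a pregeometry modulo \<open>J P\<close>, in which exchange takes place only between isomorphic summands.

  For the existence, a basis of this pregeometry generates \<open>P\<close> by Nakayama's lemma, so that \<open>P\<close> is
  a quotient of the corresponding direct sum; the quotient map splits when \<open>P\<close> is projective, and its kernel \<open>K\<close>
  satisfies \<open>K = J K\<close>, hence vanishes. For the uniqueness, a decomposition of \<open>P\<close> yields a basis, and two
  bases are equipotent on each isomorphism class.
\<close>

section \<open>Internal direct sums through component maps\<close>

text \<open>The module P need not be finitely generated, so finite Krull-Schmidt arguments do not
  apply. Nilpotence of J takes the place of finiteness: Nakayama's lemma and the vanishing of K = J
  K become descending inductions on the exponent of J. The simple summands of P / J P belong to many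
  isomorphism classes, each with its own endomorphism division ring; a pregeometry yields bases and
  dimensions without choosing any of these rings, and its finitary closure lets infinite bases be
  compared by cardinal arithmetic. Neither R / J nor P / J P is constructed. Passing to P / J P
  amounts to putting J P into every closure, and simplicity of R e / J e is used as a cancellation
  rule: a homogeneous r with r e outside J has a homogeneous s with s r e = e. The submodule R x,
  the ideal L x and the annihilator of x are guaranteed to be graded only for homogeneous x; hence
  equations are repeatedly cut down to a single degree.\<close>

context abelian_group
begin

lemma additive_subgroup_iff:
  "additive_subgroup H G \<longleftrightarrow>
     H \<subseteq> carrier G \<and> \<zero> \<in> H \<and> (\<forall>x\<in>H. \<forall>y\<in>H. x \<oplus> y \<in> H) \<and> (\<forall>x\<in>H. \<ominus> x \<in> H)"
proof
  assume "additive_subgroup H G"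
  then interpret additive_subgroup H G .
  show "H \<subseteq> carrier G \<and> \<zero> \<in> H \<and> (\<forall>x\<in>H. \<forall>y\<in>H. x \<oplus> y \<in> H) \<and> (\<forall>x\<in>H. \<ominus> x \<in> H)"
    using a_subset abelian_subgroup.intro[OF additive_subgroup_axioms]
    by (auto simp: a_inv_def intro: subgroup.m_inv_closed[OF a_subgroup])
next
  assume *: "H \<subseteq> carrier G \<and> \<zero> \<in> H \<and> (\<forall>x\<in>H. \<forall>y\<in>H. x \<oplus> y \<in> H) \<and> (\<forall>x\<in>H. \<ominus> x \<in> H)"
  show "additive_subgroup H G"
    by (rule additive_subgroupI, rule add.subgroupI) (use * in \<open>auto simp: a_inv_def\<close>)
qed

text \<open>\<open>internal_direct_sum\<close> asks for a sum over the exact support of an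
  extensional family; a sum over any finite index set takes that shape after extension by
  zero.\<close>

lemma finsum_support:
  assumes "finite F" "F \<subseteq> I" "\<And>i. i \<in> F \<Longrightarrow> f i \<in> carrier G"
  shows "finsum G f F = finsum G (\<lambda>i\<in>I. if i \<in> F then f i else \<zero>)
           {i \<in> I. (\<lambda>i\<in>I. if i \<in> F then f i else \<zero>) i \<noteq> \<zero>}"
  by (rule add.finprod_mono_neutral_cong_right) (use assms in auto)

end

definition component :: "('b, 'c) ring_scheme \<Rightarrow> 'i set \<Rightarrow> ('i \<Rightarrow> 'b set) \<Rightarrow> 'b \<Rightarrow> 'i \<Rightarrow> 'b" where
  "component M I H x = (THE f. f \<in> (\<Pi>\<^sub>E i\<in>I. H i) \<and> finite {i\<in>I. f i \<noteq> \<zero>\<^bsub>M\<^esub>} \<and>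
        x = (\<Oplus>\<^bsub>M\<^esub>i\<in>{i\<in>I. f i \<noteq> \<zero>\<^bsub>M\<^esub>}. f i))"

locale direct_sum_decomp = abelian_group M for M (structure) +
  fixes I :: "'i set" and H :: "'i \<Rightarrow> 'b set"
  assumes ids: "internal_direct_sum M I H"
begin

abbreviation "c \<equiv> component M I H"

lemma subgroupH: "i \<in> I \<Longrightarrow> additive_subgroup (H i) M"
  using ids by (auto simp: internal_direct_sum_def)

lemma H_facts:
  assumes "i \<in> I"
  shows "H i \<subseteq> carrier M" "\<zero> \<in> H i" "\<And>x y. x \<in> H i \<Longrightarrow> y \<in> H i \<Longrightarrow> x \<oplus> y \<in> H i"
    "\<And>x. x \<in> H i \<Longrightarrow> \<ominus> x \<in> H i"
  using subgroupH[OF assms] by (auto simp: additive_subgroup_iff)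

lemma component_props:
  assumes "x \<in> carrier M"
  shows "c x \<in> (\<Pi>\<^sub>E i\<in>I. H i)" "finite {i\<in>I. c x i \<noteq> \<zero>}"
    "x = (\<Oplus>i\<in>{i\<in>I. c x i \<noteq> \<zero>}. c x i)"
proof -
  have "\<exists>!f. f \<in> (\<Pi>\<^sub>E i\<in>I. H i) \<and> finite {i\<in>I. f i \<noteq> \<zero>} \<and>
        x = (\<Oplus>i\<in>{i\<in>I. f i \<noteq> \<zero>}. f i)"
    using ids assms by (auto simp: internal_direct_sum_def)
  from theI'[OF this] show "c x \<in> (\<Pi>\<^sub>E i\<in>I. H i)" "finite {i\<in>I. c x i \<noteq> \<zero>}"
    "x = (\<Oplus>i\<in>{i\<in>I. c x i \<noteq> \<zero>}. c x i)"
    unfolding component_def by blast+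
qed

lemma component_in: "x \<in> carrier M \<Longrightarrow> i \<in> I \<Longrightarrow> c x i \<in> H i"
  using component_props(1) by (auto simp: PiE_iff)

lemma component_closed: "x \<in> carrier M \<Longrightarrow> i \<in> I \<Longrightarrow> c x i \<in> carrier M"
  using component_in H_facts(1) by blast

lemma component_finsum:
  assumes "finite F" "F \<subseteq> I" "\<And>i. i \<in> F \<Longrightarrow> f i \<in> H i" "i \<in> I"
  shows "c (finsum M f F) i = (if i \<in> F then f i else \<zero>)"
proof -
  have fc: "f i \<in> carrier M" if "i \<in> F" for i using that assms H_facts(1) by blast
  let ?x = "finsum M f F"
  let ?f = "\<lambda>i\<in>I. if i \<in> F then f i else \<zero>"
  have x: "?x \<in> carrier M" using fc by (intro finsum_closed) auto
  have ex: "\<exists>!f. f \<in> (\<Pi>\<^sub>E i\<in>I. H i) \<and> finite {i\<in>I. f i \<noteq> \<zero>} \<and>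
        ?x = (\<Oplus>i\<in>{i\<in>I. f i \<noteq> \<zero>}. f i)"
    using ids x by (auto simp: internal_direct_sum_def)
  have "?f \<in> (\<Pi>\<^sub>E i\<in>I. H i) \<and> finite {i\<in>I. ?f i \<noteq> \<zero>} \<and>
        ?x = (\<Oplus>i\<in>{i\<in>I. ?f i \<noteq> \<zero>}. ?f i)"
  proof (intro conjI)
    show "?f \<in> (\<Pi>\<^sub>E i\<in>I. H i)" using assms H_facts(2) by auto
    show "finite {i\<in>I. ?f i \<noteq> \<zero>}" by (rule finite_subset[OF _ assms(1)]) auto
    show "?x = (\<Oplus>i\<in>{i\<in>I. ?f i \<noteq> \<zero>}. ?f i)" by (rule finsum_support) (use assms fc in auto)
  qed
  with component_props[OF x] ex have "c ?x = ?f" by blast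
  then show ?thesis using assms by simp
qed

lemma component_self: 
  assumes "x \<in> H j" "j \<in> I" "i \<in> I" shows "c x i = (if i = j then x else \<zero>)"
proof -
  have "x \<in> carrier M" using assms H_facts(1) by blast
  then have "x = finsum M (\<lambda>_. x) {j}" by (simp add: finsum_insert[of "{}" j])
  then show ?thesis using component_finsum[of "{j}" "\<lambda>_. x" i] assms by auto
qed

lemma component_finsum_eq:
  assumes "x \<in> carrier M" "finite F" "F \<subseteq> I" "{i\<in>I. c x i \<noteq> \<zero>} \<subseteq> F"
  shows "x = finsum M (c x) F"
proof -
  have "x = (\<Oplus>i\<in>{i\<in>I. c x i \<noteq> \<zero>}. c x i)" using component_props assms by blast
  also have "\<dots> = finsum M (c x) F"
    by (rule add.finprod_mono_neutral_cong_left) (use assms component_closed in auto)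
  finally show ?thesis .
qed

lemma component_add:
  assumes "x \<in> carrier M" "y \<in> carrier M" "i \<in> I"
  shows "c (x \<oplus> y) i = c x i \<oplus> c y i"
proof -
  define F where "F = {i\<in>I. c x i \<noteq> \<zero>} \<union> {i\<in>I. c y i \<noteq> \<zero>}"
  have F: "finite F" "F \<subseteq> I" using component_props assms by (auto simp: F_def)
  have x: "x = finsum M (c x) F" and y: "y = finsum M (c y) F"
    using assms F by (auto intro!: component_finsum_eq simp: F_def)
  have "x \<oplus> y = finsum M (c x) F \<oplus> finsum M (c y) F" using x y by simp
  also have "\<dots> = finsum M (\<lambda>i. c x i \<oplus> c y i) F"
    by (rule finsum_addf[symmetric]) (use assms F component_closed in auto)
  also have "c \<dots> i = (if i \<in> F then c x i \<oplus> c y i else \<zero>)"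
    by (rule component_finsum) (use F assms in \<open>auto intro!: H_facts(3) component_in\<close>)
  finally have "c (x \<oplus> y) i = (if i \<in> F then c x i \<oplus> c y i else \<zero>)" .
  then show ?thesis using assms by (auto simp: F_def)
qed

lemma component_ext:
  assumes "x \<in> carrier M" "y \<in> carrier M" "\<And>i. i \<in> I \<Longrightarrow> c x i = c y i"
  shows "x = y"
proof -
  have "c x = c y"
    using component_props(1)[OF assms(1)] component_props(1)[OF assms(2)] assms(3)
    by (intro ext, rename_tac i, case_tac "i \<in> I") (auto simp: PiE_iff extensional_def)
  then show ?thesis using component_props(3)[OF assms(1)] component_props(3)[OF assms(2)] by simp
qed

lemma component_induct:
  assumes x: "x \<in> carrier M" and "Q \<zero>" "\<And>i. i \<in> I \<Longrightarrow> Q (c x i)"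
    and add: "\<And>y z. y \<in> carrier M \<Longrightarrow> z \<in> carrier M \<Longrightarrow> Q y \<Longrightarrow> Q z \<Longrightarrow> Q (y \<oplus> z)"
  shows "Q x"
proof -
  have "Q (finsum M (c x) F)" if "finite F" "F \<subseteq> I" for F
    using that
  proof (induction F rule: finite_induct)
    case (insert i F)
    have "finsum M (c x) (insert i F) = c x i \<oplus> finsum M (c x) F"
      by (rule finsum_insert) (use insert x component_closed in auto)
    moreover have "finsum M (c x) F \<in> carrier M"
      by (rule finsum_closed) (use insert x component_closed in auto)
    ultimately show ?case using insert assms component_closed by auto
  qed (simp add: assms)
  from this[of "{i\<in>I. c x i \<noteq> \<zero>}"] show ?thesis
    using component_props(2,3)[OF x] by auto
qed

end

lemma (in abelian_group) additive_finsum: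
  assumes "finite F" "f \<in> F \<rightarrow> carrier G" "abelian_group N" "\<And>x. x \<in> carrier G \<Longrightarrow> h x \<in> carrier N"
    "\<And>x y. x \<in> carrier G \<Longrightarrow> y \<in> carrier G \<Longrightarrow> h (x \<oplus> y) = h x \<oplus>\<^bsub>N\<^esub> h y"
  shows "h (finsum G f F) = finsum N (\<lambda>i. h (f i)) F"
proof -
  interpret N: abelian_group N by fact
  have "h \<zero> = h \<zero> \<oplus>\<^bsub>N\<^esub> h \<zero>" using assms(5)[of \<zero> \<zero>] by simp
  then have h0: "h \<zero> = \<zero>\<^bsub>N\<^esub>" using assms(4)[of \<zero>] N.add.l_cancel_one' by (metis zero_closed)
  show ?thesis using assms(1,2)
  proof (induction F rule: finite_induct)
    case (insert i F)
    have "h (finsum G f (insert i F)) = h (f i \<oplus> finsum G f F)"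
      using insert by (subst finsum_insert) auto
    also have "\<dots> = h (f i) \<oplus>\<^bsub>N\<^esub> h (finsum G f F)" using insert assms(5) by auto
    also have "\<dots> = finsum N (\<lambda>i. h (f i)) (insert i F)"
      using insert assms(4) by (subst N.finsum_insert) (auto simp: Pi_iff)
    finally show ?case .
  qed (simp add: h0)
qed

text \<open>A candidate d for the component maps is enough. If y is the sum of the d x i, then x - y
  has zero components, so \<open>sep\<close> yields x = y; applying d to any decomposition of x
  recovers its terms, which gives uniqueness.\<close>

lemma (in abelian_group) internal_direct_sumI:
  assumes H: "\<And>i. i \<in> I \<Longrightarrow> additive_subgroup (H i) G"
    and d_in: "\<And>x i. x \<in> carrier G \<Longrightarrow> i \<in> I \<Longrightarrow> d x i \<in> H i"
    and fin: "\<And>x. x \<in> carrier G \<Longrightarrow> finite {i\<in>I. d x i \<noteq> \<zero>}"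
    and add: "\<And>x y i. x \<in> carrier G \<Longrightarrow> y \<in> carrier G \<Longrightarrow> i \<in> I \<Longrightarrow> d (x \<oplus> y) i = d x i \<oplus> d y i"
    and self: "\<And>x i j. i \<in> I \<Longrightarrow> j \<in> I \<Longrightarrow> x \<in> H j \<Longrightarrow> d x i = (if i = j then x else \<zero>)"
    and sep: "\<And>x. x \<in> carrier G \<Longrightarrow> (\<And>i. i \<in> I \<Longrightarrow> d x i = \<zero>) \<Longrightarrow> x = \<zero>"
  shows "internal_direct_sum G I H"
proof -
  have Hc: "x \<in> carrier G" if "x \<in> H i" "i \<in> I" for x i
    using H[OF that(2)] that(1) by (auto simp: additive_subgroup_iff)
  have dc: "d x i \<in> carrier G" if "x \<in> carrier G" "i \<in> I" for x i
    using Hc d_in that by blast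
  have d_finsum: "d (finsum G f F) i = (if i \<in> F then f i else \<zero>)"
    if "finite F" "F \<subseteq> I" "\<And>i. i \<in> F \<Longrightarrow> f i \<in> H i" "i \<in> I" for f F i
  proof -
    have fc: "f j \<in> carrier G" if "j \<in> F" for j using that \<open>F \<subseteq> I\<close> Hc \<open>\<And>i. i \<in> F \<Longrightarrow> f i \<in> H i\<close> by blast
    have "d (finsum G f F) i = finsum G (\<lambda>j. d (f j) i) F"
      by (rule additive_finsum[where h = "\<lambda>x. d x i"])
        (use that fc dc add abelian_group_axioms in \<open>auto simp: subset_iff\<close>)
    also have "\<dots> = finsum G (\<lambda>j. if i = j then f j else \<zero>) F"
      by (rule finsum_cong') (use that fc self in \<open>auto simp: subset_iff\<close>)
    also have "\<dots> = (if i \<in> F then f i else \<zero>)"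
    proof (cases "i \<in> F")
      case True
      then show ?thesis using that fc by (subst finsum_singleton) (auto simp: subset_iff)
    next
      case False
      then have "finsum G (\<lambda>j. if i = j then f j else \<zero>) F = finsum G (\<lambda>j. \<zero>) F"
        by (intro finsum_cong') auto
      then show ?thesis using False by (simp add: finsum_zero)
    qed
    finally show ?thesis .
  qed
  have "\<exists>!f. f \<in> (\<Pi>\<^sub>E i\<in>I. H i) \<and> finite {i\<in>I. f i \<noteq> \<zero>} \<and> x = (\<Oplus>i\<in>{i\<in>I. f i \<noteq> \<zero>}. f i)"
    if x: "x \<in> carrier G" for x
  proof (rule ex1I)
    let ?f = "\<lambda>i\<in>I. d x i"
    have S: "{i\<in>I. ?f i \<noteq> \<zero>} = {i\<in>I. d x i \<noteq> \<zero>}" by auto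
    define y where "y = (\<Oplus>i\<in>{i\<in>I. ?f i \<noteq> \<zero>}. ?f i)"
    have y: "y \<in> carrier G" unfolding y_def using x Hc dc by (intro finsum_closed) auto
    have dyx: "d y i = d x i" if "i \<in> I" for i
      unfolding y_def S using that x d_in fin by (subst d_finsum) auto
    have "d (x \<oplus> \<ominus> y) i = \<zero>" if "i \<in> I" for i
    proof -
      have "d (x \<oplus> \<ominus> y) i \<oplus> d y i = d (x \<oplus> \<ominus> y \<oplus> y) i" using add x y that by simp
      also have "x \<oplus> \<ominus> y \<oplus> y = x" using x y by (simp add: a_assoc l_neg)
      finally have "d (x \<oplus> \<ominus> y) i \<oplus> d y i = \<zero> \<oplus> d y i"
        using dyx[OF that] that x dc by auto
      then show ?thesis using that x y dc[of _ i] by (simp add: add.right_cancel)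
    qed
    then have "x \<oplus> \<ominus> y = \<zero>" using sep x y by auto
    then have "x = y" using x y by (metis add.inv_equality add.inv_closed minus_minus)
    then show "?f \<in> (\<Pi>\<^sub>E i\<in>I. H i) \<and> finite {i\<in>I. ?f i \<noteq> \<zero>} \<and> x = (\<Oplus>i\<in>{i\<in>I. ?f i \<noteq> \<zero>}. ?f i)"
      using fin x d_in S unfolding y_def by (auto simp del: restrict_apply)
  next
    fix f assume f: "f \<in> (\<Pi>\<^sub>E i\<in>I. H i) \<and> finite {i\<in>I. f i \<noteq> \<zero>} \<and> x = (\<Oplus>i\<in>{i\<in>I. f i \<noteq> \<zero>}. f i)"
    have "d x i = f i" if "i \<in> I" for i
    proof -
      have "d x i = (if i \<in> {i\<in>I. f i \<noteq> \<zero>} then f i else \<zero>)"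
        using f that by (subst (asm) PiE_iff, subst conjunct2[OF conjunct2[OF f]], intro d_finsum) auto
      then show ?thesis using that by auto
    qed
    then show "f = (\<lambda>i\<in>I. d x i)" using f by (auto simp: PiE_iff extensional_def)
  qed
  then show ?thesis using H by (auto simp: internal_direct_sum_def)
qed

section \<open>Graded modules and graded submodules\<close>

context left_module
begin

lemma smult_l_null: "x \<in> carrier M \<Longrightarrow> \<zero>\<^bsub>R\<^esub> \<odot>\<^bsub>M\<^esub> x = \<zero>\<^bsub>M\<^esub>"
  using smult_l_distr[of "\<zero>\<^bsub>R\<^esub>" "\<zero>\<^bsub>R\<^esub>" x] smult_closed[of "\<zero>\<^bsub>R\<^esub>" x]
  by (simp add: M.add.l_cancel_one')

lemma smult_r_null: "a \<in> carrier R \<Longrightarrow> a \<odot>\<^bsub>M\<^esub> \<zero>\<^bsub>M\<^esub> = \<zero>\<^bsub>M\<^esub>"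
  using smult_r_distr[of a "\<zero>\<^bsub>M\<^esub>" "\<zero>\<^bsub>M\<^esub>"] smult_closed[of a "\<zero>\<^bsub>M\<^esub>"]
  by (simp add: M.add.l_cancel_one')

lemma smult_r_minus:
  assumes "a \<in> carrier R" "x \<in> carrier M"
  shows "a \<odot>\<^bsub>M\<^esub> (\<ominus>\<^bsub>M\<^esub> x) = \<ominus>\<^bsub>M\<^esub> (a \<odot>\<^bsub>M\<^esub> x)"
proof -
  have "a \<odot>\<^bsub>M\<^esub> (\<ominus>\<^bsub>M\<^esub> x) \<oplus>\<^bsub>M\<^esub> a \<odot>\<^bsub>M\<^esub> x = \<zero>\<^bsub>M\<^esub>"
    using assms by (simp add: smult_r_distr[symmetric] M.l_neg smult_r_null)
  then show ?thesis using assms by (simp add: M.minus_equality smult_closed)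
qed

lemma smult_l_minus:
  assumes "a \<in> carrier R" "x \<in> carrier M"
  shows "(\<ominus>\<^bsub>R\<^esub> a) \<odot>\<^bsub>M\<^esub> x = \<ominus>\<^bsub>M\<^esub> (a \<odot>\<^bsub>M\<^esub> x)"
proof -
  have "(\<ominus>\<^bsub>R\<^esub> a) \<odot>\<^bsub>M\<^esub> x \<oplus>\<^bsub>M\<^esub> a \<odot>\<^bsub>M\<^esub> x = \<zero>\<^bsub>M\<^esub>"
    using assms by (simp add: smult_l_distr[symmetric] R.l_neg smult_l_null)
  then show ?thesis using assms by (simp add: M.minus_equality smult_closed)
qed

lemma minus_smult:
  assumes "x \<in> carrier M"
  shows "(\<ominus>\<^bsub>R\<^esub> \<one>\<^bsub>R\<^esub>) \<odot>\<^bsub>M\<^esub> x = \<ominus>\<^bsub>M\<^esub> x"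
  using assms by (simp add: smult_l_minus smult_one)

end

text \<open>Sums see only the additive part of a record, so they are unaffected when a module is
  given new scalars or a new grading.\<close>

lemma finsum_record_eq:
  assumes "carrier K = carrier M" "add K = add M" "zero K = zero M"
  shows "finsum K f F = finsum M f F"
  using assms by (simp add: finsum_def finprod_def)

lemma component_record_eq:
  assumes "carrier K = carrier M" "add K = add M" "zero K = zero M"
  shows "component K I H = component M I H"
  using assms by (intro ext) (simp add: component_def finsum_record_eq[OF assms])

sublocale graded_ring \<subseteq> dR: direct_sum_decomp R "carrier G" A
  by unfold_locales (rule ring_grading)

sublocale graded_module \<subseteq> dM: direct_sum_decomp M "carrier G" "hcomp M"
  by unfold_locales (rule module_grading)

context graded_ring
begin

lemma A_closed: "a \<in> A g \<Longrightarrow> g \<in> carrier G \<Longrightarrow> a \<in> carrier R"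
  using dR.H_facts(1) by blast

lemma hom_induct [consumes 1, case_names zero homog add]:
  assumes "a \<in> carrier R" "Q \<zero>\<^bsub>R\<^esub>" "\<And>g b. g \<in> carrier G \<Longrightarrow> b \<in> A g \<Longrightarrow> Q b"
    "\<And>b c. b \<in> carrier R \<Longrightarrow> c \<in> carrier R \<Longrightarrow> Q b \<Longrightarrow> Q c \<Longrightarrow> Q (b \<oplus>\<^bsub>R\<^esub> c)"
  shows "Q a"
  by (rule dR.component_induct[OF assms(1,2) _ assms(4)]) (use assms dR.component_in in auto)

text \<open>Let e be the component of the ring identity in degree 1. Comparing degree g in b = b 1
  gives b = b e for b of degree g, hence for all b by additivity; b = 1 yields 1 = e.\<close>

lemma one_homogeneous: "\<one>\<^bsub>R\<^esub> \<in> A \<one>\<^bsub>G\<^esub>"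
proof -
  let ?e = "dR.c \<one>\<^bsub>R\<^esub> \<one>\<^bsub>G\<^esub>"
  have e: "?e \<in> A \<one>\<^bsub>G\<^esub>" "?e \<in> carrier R" by (simp_all add: dR.component_in dR.component_closed)
  have *: "dR.c (a \<otimes>\<^bsub>R\<^esub> x) (g \<otimes>\<^bsub>G\<^esub> h) = a \<otimes>\<^bsub>R\<^esub> dR.c x h"
    if a: "a \<in> A g" and g: "g \<in> carrier G" "h \<in> carrier G" and x: "x \<in> carrier R" for a g h x
    using x
  proof (induction rule: hom_induct)
    case zero
    then show ?case using a g A_closed by (simp add: dR.component_self[OF dR.H_facts(2)[of g]]
        dR.component_self[OF dR.H_facts(2)[of h] g(2) g(2)] dR.component_self[OF dR.H_facts(2)[of g] g(1)])
  next
    case (homog k b)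
    then show ?case using a g A_closed ring_grading_mult[OF g(1) homog(1) a homog(2)]
      by (simp add: dR.component_self[of _ "g \<otimes>\<^bsub>G\<^esub> k"] dR.component_self[of b k])
  next
    case (add b c)
    then show ?case using a g A_closed[OF a g(1)] 
      by (simp add: R.r_distr dR.component_add dR.component_closed)
  qed
  have "a \<otimes>\<^bsub>R\<^esub> ?e = a" if "a \<in> carrier R" for a
    using that
  proof (induction rule: hom_induct)
    case (homog g b)
    then show ?case using *[of b g "\<one>\<^bsub>G\<^esub>" "\<one>\<^bsub>R\<^esub>"] A_closed[OF homog(2,1)] by (simp add: dR.component_self)
  qed (use e in \<open>simp_all add: R.l_distr\<close>)
  from this[of "\<one>\<^bsub>R\<^esub>"] e show ?thesis by simp
qed

end

lemma gr_regular_simps [simp]: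
  "carrier (gr_regular R A) = carrier R" "zero (gr_regular R A) = zero R"
  "add (gr_regular R A) = add R" "smult (gr_regular R A) = mult R" "hcomp (gr_regular R A) = A"
  by (simp_all add: gr_regular_def)

lemma abelian_group_record:
  assumes "abelian_group M" "carrier K = carrier M" "add K = add M" "zero K = zero M"
  shows "abelian_group K"
proof -
  interpret M: abelian_group M by fact
  show ?thesis
  proof (rule abelian_groupI)
    show "\<exists>y\<in>carrier K. y \<oplus>\<^bsub>K\<^esub> x = \<zero>\<^bsub>K\<^esub>" if "x \<in> carrier K" for x
      using that assms(2-) by (auto intro!: bexI[of _ "\<ominus>\<^bsub>M\<^esub> x"] simp: M.l_neg)
  qed (simp_all add: assms(2-) M.a_ac)
qed

lemma a_inv_record_eq:
  assumes "carrier K = carrier M" "add K = add M" "zero K = zero M"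
  shows "a_inv K = a_inv M"
  using assms by (intro ext) (simp add: a_inv_def m_inv_def)

lemma additive_subgroup_record:
  assumes "abelian_group M" "carrier K = carrier M" "add K = add M" "zero K = zero M"
  shows "additive_subgroup H K \<longleftrightarrow> additive_subgroup H M"
  unfolding abelian_group.additive_subgroup_iff[OF assms(1)]
    abelian_group.additive_subgroup_iff[OF abelian_group_record[OF assms]]
  using a_inv_record_eq[OF assms(2-)] assms by simp

lemma internal_direct_sum_record:
  assumes "abelian_group M" "carrier K = carrier M" "add K = add M" "zero K = zero M"
  shows "internal_direct_sum K I H \<longleftrightarrow> internal_direct_sum M I H"
  unfolding internal_direct_sum_def additive_subgroup_record[OF assms] finsum_record_eq[OF assms(2-)]
  using assms by simp

lemma (in graded_ring) graded_regular: "graded_module G R A (gr_regular R A)"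
proof -
  have ab: "abelian_group (gr_regular R A)"
    by (rule abelian_group_record[OF R.abelian_group_axioms]) simp_all
  show ?thesis
  proof (intro graded_module.intro graded_module_axioms.intro left_module.intro left_module_axioms.intro)
    show "internal_direct_sum (gr_regular R A) (carrier G) (hcomp (gr_regular R A))"
      using ring_grading internal_direct_sum_record[OF R.abelian_group_axioms, of "gr_regular R A" "carrier G" A] by simp
    show "graded_ring G R A" by (rule graded_ring_axioms)
    show "ring R" by (rule R.ring_axioms)
    show "abelian_group (gr_regular R A)" by (rule ab)
    show "a \<odot>\<^bsub>gr_regular R A\<^esub> x \<in> hcomp (gr_regular R A) (g \<otimes>\<^bsub>G\<^esub> h)"
      if "g \<in> carrier G" "h \<in> carrier G" "a \<in> A g" "x \<in> hcomp (gr_regular R A) h" for g h a x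
      using that ring_grading_mult by simp
  qed (simp_all add: R.l_distr R.r_distr R.m_assoc)
qed

section \<open>Homogeneous components and graded submodules\<close>

context graded_module
begin

lemma hcomp_closed: "x \<in> hcomp M g \<Longrightarrow> g \<in> carrier G \<Longrightarrow> x \<in> carrier M"
  using dM.H_facts(1) by blast

lemma mhom_induct [consumes 1, case_names zero homog add]:
  assumes "x \<in> carrier M" "Q \<zero>\<^bsub>M\<^esub>" "\<And>g y. g \<in> carrier G \<Longrightarrow> y \<in> hcomp M g \<Longrightarrow> Q y"
    "\<And>y z. y \<in> carrier M \<Longrightarrow> z \<in> carrier M \<Longrightarrow> Q y \<Longrightarrow> Q z \<Longrightarrow> Q (y \<oplus>\<^bsub>M\<^esub> z)"
  shows "Q x"
  by (rule dM.component_induct[OF assms(1,2) _ assms(4)]) (use assms dM.component_in in auto)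

lemma component_zero: "g \<in> carrier G \<Longrightarrow> dM.c \<zero>\<^bsub>M\<^esub> g = \<zero>\<^bsub>M\<^esub>"
  by (simp add: dM.component_self[OF dM.H_facts(2)[of g]])

lemma component_smult:
  assumes "a \<in> A g" "g \<in> carrier G" "h \<in> carrier G" "x \<in> carrier M"
  shows "dM.c (a \<odot>\<^bsub>M\<^esub> x) (g \<otimes>\<^bsub>G\<^esub> h) = a \<odot>\<^bsub>M\<^esub> dM.c x h"
  using assms(4)
proof (induction rule: mhom_induct)
  case zero
  then show ?case using assms A_closed by (simp add: smult_r_null component_zero)
next
  case (homog k b)
  then show ?case using assms A_closed[OF assms(1,2)] module_grading_smult[OF assms(2) homog(1) assms(1) homog(2)]
    by (simp add: dM.component_self[of _ "g \<otimes>\<^bsub>G\<^esub> k"] dM.component_self[of b k] smult_r_null)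
next
  case (add b c)
  then show ?case using assms A_closed[OF assms(1,2)]
    by (simp add: smult_r_distr dM.component_add dM.component_closed smult_closed)
qed

text \<open>For homogeneous x, an equation between a x and a homogeneous element therefore survives
  replacing a by one of its components; this is how coefficients and idempotents are made
  homogeneous.\<close>

lemma component_smult2:
  assumes "x \<in> hcomp M h" "g \<in> carrier G" "h \<in> carrier G" "a \<in> carrier R"
  shows "dM.c (a \<odot>\<^bsub>M\<^esub> x) (g \<otimes>\<^bsub>G\<^esub> h) = dR.c a g \<odot>\<^bsub>M\<^esub> x"
  using assms(4)
proof (induction rule: hom_induct)
  case zero
  then show ?case using assms hcomp_closed[OF assms(1,3)]
    by (simp add: smult_l_null component_zero dR.component_self[OF dR.H_facts(2)[of g]])
next
  case (homog k b)
  then show ?case using assms hcomp_closed[OF assms(1,3)] module_grading_smult[OF homog(1) assms(3) homog(2) assms(1)]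
    by (simp add: dM.component_self[of _ "k \<otimes>\<^bsub>G\<^esub> h"] dR.component_self[of b k] smult_l_null)
next
  case (add b c)
  then show ?case using assms hcomp_closed[OF assms(1,3)]
    by (simp add: smult_l_distr dM.component_add dR.component_add dR.component_closed smult_closed)
qed

text \<open>A working form of \<open>gr_submodule\<close>: closure under components replaces the
  direct sum decomposition. It passes to intersections, and closure under negatives comes from the
  scalar -1.\<close>

definition gsub :: "'b set \<Rightarrow> bool" where
  "gsub N \<longleftrightarrow> N \<subseteq> carrier M \<and> \<zero>\<^bsub>M\<^esub> \<in> N \<and> (\<forall>x\<in>N. \<forall>y\<in>N. x \<oplus>\<^bsub>M\<^esub> y \<in> N) \<and>
     (\<forall>a\<in>carrier R. \<forall>x\<in>N. a \<odot>\<^bsub>M\<^esub> x \<in> N) \<and> (\<forall>x\<in>N. \<forall>g\<in>carrier G. dM.c x g \<in> N)"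

lemma gsubD:
  assumes "gsub N"
  shows "N \<subseteq> carrier M" "\<zero>\<^bsub>M\<^esub> \<in> N" "\<And>x y. x \<in> N \<Longrightarrow> y \<in> N \<Longrightarrow> x \<oplus>\<^bsub>M\<^esub> y \<in> N"
     "\<And>a x. a \<in> carrier R \<Longrightarrow> x \<in> N \<Longrightarrow> a \<odot>\<^bsub>M\<^esub> x \<in> N"
     "\<And>g x. x \<in> N \<Longrightarrow> g \<in> carrier G \<Longrightarrow> dM.c x g \<in> N"
     "\<And>x. x \<in> N \<Longrightarrow> \<ominus>\<^bsub>M\<^esub> x \<in> N"
proof -
  show "\<ominus>\<^bsub>M\<^esub> x \<in> N" if "x \<in> N" for x
    using assms that minus_smult[of x] R.a_inv_closed[OF R.one_closed] unfolding gsub_def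
    by (metis subsetD)
qed (use assms in \<open>auto simp: gsub_def\<close>)

text \<open>Homogeneous scalars suffice, since every scalar is a sum of such and the set is closed
  under addition.\<close>

lemma gsubI:
  assumes "N \<subseteq> carrier M" "\<zero>\<^bsub>M\<^esub> \<in> N" "\<And>x y. x \<in> N \<Longrightarrow> y \<in> N \<Longrightarrow> x \<oplus>\<^bsub>M\<^esub> y \<in> N"
     "\<And>g a x. g \<in> carrier G \<Longrightarrow> a \<in> A g \<Longrightarrow> x \<in> N \<Longrightarrow> a \<odot>\<^bsub>M\<^esub> x \<in> N"
     "\<And>g x. g \<in> carrier G \<Longrightarrow> x \<in> N \<Longrightarrow> dM.c x g \<in> N"
  shows "gsub N"
proof -
  have "a \<odot>\<^bsub>M\<^esub> x \<in> N" if a: "a \<in> carrier R" and x: "x \<in> N" for a x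
    using a
  proof (induction rule: hom_induct)
    have xc: "x \<in> carrier M" using assms(1) x by blast
    case zero
    show ?case using assms(2) by (simp add: smult_l_null xc)
  next
    have xc: "x \<in> carrier M" using assms(1) x by blast
    case (add b c)
    then show ?case using assms(3) by (simp add: smult_l_distr xc)
  next
    case (homog g b)
    then show ?case using assms(4) x by blast
  qed
  then show ?thesis using assms(1-3,5) unfolding gsub_def by blast
qed

lemma gsub_additive_subgroup: "gsub N \<Longrightarrow> additive_subgroup N M"
  unfolding M.additive_subgroup_iff by (intro conjI ballI) (rule gsubD; assumption)+

text \<open>K stands for the record update inside \<open>gr_submodule\<close> as well as for
  \<open>gr_restrict\<close>. Components taken in N agree with those taken in M because a
  decomposition inside N is also one inside M.\<close>

lemma gsub_record:
  assumes N: "gsub N" and K: "carrier K = N" "add K = add M" "zero K = zero M"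
  shows "abelian_group K" "internal_direct_sum K (carrier G) (\<lambda>g. N \<inter> hcomp M g)"
    "\<And>x g. x \<in> N \<Longrightarrow> g \<in> carrier G \<Longrightarrow> component K (carrier G) (\<lambda>g. N \<inter> hcomp M g) x g = dM.c x g"
proof -
  note [simp] = K
  note gD = gsubD[OF N]
  have Nc: "x \<in> carrier M" if "x \<in> N" for x using gD(1) that by blast
  show ab: "abelian_group K"
  proof (rule abelian_groupI)
    fix x assume "x \<in> carrier K"
    then show "\<exists>y\<in>carrier K. y \<oplus>\<^bsub>K\<^esub> x = \<zero>\<^bsub>K\<^esub>"
      using gD(6)[of x] Nc[of x] by (auto intro!: bexI[of _ "\<ominus>\<^bsub>M\<^esub> x"] simp: M.l_neg)
  qed (simp_all add: Nc M.a_ac gD(2,3))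
  then interpret K: abelian_group K .
  have inv: "\<ominus>\<^bsub>K\<^esub> x = \<ominus>\<^bsub>M\<^esub> x" if "x \<in> N" for x
    using that gD(6) Nc by (intro K.minus_equality) (auto simp: M.l_neg)
  show ids: "internal_direct_sum K (carrier G) (\<lambda>g. N \<inter> hcomp M g)"
  proof (rule K.internal_direct_sumI[where d = dM.c])
    show "additive_subgroup (N \<inter> hcomp M g) K" if "g \<in> carrier G" for g
      using gD(2,3,6) dM.H_facts[OF that] inv by (auto simp: K.additive_subgroup_iff)
    show "finite {i \<in> carrier G. dM.c x i \<noteq> \<zero>\<^bsub>K\<^esub>}" if "x \<in> carrier K" for x
      using dM.component_props(2)[OF Nc] that by simp
    show "dM.c (x \<oplus>\<^bsub>K\<^esub> y) i = dM.c x i \<oplus>\<^bsub>K\<^esub> dM.c y i"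
      if "x \<in> carrier K" "y \<in> carrier K" "i \<in> carrier G" for x y i
      using that by (simp add: Nc dM.component_add)
    show "x = \<zero>\<^bsub>K\<^esub>" if "x \<in> carrier K" "\<And>i. i \<in> carrier G \<Longrightarrow> dM.c x i = \<zero>\<^bsub>K\<^esub>" for x
      using that by (rule_tac dM.component_ext) (simp_all add: Nc component_zero)
    show "dM.c x i \<in> N \<inter> hcomp M i" if "x \<in> carrier K" "i \<in> carrier G" for x i
      using that by (simp add: gD(5) Nc dM.component_in)
    show "dM.c x i = (if i = j then x else \<zero>\<^bsub>K\<^esub>)"
      if "i \<in> carrier G" "j \<in> carrier G" "x \<in> N \<inter> hcomp M j" for x i j
      using that dM.component_self[of x j i] by simp
  qed
  fix x g assume x: "x \<in> N" and g: "g \<in> carrier G"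
  interpret K: direct_sum_decomp K "carrier G" "\<lambda>g. N \<inter> hcomp M g" by unfold_locales (rule ids)
  let ?S = "{i \<in> carrier G. K.c x i \<noteq> \<zero>\<^bsub>K\<^esub>}"
  have xK: "x \<in> carrier K" using x by simp
  have "x = finsum K (K.c x) ?S" using K.component_props(3)[OF xK] .
  also have "\<dots> = finsum M (K.c x) ?S"
    using K.additive_finsum[of ?S "K.c x" M "\<lambda>x. x"] K.component_props(2)[OF xK] K.component_closed[OF xK]
      M.abelian_group_axioms Nc by auto
  finally have "dM.c x g = dM.c (finsum M (K.c x) ?S) g" by simp
  also have "\<dots> = (if g \<in> ?S then K.c x g else \<zero>\<^bsub>M\<^esub>)"
    by (rule dM.component_finsum) (use K.component_props(2)[OF xK] K.component_in[OF xK] g in auto)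
  finally show "K.c x g = dM.c x g" using g by auto
qed

lemma gr_submodule_iff: "gr_submodule G R M N \<longleftrightarrow> gsub N"
proof
  assume N: "gr_submodule G R M N"
  let ?K = "M\<lparr>carrier := N\<rparr>"
  have sub: "additive_subgroup N M" and sm: "\<And>a x. a \<in> carrier R \<Longrightarrow> x \<in> N \<Longrightarrow> a \<odot>\<^bsub>M\<^esub> x \<in> N"
    and ids: "internal_direct_sum ?K (carrier G) (\<lambda>g. N \<inter> hcomp M g)"
    using N by (auto simp: gr_submodule_def)
  have Nc: "x \<in> carrier M" if "x \<in> N" for x using sub that by (auto simp: M.additive_subgroup_iff)
  note sub' = sub[unfolded M.additive_subgroup_iff]
  interpret K: abelian_group ?K
  proof (rule abelian_groupI)
    fix x assume "x \<in> carrier ?K"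
    then show "\<exists>y\<in>carrier ?K. y \<oplus>\<^bsub>?K\<^esub> x = \<zero>\<^bsub>?K\<^esub>"
      using sub' Nc[of x] by (auto intro!: bexI[of _ "\<ominus>\<^bsub>M\<^esub> x"] simp: M.l_neg)
  qed (simp_all add: Nc M.a_ac sub')
  interpret K: direct_sum_decomp ?K "carrier G" "\<lambda>g. N \<inter> hcomp M g" by unfold_locales (rule ids)
  have "dM.c x g \<in> N" if x: "x \<in> N" and g: "g \<in> carrier G" for x g
  proof -
    let ?S = "{i \<in> carrier G. K.c x i \<noteq> \<zero>\<^bsub>?K\<^esub>}"
    have xK: "x \<in> carrier ?K" using x by simp
    have "x = finsum ?K (K.c x) ?S" using K.component_props(3)[OF xK] .
    also have "\<dots> = finsum M (K.c x) ?S"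
      using K.additive_finsum[of ?S "K.c x" M "\<lambda>x. x"] K.component_props(2)[OF xK] K.component_closed[OF xK]
        M.abelian_group_axioms Nc by auto
    finally have "dM.c x g = dM.c (finsum M (K.c x) ?S) g" by simp
    also have "\<dots> = (if g \<in> ?S then K.c x g else \<zero>\<^bsub>M\<^esub>)"
      by (rule dM.component_finsum) (use K.component_props(2)[OF xK] K.component_in[OF xK] g in auto)
    also have "\<dots> \<in> N" using K.component_in[OF xK g] sub' by auto
    finally show ?thesis .
  qed
  then show "gsub N" using sub' sm by (auto simp: gsub_def)
next
  assume N: "gsub N"
  show "gr_submodule G R M N"
    unfolding gr_submodule_def
    using gsub_record(2)[OF N, of "M\<lparr>carrier := N\<rparr>"] gsub_additive_subgroup[OF N] gsubD(4)[OF N] by simp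
qed

lemma gr_restrict_simps [simp]:
  "carrier (gr_restrict M N) = N" "zero (gr_restrict M N) = zero M"
  "add (gr_restrict M N) = add M" "smult (gr_restrict M N) = smult M"
  "hcomp (gr_restrict M N) = (\<lambda>g. N \<inter> hcomp M g)"
  by (simp_all add: gr_restrict_def)

lemma graded_restrict:
  assumes "gsub N"
  shows "graded_module G R A (gr_restrict M N)"
proof (intro graded_module.intro graded_module_axioms.intro left_module.intro left_module_axioms.intro)
  have Nc: "x \<in> carrier M" if "x \<in> N" for x using gsubD(1)[OF assms] that by blast
  show "internal_direct_sum (gr_restrict M N) (carrier G) (hcomp (gr_restrict M N))"
    using gsub_record(2)[OF assms, of "gr_restrict M N"] by simp
  show "abelian_group (gr_restrict M N)" using gsub_record(1)[OF assms, of "gr_restrict M N"] by simp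
  show "ring R" by (rule R.ring_axioms)
  show "graded_ring G R A" by (rule graded_ring_axioms)
  show "a \<odot>\<^bsub>gr_restrict M N\<^esub> x \<in> hcomp (gr_restrict M N) (g \<otimes>\<^bsub>G\<^esub> h)"
    if "g \<in> carrier G" "h \<in> carrier G" "a \<in> A g" "x \<in> hcomp (gr_restrict M N) h" for g h a x
    using that gsubD(4)[OF assms] A_closed module_grading_smult by auto
qed (use gsubD(4)[OF assms] gsubD(1)[OF assms] in
    \<open>auto simp: smult_l_distr smult_r_distr smult_assoc smult_one subset_iff\<close>)

lemma gsub_restrict_iff:
  assumes U: "gsub U"
  shows "graded_module.gsub G R (gr_restrict M U) N \<longleftrightarrow> gsub N \<and> N \<subseteq> U"
proof -
  interpret U: graded_module G R A "gr_restrict M U" by (rule graded_restrict[OF U])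
  have "U.dM.c x g = dM.c x g" if "x \<in> U" "g \<in> carrier G" for x g
    using gsub_record(3)[OF U, of "gr_restrict M U"] that by simp
  then show ?thesis using gsubD(1)[OF U] unfolding U.gsub_def gsub_def by (auto simp: subset_iff)
qed

text \<open>The equation N + N' = U already places both summands inside U, so they may range over
  the graded submodules of M. For M = R, indecomposability of a left ideal is thus tested with left
  ideals of R.\<close>

lemma gr_indecomposable_restrict:
  assumes U: "gsub U"
  shows "gr_indecomposable G R (gr_restrict M U) \<longleftrightarrow> U \<noteq> {\<zero>\<^bsub>M\<^esub>} \<and>
    (\<forall>N N'. gsub N \<and> gsub N' \<and> {x \<oplus>\<^bsub>M\<^esub> y |x y. x \<in> N \<and> y \<in> N'} = U \<and> N \<inter> N' = {\<zero>\<^bsub>M\<^esub>} \<longrightarrow>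
       N = {\<zero>\<^bsub>M\<^esub>} \<or> N' = {\<zero>\<^bsub>M\<^esub>})"
proof -
  interpret U: graded_module G R A "gr_restrict M U" by (rule graded_restrict[OF U])
  have add: "N <+>\<^bsub>gr_restrict M U\<^esub> N' = {x \<oplus>\<^bsub>M\<^esub> y |x y. x \<in> N \<and> y \<in> N'}" for N N'
    by (auto simp: set_add_def')
  have le: "N \<subseteq> U" "N' \<subseteq> U"
    if N: "gsub N" "gsub N'" and U: "{x \<oplus>\<^bsub>M\<^esub> y |x y. x \<in> N \<and> y \<in> N'} = U" for N N'
  proof -
    note c = gsubD(1,2)[OF N(1)] gsubD(1,2)[OF N(2)]
    show "N \<subseteq> U"
    proof
      fix x assume x: "x \<in> N"
      then have "x \<in> carrier M" using c by blast
      then have "x = x \<oplus>\<^bsub>M\<^esub> \<zero>\<^bsub>M\<^esub>" by simp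
      then show "x \<in> U" unfolding U[symmetric] using c(4) x by blast
    qed
    show "N' \<subseteq> U"
    proof
      fix x assume x: "x \<in> N'"
      then have "x \<in> carrier M" using c by blast
      then have "x = \<zero>\<^bsub>M\<^esub> \<oplus>\<^bsub>M\<^esub> x" by simp
      then show "x \<in> U" unfolding U[symmetric] using c(2) x by blast
    qed
  qed
  have iff: "(gsub N \<and> N \<subseteq> U) \<and> (gsub N' \<and> N' \<subseteq> U) \<and> {x \<oplus>\<^bsub>M\<^esub> y |x y. x \<in> N \<and> y \<in> N'} = U \<and> Z \<longleftrightarrow>
      gsub N \<and> gsub N' \<and> {x \<oplus>\<^bsub>M\<^esub> y |x y. x \<in> N \<and> y \<in> N'} = U \<and> Z" for N N' Z
    using le[of N N'] by argo
  show ?thesis unfolding gr_indecomposable_def U.gr_submodule_iff gsub_restrict_iff[OF U] add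
      gr_restrict_simps iff ..
qed

end

section \<open>Morphisms, shifts and direct sums\<close>

lemma gr_homI:
  assumes "\<And>x. x \<in> carrier M \<Longrightarrow> f x \<in> carrier N"
    "\<And>x y. x \<in> carrier M \<Longrightarrow> y \<in> carrier M \<Longrightarrow> f (x \<oplus>\<^bsub>M\<^esub> y) = f x \<oplus>\<^bsub>N\<^esub> f y"
    "\<And>a x. a \<in> carrier R \<Longrightarrow> x \<in> carrier M \<Longrightarrow> f (a \<odot>\<^bsub>M\<^esub> x) = a \<odot>\<^bsub>N\<^esub> f x"
    "\<And>g x. g \<in> carrier G \<Longrightarrow> x \<in> hcomp M g \<Longrightarrow> f x \<in> hcomp N g"
  shows "f \<in> gr_hom G R M N"
  using assms by (auto simp: gr_hom_def)

lemma gr_homD: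
  assumes "f \<in> gr_hom G R M N"
  shows "\<And>x. x \<in> carrier M \<Longrightarrow> f x \<in> carrier N"
    "\<And>x y. x \<in> carrier M \<Longrightarrow> y \<in> carrier M \<Longrightarrow> f (x \<oplus>\<^bsub>M\<^esub> y) = f x \<oplus>\<^bsub>N\<^esub> f y"
    "\<And>a x. a \<in> carrier R \<Longrightarrow> x \<in> carrier M \<Longrightarrow> f (a \<odot>\<^bsub>M\<^esub> x) = a \<odot>\<^bsub>N\<^esub> f x"
    "\<And>g x. g \<in> carrier G \<Longrightarrow> x \<in> hcomp M g \<Longrightarrow> f x \<in> hcomp N g"
  using assms by (auto simp: gr_hom_def image_subset_iff)

lemma gr_hom_comp:
  assumes f: "f \<in> gr_hom G R M N" and h: "h \<in> gr_hom G R N K"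
  shows "(\<lambda>x. h (f x)) \<in> gr_hom G R M K"
  by (rule gr_homI) (simp_all add: gr_homD[OF f] gr_homD[OF h])

lemma gr_hom_id: "(\<lambda>x. x) \<in> gr_hom G R M M"
  by (rule gr_homI) auto

lemma gr_iso_refl: "gr_iso G R M M"
  unfolding gr_iso_def by (rule bexI[OF _ gr_hom_id], rule bexI[OF _ gr_hom_id]) simp

lemma gr_iso_sym: "gr_iso G R M N \<Longrightarrow> gr_iso G R N M"
  unfolding gr_iso_def by blast

lemma gr_iso_trans:
  assumes "gr_iso G R M N" "gr_iso G R N K"
  shows "gr_iso G R M K"
proof -
  obtain f f' where f: "f \<in> gr_hom G R M N" "f' \<in> gr_hom G R N M"
    "\<And>x. x \<in> carrier M \<Longrightarrow> f' (f x) = x" "\<And>y. y \<in> carrier N \<Longrightarrow> f (f' y) = y"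
    using assms(1) unfolding gr_iso_def by blast
  obtain h h' where h: "h \<in> gr_hom G R N K" "h' \<in> gr_hom G R K N"
    "\<And>x. x \<in> carrier N \<Longrightarrow> h' (h x) = x" "\<And>y. y \<in> carrier K \<Longrightarrow> h (h' y) = y"
    using assms(2) unfolding gr_iso_def by blast
  show ?thesis
    unfolding gr_iso_def
    using gr_hom_comp[OF f(1) h(1)] gr_hom_comp[OF h(2) f(2)]
    by (intro bexI[of _ "\<lambda>x. h (f x)"] bexI[of _ "\<lambda>x. f' (h' x)"])
      (simp_all add: f h gr_homD(1)[OF f(1)] gr_homD(1)[OF h(2)])
qed

lemma gr_hom_zero:
  assumes "graded_module G R A M" "graded_module G R A N" "f \<in> gr_hom G R M N"
  shows "f \<zero>\<^bsub>M\<^esub> = \<zero>\<^bsub>N\<^esub>"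
proof -
  interpret M: graded_module G R A M by fact
  interpret N: graded_module G R A N by fact
  have "f \<zero>\<^bsub>M\<^esub> \<in> carrier N" using gr_homD(1)[OF assms(3)] by simp
  moreover have "f \<zero>\<^bsub>M\<^esub> \<oplus>\<^bsub>N\<^esub> f \<zero>\<^bsub>M\<^esub> = f \<zero>\<^bsub>M\<^esub>"
    using gr_homD(2)[OF assms(3), of "\<zero>\<^bsub>M\<^esub>" "\<zero>\<^bsub>M\<^esub>"] by simp
  ultimately show ?thesis by (simp add: N.M.add.l_cancel_one')
qed

lemma gr_hom_component:
  assumes "graded_module G R A M" "graded_module G R A N" "f \<in> gr_hom G R M N"
    "x \<in> carrier M" "g \<in> carrier G"
  shows "component N (carrier G) (hcomp N) (f x) g = f (component M (carrier G) (hcomp M) x g)"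
proof -
  interpret M: graded_module G R A M by fact
  interpret N: graded_module G R A N by fact
  note f = gr_homD[OF assms(3)]
  show ?thesis using assms(4)
  proof (induction rule: M.mhom_induct)
    case zero
    then show ?case by (simp add: assms gr_hom_zero[OF assms(1-3)] M.component_zero N.component_zero)
  next
    case (homog h y)
    then show ?case using f(4)[OF homog] assms(5)
      by (simp add: M.dM.component_self[of y h] N.dM.component_self[of _ h] gr_hom_zero[OF assms(1-3)])
  next
    case (add y z)
    then show ?case using assms(5) f(1,2)
      by (simp add: M.dM.component_add N.dM.component_add M.dM.component_closed)
  qed
qed

lemma gr_shift_simps [simp]:
  "carrier (gr_shift G M \<sigma>) = carrier M" "zero (gr_shift G M \<sigma>) = zero M"
  "add (gr_shift G M \<sigma>) = add M" "smult (gr_shift G M \<sigma>) = smult M"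
  "hcomp (gr_shift G M \<sigma>) = (\<lambda>g. hcomp M (g \<otimes>\<^bsub>G\<^esub> \<sigma>))"
  by (simp_all add: gr_shift_def)

lemma graded_shift:
  assumes "graded_module G R A M" "\<sigma> \<in> carrier G"
  shows "graded_module G R A (gr_shift G M \<sigma>)"
proof -
  interpret graded_module G R A M by fact
  have ab: "abelian_group (gr_shift G M \<sigma>)"
    by (rule abelian_group_record[OF M.abelian_group_axioms]) simp_all
  then interpret S: abelian_group "gr_shift G M \<sigma>" .
  show ?thesis
  proof (intro graded_module.intro graded_module_axioms.intro left_module.intro left_module_axioms.intro)
    show "internal_direct_sum (gr_shift G M \<sigma>) (carrier G) (hcomp (gr_shift G M \<sigma>))"
    proof (rule S.internal_direct_sumI[where d = "\<lambda>x g. dM.c x (g \<otimes>\<^bsub>G\<^esub> \<sigma>)"])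
      show "additive_subgroup (hcomp (gr_shift G M \<sigma>) g) (gr_shift G M \<sigma>)" if "g \<in> carrier G" for g
        using dM.subgroupH[of "g \<otimes>\<^bsub>G\<^esub> \<sigma>"] that assms(2)
          additive_subgroup_record[OF M.abelian_group_axioms, of "gr_shift G M \<sigma>" "hcomp M (g \<otimes>\<^bsub>G\<^esub> \<sigma>)"]
        by simp
      show "finite {g \<in> carrier G. dM.c x (g \<otimes>\<^bsub>G\<^esub> \<sigma>) \<noteq> \<zero>\<^bsub>gr_shift G M \<sigma>\<^esub>}"
        if "x \<in> carrier (gr_shift G M \<sigma>)" for x
      proof (rule inj_on_finite[where f = "\<lambda>g. g \<otimes>\<^bsub>G\<^esub> \<sigma>"])
        show "inj_on (\<lambda>g. g \<otimes>\<^bsub>G\<^esub> \<sigma>) {g \<in> carrier G. dM.c x (g \<otimes>\<^bsub>G\<^esub> \<sigma>) \<noteq> \<zero>\<^bsub>gr_shift G M \<sigma>\<^esub>}"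
          using assms(2) by (auto simp: inj_on_def)
        show "finite {g \<in> carrier G. dM.c x g \<noteq> \<zero>\<^bsub>M\<^esub>}"
          using that dM.component_props(2) by simp
      qed (use assms in auto)
      show "x = \<zero>\<^bsub>gr_shift G M \<sigma>\<^esub>" if x: "x \<in> carrier (gr_shift G M \<sigma>)"
        and z: "\<And>g. g \<in> carrier G \<Longrightarrow> dM.c x (g \<otimes>\<^bsub>G\<^esub> \<sigma>) = \<zero>\<^bsub>gr_shift G M \<sigma>\<^esub>" for x
      proof -
        have "dM.c x g = dM.c \<zero>\<^bsub>M\<^esub> g" if "g \<in> carrier G" for g
          using z[of "g \<otimes>\<^bsub>G\<^esub> inv\<^bsub>G\<^esub> \<sigma>"] that assms(2)
          by (simp add: G.m_assoc component_zero)
        then show ?thesis using x by (simp add: dM.component_ext)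
      qed
      show "dM.c x (i \<otimes>\<^bsub>G\<^esub> \<sigma>) = (if i = j then x else \<zero>\<^bsub>gr_shift G M \<sigma>\<^esub>)"
        if "i \<in> carrier G" "j \<in> carrier G" "x \<in> hcomp (gr_shift G M \<sigma>) j" for x i j
        using that assms(2) dM.component_self[of x "j \<otimes>\<^bsub>G\<^esub> \<sigma>" "i \<otimes>\<^bsub>G\<^esub> \<sigma>"] by simp
    qed (use assms(2) in \<open>simp_all add: dM.component_in dM.component_add\<close>)
    show "a \<odot>\<^bsub>gr_shift G M \<sigma>\<^esub> x \<in> hcomp (gr_shift G M \<sigma>) (g \<otimes>\<^bsub>G\<^esub> h)"
      if "g \<in> carrier G" "h \<in> carrier G" "a \<in> A g" "x \<in> hcomp (gr_shift G M \<sigma>) h" for g h a x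
      using that assms(2) module_grading_smult[of g "h \<otimes>\<^bsub>G\<^esub> \<sigma>" a x] by (simp add: G.m_assoc)
    show "graded_ring G R A" by (rule graded_ring_axioms)
    show "ring R" by (rule R.ring_axioms)
    show "abelian_group (gr_shift G M \<sigma>)" by (rule ab)
  qed (simp_all add: smult_closed smult_l_distr smult_r_distr smult_assoc smult_one)
qed

lemma gr_direct_sum_simps:
  "carrier (gr_direct_sum I M) = {x \<in> \<Pi>\<^sub>E i\<in>I. carrier (M i). finite {i\<in>I. x i \<noteq> \<zero>\<^bsub>M i\<^esub>}}"
  "\<zero>\<^bsub>gr_direct_sum I M\<^esub> = (\<lambda>i\<in>I. \<zero>\<^bsub>M i\<^esub>)"
  "x \<oplus>\<^bsub>gr_direct_sum I M\<^esub> y = (\<lambda>i\<in>I. x i \<oplus>\<^bsub>M i\<^esub> y i)"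
  "a \<odot>\<^bsub>gr_direct_sum I M\<^esub> x = (\<lambda>i\<in>I. a \<odot>\<^bsub>M i\<^esub> x i)"
  "hcomp (gr_direct_sum I M) g = {x \<in> carrier (gr_direct_sum I M). \<forall>i\<in>I. x i \<in> hcomp (M i) g}"
  by (simp_all add: gr_direct_sum_def Let_def)

section \<open>Direct sums of families of graded modules\<close>

locale graded_family = graded_ring G R A
  for G :: "('g, 'e) monoid_scheme" (structure) and R :: "('a, 'c) ring_scheme" (structure)
    and A :: "'g \<Rightarrow> 'a set" +
  fixes I :: "'i set" and M :: "'i \<Rightarrow> ('a, 'b, 'g) gr_module"
  assumes graded: "i \<in> I \<Longrightarrow> graded_module G R A (M i)"
begin

abbreviation "F \<equiv> gr_direct_sum I M"
abbreviation "cM i \<equiv> component (M i) (carrier G) (hcomp (M i))"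

lemma ab: "i \<in> I \<Longrightarrow> abelian_group (M i)"
  using graded graded_module.axioms(2) left_module.axioms(2) by blast

lemma carrierF: "x \<in> carrier F \<longleftrightarrow> x \<in> extensional I \<and> (\<forall>i\<in>I. x i \<in> carrier (M i)) \<and>
    finite {i\<in>I. x i \<noteq> \<zero>\<^bsub>M i\<^esub>}"
  by (auto simp: gr_direct_sum_simps PiE_iff)

lemma carrierFD: "x \<in> carrier F \<Longrightarrow> i \<in> I \<Longrightarrow> x i \<in> carrier (M i)"
  by (simp add: carrierF)

lemma finite_support_image:
  assumes "x \<in> carrier F" "\<And>i. i \<in> I \<Longrightarrow> x i = \<zero>\<^bsub>M i\<^esub> \<Longrightarrow> y i = \<zero>\<^bsub>M i\<^esub>"
  shows "finite {i\<in>I. y i \<noteq> \<zero>\<^bsub>M i\<^esub>}"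
  by (rule finite_subset[of _ "{i\<in>I. x i \<noteq> \<zero>\<^bsub>M i\<^esub>}"]) (use assms in \<open>auto simp: carrierF\<close>)

lemma F_zero: "\<zero>\<^bsub>F\<^esub> \<in> carrier F"
  using ab by (auto simp: carrierF gr_direct_sum_simps(2) abelian_group.a_inv_closed abelian_groupE(2))

lemma F_add: assumes "x \<in> carrier F" "y \<in> carrier F" shows "x \<oplus>\<^bsub>F\<^esub> y \<in> carrier F"
proof -
  have "finite {i\<in>I. (x \<oplus>\<^bsub>F\<^esub> y) i \<noteq> \<zero>\<^bsub>M i\<^esub>}"
    by (rule finite_subset[of _ "{i\<in>I. x i \<noteq> \<zero>\<^bsub>M i\<^esub>} \<union> {i\<in>I. y i \<noteq> \<zero>\<^bsub>M i\<^esub>}"])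
      (use assms in \<open>auto simp: carrierF gr_direct_sum_simps(3) abelian_groupE(2,5)[OF ab]\<close>)
  then show ?thesis using assms by (auto simp: carrierF gr_direct_sum_simps(3) abelian_groupE(1)[OF ab])
qed

lemma F_smult: assumes "a \<in> carrier R" "x \<in> carrier F" shows "a \<odot>\<^bsub>F\<^esub> x \<in> carrier F"
proof -
  have "finite {i\<in>I. (a \<odot>\<^bsub>F\<^esub> x) i \<noteq> \<zero>\<^bsub>M i\<^esub>}"
  proof (rule finite_support_image[OF assms(2)])
    fix i assume i: "i \<in> I" and z: "x i = \<zero>\<^bsub>M i\<^esub>"
    interpret graded_module G R A "M i" by (rule graded[OF i])
    show "(a \<odot>\<^bsub>F\<^esub> x) i = \<zero>\<^bsub>M i\<^esub>" using i z assms(1) by (simp add: gr_direct_sum_simps(4) smult_r_null)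
  qed
  moreover have "(a \<odot>\<^bsub>F\<^esub> x) i \<in> carrier (M i)" if i: "i \<in> I" for i
  proof -
    interpret graded_module G R A "M i" by (rule graded[OF i])
    show ?thesis using i assms carrierFD[OF assms(2) i] by (simp add: gr_direct_sum_simps(4) smult_closed)
  qed
  ultimately show ?thesis by (auto simp: carrierF gr_direct_sum_simps(4))
qed

lemma F_abelian_group: "abelian_group F"
proof (rule abelian_groupI)
  fix x assume x: "x \<in> carrier F"
  let ?y = "\<lambda>i\<in>I. \<ominus>\<^bsub>M i\<^esub> x i"
  have "finite {i\<in>I. ?y i \<noteq> \<zero>\<^bsub>M i\<^esub>}"
  proof (rule finite_support_image[OF x])
    fix i assume i: "i \<in> I" and z: "x i = \<zero>\<^bsub>M i\<^esub>"
    interpret abelian_group "M i" by (rule ab[OF i])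
    show "?y i = \<zero>\<^bsub>M i\<^esub>" using i z by simp
  qed
  then have "?y \<in> carrier F" using x by (auto simp: carrierF abelian_group.a_inv_closed[OF ab])
  moreover have "?y \<oplus>\<^bsub>F\<^esub> x = \<zero>\<^bsub>F\<^esub>"
    using x by (auto simp: gr_direct_sum_simps(2,3) carrierF abelian_group.l_neg[OF ab] intro!: restrict_ext)
  ultimately show "\<exists>y\<in>carrier F. y \<oplus>\<^bsub>F\<^esub> x = \<zero>\<^bsub>F\<^esub>" by blast
  show "\<zero>\<^bsub>F\<^esub> \<oplus>\<^bsub>F\<^esub> x = x"
    using x by (auto simp: gr_direct_sum_simps(2,3) carrierF abelian_groupE(5)[OF ab] extensional_def)
  fix y assume y: "y \<in> carrier F"
  show "x \<oplus>\<^bsub>F\<^esub> y \<in> carrier F" using F_add x y .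
  show "x \<oplus>\<^bsub>F\<^esub> y = y \<oplus>\<^bsub>F\<^esub> x"
    using x y by (auto simp: gr_direct_sum_simps(3) carrierF abelian_groupE(4)[OF ab] intro!: restrict_ext)
  fix z assume z: "z \<in> carrier F"
  show "x \<oplus>\<^bsub>F\<^esub> y \<oplus>\<^bsub>F\<^esub> z = x \<oplus>\<^bsub>F\<^esub> (y \<oplus>\<^bsub>F\<^esub> z)"
    using x y z by (auto simp: gr_direct_sum_simps(3) carrierF abelian_groupE(3)[OF ab] intro!: restrict_ext)
qed (rule F_zero)

definition dF :: "('i \<Rightarrow> 'b) \<Rightarrow> 'g \<Rightarrow> 'i \<Rightarrow> 'b" where
  "dF x g = (\<lambda>i\<in>I. cM i (x i) g)"

lemma dF_closed:
  assumes x: "x \<in> carrier F" and g: "g \<in> carrier G"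
  shows "dF x g \<in> hcomp F g"
proof -
  have "dF x g i \<in> hcomp (M i) g \<inter> carrier (M i)" if i: "i \<in> I" for i
  proof -
    interpret graded_module G R A "M i" by (rule graded[OF i])
    show ?thesis using i carrierFD[OF x i] g by (simp add: dF_def dM.component_in dM.component_closed)
  qed
  moreover have "finite {i\<in>I. dF x g i \<noteq> \<zero>\<^bsub>M i\<^esub>}"
  proof (rule finite_support_image[OF x])
    fix i assume i: "i \<in> I" and z: "x i = \<zero>\<^bsub>M i\<^esub>"
    interpret graded_module G R A "M i" by (rule graded[OF i])
    show "dF x g i = \<zero>\<^bsub>M i\<^esub>" using i z g by (simp add: dF_def component_zero)
  qed
  ultimately show ?thesis by (auto simp: gr_direct_sum_simps(5) carrierF dF_def)
qed

lemma graded_direct_sum: "graded_module G R A F"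
proof (intro graded_module.intro graded_module_axioms.intro left_module.intro left_module_axioms.intro)
  show "graded_ring G R A" by (rule graded_ring_axioms)
  show "ring R" by (rule R.ring_axioms)
  show "abelian_group F" by (rule F_abelian_group)
  interpret F: abelian_group F by (rule F_abelian_group)
  have uminus: "\<ominus>\<^bsub>F\<^esub> x = (\<lambda>i\<in>I. \<ominus>\<^bsub>M i\<^esub> x i)" if x: "x \<in> carrier F" for x
  proof -
    have "(\<ominus>\<^bsub>F\<^esub> x) i = \<ominus>\<^bsub>M i\<^esub> x i" if i: "i \<in> I" for i
    proof -
      interpret abelian_group "M i" by (rule ab[OF i])
      have "(\<ominus>\<^bsub>F\<^esub> x \<oplus>\<^bsub>F\<^esub> x) i = \<zero>\<^bsub>F\<^esub> i" using x by (simp add: F.l_neg)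
      then have "(\<ominus>\<^bsub>F\<^esub> x) i \<oplus>\<^bsub>M i\<^esub> x i = \<zero>\<^bsub>M i\<^esub>" using i by (simp add: gr_direct_sum_simps(2,3))
      then show ?thesis using carrierFD[OF x i] carrierFD[OF F.a_inv_closed[OF x] i] 
        by (simp add: minus_equality)
    qed
    then show ?thesis using F.a_inv_closed[OF x] by (intro ext) (auto simp: carrierF extensional_def)
  qed
  have neg: "(\<lambda>i\<in>I. \<ominus>\<^bsub>M i\<^esub> x i) \<in> carrier F" if "x \<in> carrier F" for x
    using F.a_inv_closed[OF that] uminus[OF that] by simp
  show "internal_direct_sum F (carrier G) (hcomp F)"
  proof (rule F.internal_direct_sumI[where d = dF])
    show "additive_subgroup (hcomp F g) F" if g: "g \<in> carrier G" for g
    proof -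
      have "\<zero>\<^bsub>M i\<^esub> \<in> hcomp (M i) g" "\<And>x y. x \<in> hcomp (M i) g \<Longrightarrow> y \<in> hcomp (M i) g \<Longrightarrow> x \<oplus>\<^bsub>M i\<^esub> y \<in> hcomp (M i) g"
         "\<And>x. x \<in> hcomp (M i) g \<Longrightarrow> \<ominus>\<^bsub>M i\<^esub> x \<in> hcomp (M i) g" if i: "i \<in> I" for i
      proof -
        interpret graded_module G R A "M i" by (rule graded[OF i])
        show "\<zero>\<^bsub>M i\<^esub> \<in> hcomp (M i) g" "\<And>x y. x \<in> hcomp (M i) g \<Longrightarrow> y \<in> hcomp (M i) g \<Longrightarrow> x \<oplus>\<^bsub>M i\<^esub> y \<in> hcomp (M i) g"
         "\<And>x. x \<in> hcomp (M i) g \<Longrightarrow> \<ominus>\<^bsub>M i\<^esub> x \<in> hcomp (M i) g" using dM.H_facts[OF g] by auto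
      qed
      then show ?thesis unfolding F.additive_subgroup_iff
        by (auto simp: gr_direct_sum_simps(5) uminus neg) (simp_all add: gr_direct_sum_simps(2,3))
    qed
    fix x assume x: "x \<in> carrier F"
    show "dF x g \<in> hcomp F g" if "g \<in> carrier G" for g using dF_closed x that .
    show "finite {g \<in> carrier G. dF x g \<noteq> \<zero>\<^bsub>F\<^esub>}"
    proof (rule finite_subset)
      let ?S = "{i\<in>I. x i \<noteq> \<zero>\<^bsub>M i\<^esub>}"
      show "finite (\<Union>i\<in>?S. {g \<in> carrier G. cM i (x i) g \<noteq> \<zero>\<^bsub>M i\<^esub>})"
      proof (rule finite_UN_I)
        show "finite ?S" using x by (simp add: carrierF)
        fix i assume "i \<in> ?S"
        then have i: "i \<in> I" by simp
        interpret graded_module G R A "M i" by (rule graded[OF i])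
        show "finite {g \<in> carrier G. cM i (x i) g \<noteq> \<zero>\<^bsub>M i\<^esub>}"
          using dM.component_props(2)[OF carrierFD[OF x i]] .
      qed
      show "{g \<in> carrier G. dF x g \<noteq> \<zero>\<^bsub>F\<^esub>} \<subseteq> (\<Union>i\<in>?S. {g \<in> carrier G. cM i (x i) g \<noteq> \<zero>\<^bsub>M i\<^esub>})"
      proof
        fix g assume "g \<in> {g \<in> carrier G. dF x g \<noteq> \<zero>\<^bsub>F\<^esub>}"
        then have g: "g \<in> carrier G" and "dF x g \<noteq> \<zero>\<^bsub>F\<^esub>" by auto
        then obtain i where i: "i \<in> I" "cM i (x i) g \<noteq> \<zero>\<^bsub>M i\<^esub>"
          by (auto simp: dF_def gr_direct_sum_simps(2) fun_eq_iff split: if_splits)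
        interpret graded_module G R A "M i" by (rule graded[OF i(1)])
        have "x i \<noteq> \<zero>\<^bsub>M i\<^esub>" using i component_zero[OF g] by auto
        then show "g \<in> (\<Union>i\<in>?S. {g \<in> carrier G. cM i (x i) g \<noteq> \<zero>\<^bsub>M i\<^esub>})" using i g by blast
      qed
    qed
    show "x = \<zero>\<^bsub>F\<^esub>" if z: "\<And>g. g \<in> carrier G \<Longrightarrow> dF x g = \<zero>\<^bsub>F\<^esub>"
    proof -
      have "x i = \<zero>\<^bsub>M i\<^esub>" if i: "i \<in> I" for i
      proof -
        interpret graded_module G R A "M i" by (rule graded[OF i])
        have "cM i (x i) g = \<zero>\<^bsub>M i\<^esub>" if "g \<in> carrier G" for g
          using fun_cong[OF z[OF that], of i] i by (simp add: dF_def gr_direct_sum_simps(2))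
        then show ?thesis using carrierFD[OF x i] by (simp add: dM.component_ext component_zero)
      qed
      then show ?thesis using x by (auto simp: gr_direct_sum_simps(2) carrierF extensional_def)
    qed
    fix g assume g: "g \<in> carrier G"
    show "dF (x \<oplus>\<^bsub>F\<^esub> y) g = dF x g \<oplus>\<^bsub>F\<^esub> dF y g" if y: "y \<in> carrier F" for y
    proof -
      have "cM i (x i \<oplus>\<^bsub>M i\<^esub> y i) g = cM i (x i) g \<oplus>\<^bsub>M i\<^esub> cM i (y i) g" if i: "i \<in> I" for i
      proof -
        interpret graded_module G R A "M i" by (rule graded[OF i])
        show ?thesis using carrierFD[OF x i] carrierFD[OF y i] g by (simp add: dM.component_add)
      qed
      then show ?thesis by (auto simp: dF_def gr_direct_sum_simps(3) intro!: restrict_ext)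
    qed
  next
    fix x i j assume ij: "i \<in> carrier G" "j \<in> carrier G" and x: "x \<in> hcomp F j"
    have "cM k (x k) i = (if i = j then x k else \<zero>\<^bsub>M k\<^esub>)" if k: "k \<in> I" for k
    proof -
      interpret graded_module G R A "M k" by (rule graded[OF k])
      have "x k \<in> hcomp (M k) j" using x k by (simp add: gr_direct_sum_simps(5))
      from dM.component_self[OF this ij(2,1)] show ?thesis .
    qed
    then show "dF x i = (if i = j then x else \<zero>\<^bsub>F\<^esub>)"
      using x by (intro ext) (auto simp: dF_def gr_direct_sum_simps(2,5) carrierF extensional_def)
  qed
  fix a assume a: "a \<in> carrier R"
  fix x assume x: "x \<in> carrier F"
  show "a \<odot>\<^bsub>F\<^esub> x \<in> carrier F" using F_smult[OF a x] .
  fix b assume b: "b \<in> carrier R"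
  have *: "(a \<oplus>\<^bsub>R\<^esub> b) \<odot>\<^bsub>M i\<^esub> x i = a \<odot>\<^bsub>M i\<^esub> x i \<oplus>\<^bsub>M i\<^esub> b \<odot>\<^bsub>M i\<^esub> x i"
    "(a \<otimes>\<^bsub>R\<^esub> b) \<odot>\<^bsub>M i\<^esub> x i = a \<odot>\<^bsub>M i\<^esub> (b \<odot>\<^bsub>M i\<^esub> x i)"
     if i: "i \<in> I" for i
  proof -
    interpret graded_module G R A "M i" by (rule graded[OF i])
    show "(a \<oplus>\<^bsub>R\<^esub> b) \<odot>\<^bsub>M i\<^esub> x i = a \<odot>\<^bsub>M i\<^esub> x i \<oplus>\<^bsub>M i\<^esub> b \<odot>\<^bsub>M i\<^esub> x i"
    "(a \<otimes>\<^bsub>R\<^esub> b) \<odot>\<^bsub>M i\<^esub> x i = a \<odot>\<^bsub>M i\<^esub> (b \<odot>\<^bsub>M i\<^esub> x i)"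
      using a b carrierFD[OF x i] by (simp_all add: smult_l_distr smult_assoc)
  qed
  show "(a \<oplus>\<^bsub>R\<^esub> b) \<odot>\<^bsub>F\<^esub> x = a \<odot>\<^bsub>F\<^esub> x \<oplus>\<^bsub>F\<^esub> b \<odot>\<^bsub>F\<^esub> x"
    "(a \<otimes>\<^bsub>R\<^esub> b) \<odot>\<^bsub>F\<^esub> x = a \<odot>\<^bsub>F\<^esub> (b \<odot>\<^bsub>F\<^esub> x)"
    using * by (auto simp: gr_direct_sum_simps(3,4) intro!: restrict_ext)
next
  fix x assume x: "x \<in> carrier F"
  have "\<one>\<^bsub>R\<^esub> \<odot>\<^bsub>M i\<^esub> x i = x i" if i: "i \<in> I" for i
  proof -
    interpret graded_module G R A "M i" by (rule graded[OF i])
    show ?thesis using carrierFD[OF x i] by (simp add: smult_one)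
  qed
  then show "\<one>\<^bsub>R\<^esub> \<odot>\<^bsub>F\<^esub> x = x" using x by (auto simp: gr_direct_sum_simps(4) carrierF extensional_def)
next
  fix a x y assume a: "a \<in> carrier R" and x: "x \<in> carrier F" and y: "y \<in> carrier F"
  have "a \<odot>\<^bsub>M i\<^esub> (x i \<oplus>\<^bsub>M i\<^esub> y i) = a \<odot>\<^bsub>M i\<^esub> x i \<oplus>\<^bsub>M i\<^esub> a \<odot>\<^bsub>M i\<^esub> y i" if i: "i \<in> I" for i
  proof -
    interpret graded_module G R A "M i" by (rule graded[OF i])
    show ?thesis using a carrierFD[OF x i] carrierFD[OF y i] by (simp add: smult_r_distr)
  qed
  then show "a \<odot>\<^bsub>F\<^esub> (x \<oplus>\<^bsub>F\<^esub> y) = a \<odot>\<^bsub>F\<^esub> x \<oplus>\<^bsub>F\<^esub> a \<odot>\<^bsub>F\<^esub> y"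
    by (auto simp: gr_direct_sum_simps(3,4) intro!: restrict_ext)
next
  fix g h a x assume gh: "g \<in> carrier G" "h \<in> carrier G" and a: "a \<in> A g" and x: "x \<in> hcomp F h"
  have "a \<odot>\<^bsub>M i\<^esub> x i \<in> hcomp (M i) (g \<otimes>\<^bsub>G\<^esub> h)" if i: "i \<in> I" for i
  proof -
    interpret graded_module G R A "M i" by (rule graded[OF i])
    have "x i \<in> hcomp (M i) h" using x i by (simp add: gr_direct_sum_simps(5))
    then show ?thesis using module_grading_smult gh a by blast
  qed
  moreover have "a \<odot>\<^bsub>F\<^esub> x \<in> carrier F"
    using F_smult A_closed[OF a gh(1)] x by (simp add: gr_direct_sum_simps(5))
  ultimately show "a \<odot>\<^bsub>F\<^esub> x \<in> hcomp F (g \<otimes>\<^bsub>G\<^esub> h)"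
    by (simp add: gr_direct_sum_simps(5)) (simp add: gr_direct_sum_simps(4))
qed

sublocale F: graded_module G R A F
  by (rule graded_direct_sum)

lemma F_component:
  assumes "x \<in> carrier F" "g \<in> carrier G" "i \<in> I"
  shows "F.dM.c x g i = cM i (x i) g"
proof -
  have "(\<lambda>x. x i) \<in> gr_hom G R F (M i)"
    by (rule gr_homI) (use assms(3) in \<open>auto simp: carrierFD gr_direct_sum_simps(3-5)\<close>)
  from gr_hom_component[OF graded_direct_sum graded[OF assms(3)] this assms(1,2)] show ?thesis by simp
qed

definition single :: "'i \<Rightarrow> 'b \<Rightarrow> 'i \<Rightarrow> 'b" where
  "single i r = (\<lambda>k\<in>I. if k = i then r else \<zero>\<^bsub>M k\<^esub>)"

lemma single_closed:
  assumes "i \<in> I" "r \<in> carrier (M i)"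
  shows "single i r \<in> carrier F"
proof -
  have "finite {k\<in>I. single i r k \<noteq> \<zero>\<^bsub>M k\<^esub>}"
    by (rule finite_subset[of _ "{i}"]) (auto simp: single_def)
  then show ?thesis using assms by (auto simp: carrierF single_def abelian_groupE(2)[OF ab])
qed

lemma single_apply: "k \<in> I \<Longrightarrow> single i r k = (if k = i then r else \<zero>\<^bsub>M k\<^esub>)"
  by (simp add: single_def)

lemma single_hom: assumes i: "i \<in> I" shows "single i \<in> gr_hom G R (M i) F"
proof -
  interpret Mi: graded_module G R A "M i" by (rule graded[OF i])
  have z: "a \<odot>\<^bsub>M k\<^esub> \<zero>\<^bsub>M k\<^esub> = \<zero>\<^bsub>M k\<^esub>" "\<zero>\<^bsub>M k\<^esub> \<in> hcomp (M k) g" if k: "k \<in> I" "a \<in> carrier R" "g \<in> carrier G" for a k g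
  proof -
    interpret graded_module G R A "M k" by (rule graded[OF k(1)])
    show "a \<odot>\<^bsub>M k\<^esub> \<zero>\<^bsub>M k\<^esub> = \<zero>\<^bsub>M k\<^esub>" "\<zero>\<^bsub>M k\<^esub> \<in> hcomp (M k) g"
      using k smult_r_null dM.H_facts(2) by auto
  qed
  show ?thesis
  proof (rule gr_homI)
    show "single i (x \<oplus>\<^bsub>M i\<^esub> y) = single i x \<oplus>\<^bsub>F\<^esub> single i y" if "x \<in> carrier (M i)" "y \<in> carrier (M i)" for x y
      using that abelian_groupE(5,2)[OF ab]
      by (auto simp: single_def gr_direct_sum_simps(3) intro!: restrict_ext)
    show "single i (a \<odot>\<^bsub>M i\<^esub> x) = a \<odot>\<^bsub>F\<^esub> single i x" if "a \<in> carrier R" "x \<in> carrier (M i)" for a x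
      using that z(1)[OF _ that(1) G.one_closed] by (auto simp: single_def gr_direct_sum_simps(4) intro!: restrict_ext)
    show "single i x \<in> hcomp F g" if "g \<in> carrier G" "x \<in> hcomp (M i) g" for g x
      using that z(2)[OF _ R.zero_closed that(1)] single_closed[OF i Mi.hcomp_closed[OF that(2,1)]]
      by (auto simp: gr_direct_sum_simps(5) single_apply)
  qed (rule single_closed[OF i])
qed

text \<open>The base case concerns only the coordinates of the given x, so that what is known about
  them, such as their degree or membership in J, can enter the induction.\<close>

lemma F_induct:
  assumes x: "x \<in> carrier F" and Q0: "Q \<zero>\<^bsub>F\<^esub>" and Qs: "\<And>i. i \<in> I \<Longrightarrow> Q (single i (x i))"
    and add: "\<And>y z. y \<in> carrier F \<Longrightarrow> z \<in> carrier F \<Longrightarrow> Q y \<Longrightarrow> Q z \<Longrightarrow> Q (y \<oplus>\<^bsub>F\<^esub> z)"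
  shows "Q x"
proof -
  define p where "p S = (\<lambda>k\<in>I. if k \<in> S then x k else \<zero>\<^bsub>M k\<^esub>)" for S
  have p: "p S \<in> carrier F" for S
  proof -
    have "finite {i\<in>I. p S i \<noteq> \<zero>\<^bsub>M i\<^esub>}" by (rule finite_support_image[OF x]) (simp add: p_def)
    then show ?thesis using x by (auto simp: carrierF p_def abelian_groupE(2)[OF ab])
  qed
  have "Q (p S)" if "finite S" "S \<subseteq> I" for S
    using that
  proof (induction S rule: finite_induct)
    case empty
    have "p {} = \<zero>\<^bsub>F\<^esub>" by (auto simp: p_def gr_direct_sum_simps(2))
    then show ?case using Q0 by simp
  next
    case (insert i S)
    have "p (insert i S) = single i (x i) \<oplus>\<^bsub>F\<^esub> p S"
      using insert x abelian_groupE(2,5)[OF ab] abelian_monoid.r_zero[OF abelian_group.axioms(1)[OF ab]]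
      by (auto simp: p_def single_def gr_direct_sum_simps(3) carrierF intro!: restrict_ext)
    then show ?case using insert add[OF single_closed p] Qs carrierFD[OF x] by simp
  qed
  from this[of "{i\<in>I. x i \<noteq> \<zero>\<^bsub>M i\<^esub>}"] have "Q (p {i\<in>I. x i \<noteq> \<zero>\<^bsub>M i\<^esub>})" using x by (simp add: carrierF)
  moreover have "p {i\<in>I. x i \<noteq> \<zero>\<^bsub>M i\<^esub>} = x" using x by (auto simp: p_def carrierF extensional_def)
  ultimately show ?thesis by simp
qed

section \<open>Maps out of a direct sum\<close>

definition cotuple :: "('a, 'n, 'g) gr_module \<Rightarrow> ('i \<Rightarrow> 'b \<Rightarrow> 'n) \<Rightarrow> ('i \<Rightarrow> 'b) \<Rightarrow> 'n" where
  "cotuple N \<phi> x = (\<Oplus>\<^bsub>N\<^esub>i\<in>{i\<in>I. x i \<noteq> \<zero>\<^bsub>M i\<^esub>}. \<phi> i (x i))"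

context
  fixes N :: "('a, 'n, 'g) gr_module" and \<phi>
  assumes N: "graded_module G R A N" and \<phi>: "\<And>i. i \<in> I \<Longrightarrow> \<phi> i \<in> gr_hom G R (M i) N"
begin

interpretation N: graded_module G R A N by (rule N)

text \<open>Each \<phi> i sends zero to zero, so the index set may be enlarged; this lets elements
  with different supports be summed over a common set.\<close>

lemma cotuple_eq:
  assumes "x \<in> carrier F" "finite S" "S \<subseteq> I" "{i\<in>I. x i \<noteq> \<zero>\<^bsub>M i\<^esub>} \<subseteq> S"
  shows "cotuple N \<phi> x = (\<Oplus>\<^bsub>N\<^esub>i\<in>S. \<phi> i (x i))"
  unfolding cotuple_def
  using assms carrierFD[OF assms(1)] gr_homD(1)[OF \<phi>] gr_hom_zero[OF graded N \<phi>]
  by (intro N.M.add.finprod_mono_neutral_cong_left) (auto simp: subset_iff)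

lemma cotuple_single:
  assumes "i \<in> I" "r \<in> carrier (M i)"
  shows "cotuple N \<phi> (single i r) = \<phi> i r"
proof -
  have "cotuple N \<phi> (single i r) = (\<Oplus>\<^bsub>N\<^esub>k\<in>{i}. \<phi> k (single i r k))"
    by (rule cotuple_eq) (use assms single_closed in \<open>auto simp: single_apply split: if_splits\<close>)
  also have "\<dots> = \<phi> i r"
    using assms gr_homD(1)[OF \<phi>] by (simp add: N.M.finsum_insert[of "{}"] single_apply)
  finally show ?thesis .
qed

lemma cotuple_add:
  assumes x: "x \<in> carrier F" and y: "y \<in> carrier F"
  shows "cotuple N \<phi> (x \<oplus>\<^bsub>F\<^esub> y) = cotuple N \<phi> x \<oplus>\<^bsub>N\<^esub> cotuple N \<phi> y"
proof -
  let ?S = "{i\<in>I. x i \<noteq> \<zero>\<^bsub>M i\<^esub>} \<union> {i\<in>I. y i \<noteq> \<zero>\<^bsub>M i\<^esub>}"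
  have S: "finite ?S" "?S \<subseteq> I" using x y by (auto simp: carrierF)
  have "cotuple N \<phi> (x \<oplus>\<^bsub>F\<^esub> y) = (\<Oplus>\<^bsub>N\<^esub>i\<in>?S. \<phi> i ((x \<oplus>\<^bsub>F\<^esub> y) i))"
    by (rule cotuple_eq[OF F_add[OF x y] S])
      (auto simp: gr_direct_sum_simps(3) abelian_groupE(2,5)[OF ab])
  also have "\<dots> = (\<Oplus>\<^bsub>N\<^esub>i\<in>?S. \<phi> i (x i) \<oplus>\<^bsub>N\<^esub> \<phi> i (y i))"
    using S gr_homD(1,2)[OF \<phi>] carrierFD[OF x] carrierFD[OF y]
    by (intro N.M.finsum_cong') (auto simp: gr_direct_sum_simps(3))
  also have "\<dots> = (\<Oplus>\<^bsub>N\<^esub>i\<in>?S. \<phi> i (x i)) \<oplus>\<^bsub>N\<^esub> (\<Oplus>\<^bsub>N\<^esub>i\<in>?S. \<phi> i (y i))"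
    using S gr_homD(1)[OF \<phi>] carrierFD[OF x] carrierFD[OF y] by (intro N.M.finsum_addf) auto
  also have "(\<Oplus>\<^bsub>N\<^esub>i\<in>?S. \<phi> i (x i)) = cotuple N \<phi> x"
    by (rule cotuple_eq[symmetric]) (use x S in auto)
  also have "(\<Oplus>\<^bsub>N\<^esub>i\<in>?S. \<phi> i (y i)) = cotuple N \<phi> y"
    by (rule cotuple_eq[symmetric]) (use y S in auto)
  finally show ?thesis .
qed

lemma cotuple_zero: "cotuple N \<phi> \<zero>\<^bsub>F\<^esub> = \<zero>\<^bsub>N\<^esub>"
  using cotuple_eq[OF F_zero, of "{}"] by (simp add: gr_direct_sum_simps(2))

lemma cotuple_closed: assumes x: "x \<in> carrier F" shows "cotuple N \<phi> x \<in> carrier N"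
  unfolding cotuple_def using gr_homD(1)[OF \<phi>] carrierFD[OF x] by (intro N.M.finsum_closed) auto

lemma cotuple_hom: "cotuple N \<phi> \<in> gr_hom G R F N"
proof (rule gr_homI)
  fix a x assume a: "a \<in> carrier R" and x: "x \<in> carrier F"
  show "cotuple N \<phi> (a \<odot>\<^bsub>F\<^esub> x) = a \<odot>\<^bsub>N\<^esub> cotuple N \<phi> x"
  proof (rule F_induct[OF x])
    show "cotuple N \<phi> (a \<odot>\<^bsub>F\<^esub> \<zero>\<^bsub>F\<^esub>) = a \<odot>\<^bsub>N\<^esub> cotuple N \<phi> \<zero>\<^bsub>F\<^esub>"
      using a by (simp add: F.smult_r_null N.smult_r_null cotuple_zero)
  next
    fix i assume i: "i \<in> I"
    interpret Mi: graded_module G R A "M i" by (rule graded[OF i])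
    show "cotuple N \<phi> (a \<odot>\<^bsub>F\<^esub> single i (x i)) = a \<odot>\<^bsub>N\<^esub> cotuple N \<phi> (single i (x i))"
      using carrierFD[OF x i] a i by (simp add: gr_homD(3)[OF single_hom[OF i], symmetric] cotuple_single
          Mi.smult_closed gr_homD(3)[OF \<phi>[OF i]])
  next
    fix y z assume "y \<in> carrier F" "z \<in> carrier F"
      "cotuple N \<phi> (a \<odot>\<^bsub>F\<^esub> y) = a \<odot>\<^bsub>N\<^esub> cotuple N \<phi> y" "cotuple N \<phi> (a \<odot>\<^bsub>F\<^esub> z) = a \<odot>\<^bsub>N\<^esub> cotuple N \<phi> z"
    then show "cotuple N \<phi> (a \<odot>\<^bsub>F\<^esub> (y \<oplus>\<^bsub>F\<^esub> z)) = a \<odot>\<^bsub>N\<^esub> cotuple N \<phi> (y \<oplus>\<^bsub>F\<^esub> z)"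
      using a by (simp add: F.smult_r_distr N.smult_r_distr cotuple_add F_smult cotuple_closed)
  qed
next
  fix g x assume g: "g \<in> carrier G" and x: "x \<in> hcomp F g"
  then have xF: "x \<in> carrier F" by (simp add: F.hcomp_closed)
  show "cotuple N \<phi> x \<in> hcomp N g"
  proof (rule F_induct[OF xF])
    show "cotuple N \<phi> \<zero>\<^bsub>F\<^esub> \<in> hcomp N g" using g by (simp add: cotuple_zero N.dM.H_facts(2))
    show "cotuple N \<phi> (single i (x i)) \<in> hcomp N g" if i: "i \<in> I" for i
      using x i carrierFD[OF xF i] gr_homD(4)[OF \<phi>[OF i] g] by (simp add: cotuple_single gr_direct_sum_simps(5))
    show "cotuple N \<phi> (y \<oplus>\<^bsub>F\<^esub> z) \<in> hcomp N g"
      if "y \<in> carrier F" "z \<in> carrier F" "cotuple N \<phi> y \<in> hcomp N g" "cotuple N \<phi> z \<in> hcomp N g" for y z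
      using that by (simp add: cotuple_add N.dM.H_facts(3)[OF g])
  qed
qed (rule cotuple_closed cotuple_add; assumption)+

end

end

lemma gr_direct_sum_reindex:
  fixes M :: "'j \<Rightarrow> ('a, 'b, 'g) gr_module" and b :: "'i \<Rightarrow> 'j"
  assumes "bij_betw b I J"
  shows "gr_iso G R (gr_direct_sum I (\<lambda>i. M (b i))) (gr_direct_sum J M)"
proof -
  let ?D = "gr_direct_sum I (\<lambda>i. M (b i))" and ?E = "gr_direct_sum J M"
  define f where "f x = (\<lambda>j\<in>J. x (inv_into I b j))" for x :: "'i \<Rightarrow> 'b"
  define h where "h y = (\<lambda>i\<in>I. y (b i))" for y :: "'j \<Rightarrow> 'b"
  note c = bij_betw_inv_into[OF assms]
  have bJ: "b i \<in> J" if "i \<in> I" for i using assms that by (auto simp: bij_betw_def)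
  have iI: "inv_into I b j \<in> I" if "j \<in> J" for j using c that by (auto simp: bij_betw_def)
  have bi: "b (inv_into I b j) = j" if "j \<in> J" for j using assms that by (simp add: bij_betw_inv_into_right)
  have ib: "inv_into I b (b i) = i" if "i \<in> I" for i using assms that by (simp add: bij_betw_inv_into_left)
  have f_car: "f x \<in> carrier ?E" if "x \<in> carrier ?D" for x
  proof -
    have "{j \<in> J. f x j \<noteq> \<zero>\<^bsub>M j\<^esub>} \<subseteq> b ` {i \<in> I. x i \<noteq> \<zero>\<^bsub>M (b i)\<^esub>}"
    proof
      fix j assume "j \<in> {j \<in> J. f x j \<noteq> \<zero>\<^bsub>M j\<^esub>}"
      then show "j \<in> b ` {i \<in> I. x i \<noteq> \<zero>\<^bsub>M (b i)\<^esub>}"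
        using iI bi by (intro image_eqI[of _ _ "inv_into I b j"]) (auto simp: f_def)
    qed
    then have "finite {j \<in> J. f x j \<noteq> \<zero>\<^bsub>M j\<^esub>}"
      using that by (auto simp: gr_direct_sum_simps(1) intro: finite_subset)
    moreover have "f x j \<in> carrier (M j)" if "j \<in> J" for j
      using \<open>x \<in> carrier ?D\<close> iI[OF that] bi[OF that] that by (auto simp: f_def gr_direct_sum_simps(1) PiE_iff)
    ultimately show ?thesis by (auto simp: gr_direct_sum_simps(1) f_def PiE_iff)
  qed
  have h_car: "h y \<in> carrier ?D" if "y \<in> carrier ?E" for y
  proof -
    have "{i \<in> I. h y i \<noteq> \<zero>\<^bsub>M (b i)\<^esub>} \<subseteq> inv_into I b ` {j \<in> J. y j \<noteq> \<zero>\<^bsub>M j\<^esub>}"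
    proof
      fix i assume "i \<in> {i \<in> I. h y i \<noteq> \<zero>\<^bsub>M (b i)\<^esub>}"
      then show "i \<in> inv_into I b ` {j \<in> J. y j \<noteq> \<zero>\<^bsub>M j\<^esub>}"
        using bJ ib by (intro image_eqI[of _ _ "b i"]) (auto simp: h_def)
    qed
    then have "finite {i \<in> I. h y i \<noteq> \<zero>\<^bsub>M (b i)\<^esub>}"
      using that by (auto simp: gr_direct_sum_simps(1) intro: finite_subset)
    moreover have "h y i \<in> carrier (M (b i))" if "i \<in> I" for i
      using \<open>y \<in> carrier ?E\<close> bJ[OF that] that by (auto simp: h_def gr_direct_sum_simps(1) PiE_iff)
    ultimately show ?thesis by (auto simp: gr_direct_sum_simps(1) h_def PiE_iff)
  qed
  have f: "f \<in> gr_hom G R ?D ?E"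
  proof (rule gr_homI)
    show "f x \<in> hcomp ?E g" if "x \<in> hcomp ?D g" for g x
    proof -
      have "f x j \<in> hcomp (M j) g" if j: "j \<in> J" for j
        using \<open>x \<in> hcomp ?D g\<close> iI[OF j] bi[OF j] j by (auto simp: f_def gr_direct_sum_simps(5) dest!: bspec[of I])
      then show ?thesis using f_car that by (simp add: gr_direct_sum_simps(5))
    qed
  qed (auto simp: f_car, auto simp: f_def gr_direct_sum_simps(3,4) iI bi intro!: restrict_ext)
  have h: "h \<in> gr_hom G R ?E ?D"
  proof (rule gr_homI)
    show "h y \<in> hcomp ?D g" if "y \<in> hcomp ?E g" for g y
      using that h_car bJ by (auto simp: gr_direct_sum_simps(5)) (auto simp: h_def)
  qed (auto simp: h_car, auto simp: h_def gr_direct_sum_simps(3,4) bJ intro!: restrict_ext)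
  have "h (f x) = x" if "x \<in> carrier ?D" for x
    using that bJ ib by (auto simp: h_def f_def gr_direct_sum_simps(1) PiE_iff extensional_def)
  moreover have "f (h y) = y" if "y \<in> carrier ?E" for y
    using that iI bi by (auto simp: h_def f_def gr_direct_sum_simps(1) PiE_iff extensional_def)
  ultimately show ?thesis unfolding gr_iso_def using f h by blast
qed

section \<open>Graded left ideals and nilpotence\<close>

lemma component_regular [simp]: "component (gr_regular R A) I H = component R I H"
  by (rule component_record_eq) simp_all

sublocale graded_ring \<subseteq> reg: graded_module G R A "gr_regular R A"
  by (rule graded_regular)

context graded_ring
begin

abbreviation rmul (infixl "\<cdot>" 70) where "a \<cdot> b \<equiv> a \<otimes>\<^bsub>R\<^esub> b"

definition gr_left_ideal :: "'a set \<Rightarrow> bool" where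
  "gr_left_ideal L \<longleftrightarrow> L \<subseteq> carrier R \<and> \<zero>\<^bsub>R\<^esub> \<in> L \<and> (\<forall>x\<in>L. \<forall>y\<in>L. x \<oplus>\<^bsub>R\<^esub> y \<in> L) \<and>
     (\<forall>a\<in>carrier R. \<forall>x\<in>L. a \<cdot> x \<in> L) \<and> (\<forall>x\<in>L. \<forall>g\<in>carrier G. dR.c x g \<in> L)"

lemma gsub_regular: "reg.gsub L \<longleftrightarrow> gr_left_ideal L"
  by (simp add: reg.gsub_def gr_left_ideal_def)

lemma gr_left_idealD:
  assumes "gr_left_ideal L"
  shows "L \<subseteq> carrier R" "\<zero>\<^bsub>R\<^esub> \<in> L" "\<And>x y. x \<in> L \<Longrightarrow> y \<in> L \<Longrightarrow> x \<oplus>\<^bsub>R\<^esub> y \<in> L"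
     "\<And>a x. a \<in> carrier R \<Longrightarrow> x \<in> L \<Longrightarrow> a \<cdot> x \<in> L"
     "\<And>g x. x \<in> L \<Longrightarrow> g \<in> carrier G \<Longrightarrow> dR.c x g \<in> L"
     "\<And>x. x \<in> L \<Longrightarrow> \<ominus>\<^bsub>R\<^esub> x \<in> L" "\<And>x. x \<in> L \<Longrightarrow> x \<in> carrier R"
proof -
  show "\<ominus>\<^bsub>R\<^esub> x \<in> L" if "x \<in> L" for x
  proof -
    have "x \<in> carrier R" using assms that by (auto simp: gr_left_ideal_def)
    then have "\<ominus>\<^bsub>R\<^esub> x = \<ominus>\<^bsub>R\<^esub> \<one>\<^bsub>R\<^esub> \<cdot> x" by (simp add: R.l_minus)
    then show ?thesis using assms that by (auto simp: gr_left_ideal_def)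
  qed
qed (use assms in \<open>auto simp: gr_left_ideal_def\<close>)

lemma gr_left_idealI:
  assumes "L \<subseteq> carrier R" "\<zero>\<^bsub>R\<^esub> \<in> L" "\<And>x y. x \<in> L \<Longrightarrow> y \<in> L \<Longrightarrow> x \<oplus>\<^bsub>R\<^esub> y \<in> L"
     "\<And>a x. a \<in> carrier R \<Longrightarrow> x \<in> L \<Longrightarrow> a \<cdot> x \<in> L"
     "\<And>g x. g \<in> carrier G \<Longrightarrow> x \<in> L \<Longrightarrow> dR.c x g \<in> L"
  shows "gr_left_ideal L"
  using assms unfolding gr_left_ideal_def by blast

lemma component_mult:
  assumes "b \<in> A h" "g \<in> carrier G" "h \<in> carrier G" "a \<in> carrier R"
  shows "dR.c (a \<cdot> b) (g \<otimes>\<^bsub>G\<^esub> h) = dR.c a g \<cdot> b"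
  using reg.component_smult2[of b h g a] assms by simp

lemma component_mult':
  assumes "b \<in> A h" "g \<in> carrier G" "h \<in> carrier G" "a \<in> carrier R"
  shows "dR.c (a \<cdot> b) g = dR.c a (g \<otimes>\<^bsub>G\<^esub> inv\<^bsub>G\<^esub> h) \<cdot> b"
  using component_mult[of b h "g \<otimes>\<^bsub>G\<^esub> inv\<^bsub>G\<^esub> h" a] assms by (simp add: G.m_assoc)

lemma component_self1: "a \<in> A g \<Longrightarrow> g \<in> carrier G \<Longrightarrow> dR.c a g = a"
  by (simp add: dR.component_self)

lemma A_mult: "a \<in> A g \<Longrightarrow> b \<in> A h \<Longrightarrow> g \<in> carrier G \<Longrightarrow> h \<in> carrier G \<Longrightarrow> a \<cdot> b \<in> A (g \<otimes>\<^bsub>G\<^esub> h)"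
  by (simp add: ring_grading_mult)

lemma A1_closed: "a \<in> A \<one>\<^bsub>G\<^esub> \<Longrightarrow> a \<in> carrier R"
  by (simp add: A_closed)

lemma A1_mult: "a \<in> A \<one>\<^bsub>G\<^esub> \<Longrightarrow> b \<in> A \<one>\<^bsub>G\<^esub> \<Longrightarrow> a \<cdot> b \<in> A \<one>\<^bsub>G\<^esub>"
  using A_mult[of a "\<one>\<^bsub>G\<^esub>" b "\<one>\<^bsub>G\<^esub>"] by simp

lemma A1_minus: "a \<in> A \<one>\<^bsub>G\<^esub> \<Longrightarrow> b \<in> A \<one>\<^bsub>G\<^esub> \<Longrightarrow> a \<ominus>\<^bsub>R\<^esub> b \<in> A \<one>\<^bsub>G\<^esub>"
  unfolding a_minus_def by (simp add: dR.H_facts(3,4))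

lemma A1_add: "a \<in> A \<one>\<^bsub>G\<^esub> \<Longrightarrow> b \<in> A \<one>\<^bsub>G\<^esub> \<Longrightarrow> a \<oplus>\<^bsub>R\<^esub> b \<in> A \<one>\<^bsub>G\<^esub>"
  by (simp add: dR.H_facts(3))

lemma gr_left_ideal_carrier: "gr_left_ideal (carrier R)"
  by (rule gr_left_idealI) (auto simp: dR.component_closed)

text \<open>Right multiplication by x shifts every degree by h, so the components of a x are the
  products of the components of a with x. For inhomogeneous x the set L x need not be
  graded.\<close>

lemma gr_left_ideal_mult_homog:
  assumes L: "gr_left_ideal L" and x: "x \<in> A h" "h \<in> carrier G"
  shows "gr_left_ideal {a \<cdot> x |a. a \<in> L}"
proof (rule gr_left_idealI)
  have xc: "x \<in> carrier R" using x A_closed by blast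
  note Lc = gr_left_idealD(7)[OF L]
  show "{a \<cdot> x |a. a \<in> L} \<subseteq> carrier R" using Lc xc by auto
  show "\<zero>\<^bsub>R\<^esub> \<in> {a \<cdot> x |a. a \<in> L}" using gr_left_idealD(2)[OF L] xc by (auto intro!: exI[of _ "\<zero>\<^bsub>R\<^esub>"])
  show "y \<oplus>\<^bsub>R\<^esub> z \<in> {a \<cdot> x |a. a \<in> L}" if yz: "y \<in> {a \<cdot> x |a. a \<in> L}" "z \<in> {a \<cdot> x |a. a \<in> L}" for y z
  proof -
    obtain a b where "y = a \<cdot> x" "z = b \<cdot> x" "a \<in> L" "b \<in> L" using yz by blast
    then show ?thesis using gr_left_idealD(3)[OF L] Lc xc by (auto intro!: exI[of _ "a \<oplus>\<^bsub>R\<^esub> b"] simp: R.l_distr)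
  qed
  show "r \<cdot> y \<in> {a \<cdot> x |a. a \<in> L}" if r: "r \<in> carrier R" and y: "y \<in> {a \<cdot> x |a. a \<in> L}" for r y
  proof -
    obtain a where "y = a \<cdot> x" "a \<in> L" using y by blast
    then show ?thesis using gr_left_idealD(4)[OF L] Lc xc r by (auto intro!: exI[of _ "r \<cdot> a"] simp: R.m_assoc)
  qed
  show "dR.c y g \<in> {a \<cdot> x |a. a \<in> L}" if g: "g \<in> carrier G" and y: "y \<in> {a \<cdot> x |a. a \<in> L}" for g y
  proof -
    obtain a where "y = a \<cdot> x" "a \<in> L" using y by blast
    then show ?thesis using gr_left_idealD(5)[OF L] Lc g x
      by (auto intro!: exI[of _ "dR.c a (g \<otimes>\<^bsub>G\<^esub> inv\<^bsub>G\<^esub> h)"] simp: component_mult')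
  qed
qed

lemma gr_left_ideal_ann:
  assumes L: "gr_left_ideal L" and x: "x \<in> A h" "h \<in> carrier G"
  shows "gr_left_ideal {a \<in> L. a \<cdot> x = \<zero>\<^bsub>R\<^esub>}"
proof -
  have xc: "x \<in> carrier R" using x A_closed by blast
  note Lc = gr_left_idealD(7)[OF L]
  show ?thesis
  proof (rule gr_left_idealI)
  show "dR.c y g \<in> {a \<in> L. a \<cdot> x = \<zero>\<^bsub>R\<^esub>}" if g: "g \<in> carrier G" and y: "y \<in> {a \<in> L. a \<cdot> x = \<zero>\<^bsub>R\<^esub>}" for g y
  proof -
    have "dR.c y g \<cdot> x = dR.c (y \<cdot> x) (g \<otimes>\<^bsub>G\<^esub> h)" using component_mult[OF x(1) g x(2), of y] y Lc[of y] by auto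
    also have "\<dots> = \<zero>\<^bsub>R\<^esub>" using y g x reg.component_zero[of "g \<otimes>\<^bsub>G\<^esub> h"] by simp
    finally show ?thesis using gr_left_idealD(5)[OF L] y g by auto
  qed
  qed (use gr_left_idealD(2-4)[OF L] xc Lc in \<open>auto simp: R.l_distr R.m_assoc\<close>)
qed

lemma gr_left_ideal_principal:
  assumes "x \<in> A h" "h \<in> carrier G"
  shows "gr_left_ideal {a \<cdot> x |a. a \<in> carrier R}"
  by (rule gr_left_ideal_mult_homog[OF gr_left_ideal_carrier assms])

lemma gr_left_ideal_sum:
  assumes L: "gr_left_ideal L" and K: "gr_left_ideal K"
  shows "gr_left_ideal {x \<oplus>\<^bsub>R\<^esub> y |x y. x \<in> L \<and> y \<in> K}" (is "gr_left_ideal ?S")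
proof (rule gr_left_idealI)
  note Lc = gr_left_idealD(7)[OF L] and Kc = gr_left_idealD(7)[OF K]
  show "?S \<subseteq> carrier R" using Lc Kc by auto
  have "\<zero>\<^bsub>R\<^esub> = \<zero>\<^bsub>R\<^esub> \<oplus>\<^bsub>R\<^esub> \<zero>\<^bsub>R\<^esub>" by simp
  then show "\<zero>\<^bsub>R\<^esub> \<in> ?S" using gr_left_idealD(2)[OF L] gr_left_idealD(2)[OF K] by blast
  show "y \<oplus>\<^bsub>R\<^esub> z \<in> ?S" if yz: "y \<in> ?S" "z \<in> ?S" for y z
  proof -
    obtain a b c d where e: "y = a \<oplus>\<^bsub>R\<^esub> b" "z = c \<oplus>\<^bsub>R\<^esub> d" "a \<in> L" "c \<in> L" "b \<in> K" "d \<in> K" using yz by blast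
    have "y \<oplus>\<^bsub>R\<^esub> z = (a \<oplus>\<^bsub>R\<^esub> c) \<oplus>\<^bsub>R\<^esub> (b \<oplus>\<^bsub>R\<^esub> d)" using e Lc Kc by (simp add: R.a_ac)
    then show ?thesis using e gr_left_idealD(3)[OF L] gr_left_idealD(3)[OF K] by blast
  qed
  show "r \<cdot> y \<in> ?S" if r: "r \<in> carrier R" and y: "y \<in> ?S" for r y
  proof -
    obtain a b where e: "y = a \<oplus>\<^bsub>R\<^esub> b" "a \<in> L" "b \<in> K" using y by blast
    have "r \<cdot> y = r \<cdot> a \<oplus>\<^bsub>R\<^esub> r \<cdot> b" using e r Lc Kc by (simp add: R.r_distr)
    then show ?thesis using e r gr_left_idealD(4)[OF L] gr_left_idealD(4)[OF K] by blast
  qed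
  show "dR.c y g \<in> ?S" if g: "g \<in> carrier G" and y: "y \<in> ?S" for g y
  proof -
    obtain a b where e: "y = a \<oplus>\<^bsub>R\<^esub> b" "a \<in> L" "b \<in> K" using y by blast
    have "dR.c y g = dR.c a g \<oplus>\<^bsub>R\<^esub> dR.c b g" using e g Lc Kc by (simp add: dR.component_add)
    then show ?thesis using e g gr_left_idealD(5)[OF L] gr_left_idealD(5)[OF K] by blast
  qed
qed

lemma gr_left_ideal_sum_upper:
  assumes L: "gr_left_ideal L" and K: "gr_left_ideal K"
  shows "L \<subseteq> {x \<oplus>\<^bsub>R\<^esub> y |x y. x \<in> L \<and> y \<in> K}" "K \<subseteq> {x \<oplus>\<^bsub>R\<^esub> y |x y. x \<in> L \<and> y \<in> K}"
proof -
  have "x = x \<oplus>\<^bsub>R\<^esub> \<zero>\<^bsub>R\<^esub>" "x = \<zero>\<^bsub>R\<^esub> \<oplus>\<^bsub>R\<^esub> x" if "x \<in> carrier R" for x using that by simp_all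
  then show "L \<subseteq> {x \<oplus>\<^bsub>R\<^esub> y |x y. x \<in> L \<and> y \<in> K}" "K \<subseteq> {x \<oplus>\<^bsub>R\<^esub> y |x y. x \<in> L \<and> y \<in> K}"
    using gr_left_idealD(2,7)[OF L] gr_left_idealD(2,7)[OF K] by blast+
qed

lemma gr_left_ideal_Inter:
  assumes "\<And>K. K \<in> S \<Longrightarrow> gr_left_ideal K" "S \<noteq> {}"
  shows "gr_left_ideal (\<Inter>S)"
proof (rule gr_left_idealI)
  obtain K where "K \<in> S" using assms(2) by blast
  then show "\<Inter>S \<subseteq> carrier R" using gr_left_idealD(1)[OF assms(1)] by blast
qed (auto intro: gr_left_idealD(2-5)[OF assms(1)])

text \<open>The set of n-fold products, without passing to sums: the n-th power of an ideal is
  spanned by these products and vanishes exactly when they all do. The value at 0 is the end point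
  of the descending inductions on the exponent.\<close>

primrec set_power :: "'a set \<Rightarrow> nat \<Rightarrow> 'a set" where
  "set_power L 0 = {\<one>\<^bsub>R\<^esub>}"
| "set_power L (Suc n) = {a \<cdot> b |a b. a \<in> L \<and> b \<in> set_power L n}"

definition nilpotent :: "'a set \<Rightarrow> bool" where
  "nilpotent L \<longleftrightarrow> (\<exists>n. set_power L n \<subseteq> {\<zero>\<^bsub>R\<^esub>})"

lemma set_power_closed: "L \<subseteq> carrier R \<Longrightarrow> set_power L n \<subseteq> carrier R"
  by (induction n) auto

lemma set_power_mono: "K \<subseteq> L \<Longrightarrow> set_power K n \<subseteq> set_power L n"
  by (induction n) (simp, fastforce)

lemma nilpotent_mono: "K \<subseteq> L \<Longrightarrow> nilpotent L \<Longrightarrow> nilpotent K"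
  unfolding nilpotent_def using set_power_mono by (meson subset_trans)

lemma set_power_zero_mono:
  assumes "set_power L n \<subseteq> {\<zero>\<^bsub>R\<^esub>}" "n \<le> m" "L \<subseteq> carrier R"
  shows "set_power L m \<subseteq> {\<zero>\<^bsub>R\<^esub>}"
  using assms(2)
proof (induction m rule: dec_induct)
  case (step m)
  show ?case
  proof
    fix y assume "y \<in> set_power L (Suc m)"
    then obtain a b where y: "y = a \<cdot> b" "a \<in> L" "b \<in> set_power L m" by auto
    then have "b = \<zero>\<^bsub>R\<^esub>" "a \<in> carrier R" using assms(3) step.IH by blast+
    then show "y \<in> {\<zero>\<^bsub>R\<^esub>}" using y(1) by simp
  qed
qed (rule assms(1))

lemma set_power_pow: "a \<in> L \<Longrightarrow> L \<subseteq> carrier R \<Longrightarrow> a [^]\<^bsub>R\<^esub> n \<in> set_power L n"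
proof (induction n)
  case (Suc n)
  then have "a [^]\<^bsub>R\<^esub> Suc n = a \<cdot> a [^]\<^bsub>R\<^esub> n" by (intro R.nat_pow_Suc2) auto
  with Suc show ?case by auto
qed auto

lemma nilpotent_pow:
  assumes "nilpotent L" "L \<subseteq> carrier R" "a \<in> L"
  obtains n :: nat where "a [^]\<^bsub>R\<^esub> n = \<zero>\<^bsub>R\<^esub>"
  using assms set_power_pow unfolding nilpotent_def by blast

lemma pow_fix:
  assumes "a \<in> carrier R" "x \<in> carrier R" "a \<cdot> x = x"
  shows "a [^]\<^bsub>R\<^esub> (n::nat) \<cdot> x = x"
  by (induction n) (use assms in \<open>simp_all add: R.m_assoc\<close>)

text \<open>Iterating a x = x gives x = a^n x, and some a^n is zero. With x = a this excludes
  nonzero idempotents from nilpotent ideals.\<close>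

lemma nilpotent_fix:
  assumes "nilpotent L" "L \<subseteq> carrier R" "a \<in> L" "x \<in> carrier R" "a \<cdot> x = x"
  shows "x = \<zero>\<^bsub>R\<^esub>"
proof -
  obtain n :: nat where "a [^]\<^bsub>R\<^esub> n = \<zero>\<^bsub>R\<^esub>" using nilpotent_pow assms(1-3) by blast
  then show ?thesis using pow_fix[of a x n] assms by auto
qed

text \<open>In the corner ring with identity e, nilpotence of a makes e - a a unit, yet e - a is
  nilpotent too. Instead of an inverse, the proof uses z_k = e a^k: if z_(k+1) = 0, then z_k (e - a)
  = z_k, and iterating m times gives z_k = 0.\<close>

lemma left_zero_of_idem_sum:
  assumes c: "a \<in> carrier R" "e \<in> carrier R" and "e \<cdot> e = e" "a \<cdot> e = a" "e \<cdot> a = a"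
    and n: "a [^]\<^bsub>R\<^esub> (n::nat) = \<zero>\<^bsub>R\<^esub>" and m: "(e \<ominus>\<^bsub>R\<^esub> a) [^]\<^bsub>R\<^esub> (m::nat) = \<zero>\<^bsub>R\<^esub>"
  shows "e = \<zero>\<^bsub>R\<^esub>"
proof -
  let ?b = "e \<ominus>\<^bsub>R\<^esub> a" and ?z = "\<lambda>k::nat. e \<cdot> a [^]\<^bsub>R\<^esub> k"
  have ze: "?z k \<cdot> e = ?z k" for k
    by (cases k) (use assms in \<open>simp_all add: R.m_assoc\<close>)
  have step: "?z k = \<zero>\<^bsub>R\<^esub>" if "?z (Suc k) = \<zero>\<^bsub>R\<^esub>" for k
  proof -
    have zk: "?z k \<in> carrier R" using c by simp
    have "?z k \<cdot> ?b = ?z k \<ominus>\<^bsub>R\<^esub> ?z (Suc k)"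
      using c ze[of k] by (simp add: a_minus_def R.r_distr R.r_minus R.m_assoc)
    then have zb: "?z k \<cdot> ?b = ?z k" using that zk by (simp add: a_minus_def)
    have "?z k \<cdot> ?b [^]\<^bsub>R\<^esub> i = ?z k" for i :: nat
    proof (induction i)
      case (Suc i)
      have "?z k \<cdot> ?b [^]\<^bsub>R\<^esub> Suc i = ?z k \<cdot> ?b [^]\<^bsub>R\<^esub> i \<cdot> ?b"
        using c zk by (simp add: R.m_assoc)
      then show ?case using Suc zb by simp
    qed (use zk in simp)
    from this[of m] show ?thesis using m zk by simp
  qed
  \<comment> \<open>Descends from e a^n = 0 to e a^0 = e; once k has reached n the truncated
    difference stays 0.\<close>
  have "?z (n - k) = \<zero>\<^bsub>R\<^esub>" for k
  proof (induction k)
    case (Suc k)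
    then show ?case
      using step[of "n - Suc k"] by (cases "k < n") (simp_all add: Suc_diff_Suc del: R.nat_pow_Suc)
  qed (use n c in simp)
  from this[of n] show ?thesis using c by simp
qed

lemmas noncomm_simps = a_minus_def R.l_distr R.r_distr R.l_minus R.r_minus R.m_assoc R.a_ac
  R.minus_add R.r_neg R.l_neg R.r_neg1 R.r_neg2

text \<open>
  Here \<open>a' = 3a\<^sup>2 - 2a\<^sup>3\<close> is the Newton step for the equation \<open>a\<^sup>2 = a\<close>; the coefficient is \<open>w = 4b - 3\<close>.
\<close>

lemma idem_correction:
  assumes a: "a \<in> carrier R"
  defines "b \<equiv> a \<cdot> a \<ominus>\<^bsub>R\<^esub> a"
  defines "a' \<equiv> a \<oplus>\<^bsub>R\<^esub> (\<one>\<^bsub>R\<^esub> \<ominus>\<^bsub>R\<^esub> a \<ominus>\<^bsub>R\<^esub> a) \<cdot> b"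
  shows "\<exists>w\<in>carrier R. a' \<cdot> a' \<ominus>\<^bsub>R\<^esub> a' = w \<cdot> b \<cdot> b"
proof -
  let ?s = "\<one>\<^bsub>R\<^esub> \<ominus>\<^bsub>R\<^esub> a \<ominus>\<^bsub>R\<^esub> a"
  have b: "b \<in> carrier R" and s: "?s \<in> carrier R" using a by (simp_all add: b_def)
  have ab: "b \<cdot> a = a \<cdot> b" using a unfolding b_def by (simp add: noncomm_simps)
  have aa: "a \<cdot> a = b \<oplus>\<^bsub>R\<^esub> a" using a unfolding b_def by (simp add: noncomm_simps)
  have sb: "b \<cdot> ?s = ?s \<cdot> b" using a b ab by (simp add: noncomm_simps)
  have sa: "a \<cdot> ?s = ?s \<cdot> a" using a by (simp add: noncomm_simps)
  have ss: "?s \<cdot> ?s = \<one>\<^bsub>R\<^esub> \<oplus>\<^bsub>R\<^esub> (b \<oplus>\<^bsub>R\<^esub> b \<oplus>\<^bsub>R\<^esub> b \<oplus>\<^bsub>R\<^esub> b)" using a b unfolding b_def by (simp add: noncomm_simps)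
  have cancel: "p \<oplus>\<^bsub>R\<^esub> (x \<oplus>\<^bsub>R\<^esub> (\<ominus>\<^bsub>R\<^esub> p \<oplus>\<^bsub>R\<^esub> y)) = x \<oplus>\<^bsub>R\<^esub> y"
    if "p \<in> carrier R" "x \<in> carrier R" "y \<in> carrier R" for p x y
    using that R.a_lcomm[of p x] by (simp add: R.r_neg2)
  define f where "f = b \<oplus>\<^bsub>R\<^esub> b \<oplus>\<^bsub>R\<^esub> b \<oplus>\<^bsub>R\<^esub> b"
  have f: "f \<in> carrier R" using b by (simp add: f_def)
  define s where "s = ?s"
  have sc: "s \<in> carrier R" using s by (simp add: s_def)
  \<comment> \<open>Writing 2 a as 1 - s turns the cross terms 2 a s b into s b - s^2 b, where s^2 =
    1 + 4 b involves b alone.\<close>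
  have s2: "a \<oplus>\<^bsub>R\<^esub> a = \<one>\<^bsub>R\<^esub> \<ominus>\<^bsub>R\<^esub> s" using a unfolding s_def by (simp add: noncomm_simps)
  have "a' \<cdot> a' = a \<cdot> a \<oplus>\<^bsub>R\<^esub> (a \<cdot> (s \<cdot> b) \<oplus>\<^bsub>R\<^esub> s \<cdot> b \<cdot> a) \<oplus>\<^bsub>R\<^esub> s \<cdot> b \<cdot> (s \<cdot> b)"
    unfolding a'_def s_def[symmetric] using a b sc by (simp add: noncomm_simps)
  also have "a \<cdot> (s \<cdot> b) \<oplus>\<^bsub>R\<^esub> s \<cdot> b \<cdot> a = s \<cdot> (a \<oplus>\<^bsub>R\<^esub> a) \<cdot> b"
    using a b sc ab sa unfolding s_def[symmetric] by (simp add: R.m_assoc R.l_distr R.r_distr R.m_assoc[symmetric, of a s])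
  also have "s \<cdot> (a \<oplus>\<^bsub>R\<^esub> a) \<cdot> b = s \<cdot> b \<ominus>\<^bsub>R\<^esub> s \<cdot> s \<cdot> b" 
    unfolding s2 using b sc by (simp add: noncomm_simps)
  also have "s \<cdot> b \<cdot> (s \<cdot> b) = s \<cdot> s \<cdot> b \<cdot> b"
    using sb b sc unfolding s_def[symmetric] by (metis R.m_assoc R.m_closed)
  also have "s \<cdot> s = \<one>\<^bsub>R\<^esub> \<oplus>\<^bsub>R\<^esub> f" using ss by (simp add: s_def f_def)
  finally have "a' \<cdot> a' = b \<oplus>\<^bsub>R\<^esub> a \<oplus>\<^bsub>R\<^esub> (s \<cdot> b \<ominus>\<^bsub>R\<^esub> (\<one>\<^bsub>R\<^esub> \<oplus>\<^bsub>R\<^esub> f) \<cdot> b) \<oplus>\<^bsub>R\<^esub> (\<one>\<^bsub>R\<^esub> \<oplus>\<^bsub>R\<^esub> f) \<cdot> b \<cdot> b"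
    using aa by simp
  moreover have "a' = a \<oplus>\<^bsub>R\<^esub> s \<cdot> b" by (simp add: a'_def s_def)
  ultimately have "a' \<cdot> a' \<ominus>\<^bsub>R\<^esub> a' = (\<one>\<^bsub>R\<^esub> \<oplus>\<^bsub>R\<^esub> f) \<cdot> b \<cdot> b \<ominus>\<^bsub>R\<^esub> f \<cdot> b"
    using a b sc f by (simp add: noncomm_simps cancel)
  also have "\<dots> = (f \<ominus>\<^bsub>R\<^esub> (\<one>\<^bsub>R\<^esub> \<oplus>\<^bsub>R\<^esub> \<one>\<^bsub>R\<^esub> \<oplus>\<^bsub>R\<^esub> \<one>\<^bsub>R\<^esub>)) \<cdot> b \<cdot> b"
    using b unfolding f_def by (simp add: noncomm_simps)
  finally show ?thesis by (rule bexI) (use f in simp)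
qed

end

section \<open>The graded radical of a graded left Artinian ring\<close>

lemma (in abelian_group) minus_eq_zero_iff:
  assumes "x \<in> carrier G" "y \<in> carrier G"
  shows "x \<ominus> y = \<zero> \<longleftrightarrow> x = y"
  using assms minus_equality[of x "\<ominus> y"] by (auto simp: a_minus_def r_neg)

lemma (in graded_ring) set_power_SucI: "a \<in> L \<Longrightarrow> b \<in> set_power L n \<Longrightarrow> a \<cdot> b \<in> set_power L (Suc n)"
  by auto

locale gr_artin = graded_ring G R A
  for G :: "('g, 'e) monoid_scheme" (structure) and R :: "('a, 'c) ring_scheme" (structure)
    and A :: "'g \<Rightarrow> 'a set" +
  assumes artinian: "gr_left_artinian G R A"
begin

lemma artin_minimal:
  assumes "S \<noteq> {}" "\<And>L. L \<in> S \<Longrightarrow> gr_left_ideal L"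
  obtains L where "L \<in> S" "\<And>K. K \<in> S \<Longrightarrow> K \<subseteq> L \<Longrightarrow> K = L"
proof (rule ccontr)
  note minimal = that
  assume "\<not> thesis"
  then have *: "\<exists>K\<in>S. K \<subset> L" if "L \<in> S" for L using that minimal by blast
  obtain L0 where L0: "L0 \<in> S" using assms by blast
  have "\<exists>f. \<forall>n::nat. f n \<in> S \<and> f (Suc n) \<subset> f n"
    by (rule dependent_nat_choice) (use L0 * in auto)
  then obtain f :: "nat \<Rightarrow> 'a set" where f: "\<And>n. f n \<in> S" "\<And>n. f (Suc n) \<subset> f n" by blast
  have "\<forall>n. gr_submodule G R (gr_regular R A) (f n)"
    using f(1) assms(2) by (simp add: reg.gr_submodule_iff gsub_regular)
  moreover have "\<forall>n. f (Suc n) \<subseteq> f n" using f(2) by blast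
  ultimately obtain m where m: "\<forall>n\<ge>m. f n = f m" using artinian unfolding gr_left_artinian_def by blast
  have "f (Suc m) = f m" by (rule m[rule_format]) simp
  then show False using f(2)[of m] by simp
qed

text \<open>Bracket the 2 n factors in pairs. This carries nilpotence from the set of products of
  two elements of L back to L.\<close>

lemma set_power_square: "L \<subseteq> carrier R \<Longrightarrow> set_power L (2 * n) \<subseteq> set_power {a \<cdot> b |a b. a \<in> L \<and> b \<in> L} n"
proof (induction n)
  case (Suc n)
  show ?case
  proof
    fix y assume "y \<in> set_power L (2 * Suc n)"
    then obtain a b c where y: "y = a \<cdot> (b \<cdot> c)" "a \<in> L" "b \<in> L" "c \<in> set_power L (2 * n)" by auto
    moreover have "c \<in> carrier R" using y(4) set_power_closed[OF Suc.prems] by blast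
    ultimately have "y = (a \<cdot> b) \<cdot> c" using Suc.prems by (simp add: R.m_assoc subset_iff)
    moreover have "c \<in> set_power {a \<cdot> b |a b. a \<in> L \<and> b \<in> L} n" using Suc y(4) by blast
    ultimately show "y \<in> set_power {a \<cdot> b |a b. a \<in> L \<and> b \<in> L} (Suc n)" using y(2,3) by auto
  qed
qed simp

text \<open>
  Hopkins' argument. With \<open>K\<close> minimal non-nilpotent, so that \<open>K\<close> is generated by \<open>K K\<close>, and \<open>I\<close> minimal with
  \<open>K I \<noteq> 0\<close>, one gets \<open>I = K x\<close> and \<open>a x = x\<close> for some \<open>a \<in> K\<close> of degree \<open>1\<close>. The defect \<open>b = a\<^sup>2 - a\<close> kills \<open>x\<close> and
  hence lies in a nilpotent ideal. Choosing \<open>a\<close> with \<open>R b\<close> minimal makes the Newton step stationary,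
  \<open>b = (r w b) b\<close>, so \<open>b = 0\<close>; this replaces the usual lifting of idempotents.
\<close>

lemma nonnilpotent_idem:
  assumes L: "gr_left_ideal L" and nn: "\<not> nilpotent L"
  obtains e where "e \<in> L" "e \<in> A \<one>\<^bsub>G\<^esub>" "e \<noteq> \<zero>\<^bsub>R\<^esub>" "e \<cdot> e = e"
proof -
  obtain K where K: "gr_left_ideal K" "K \<subseteq> L" "\<not> nilpotent K"
    and Kmin: "\<And>N. gr_left_ideal N \<Longrightarrow> N \<subseteq> K \<Longrightarrow> \<not> nilpotent N \<Longrightarrow> N = K"
  proof (rule artin_minimal[of "{K. gr_left_ideal K \<and> K \<subseteq> L \<and> \<not> nilpotent K}"])
    show "{K. gr_left_ideal K \<and> K \<subseteq> L \<and> \<not> nilpotent K} \<noteq> {}" using L nn by blast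
  qed blast+
  note Kc = gr_left_idealD(1)[OF K(1)]
  let ?P = "{a \<cdot> b |a b. a \<in> K \<and> b \<in> K}"
  \<comment> \<open>The graded left ideal generated by K K, taken as an intersection: any graded
    left ideal containing all products then contains it at once.\<close>
  let ?H = "\<Inter>{N. gr_left_ideal N \<and> ?P \<subseteq> N}"
  have PK: "?P \<subseteq> K" using gr_left_idealD(4)[OF K(1)] Kc by blast
  have "gr_left_ideal ?H" by (rule gr_left_ideal_Inter) (use K(1) PK in blast)+
  moreover have "?H \<subseteq> K" using K(1) PK by blast
  moreover have "\<not> nilpotent ?H"
  proof
    assume "nilpotent ?H"
    then have "nilpotent ?P" by (rule nilpotent_mono[rotated]) blast
    then obtain n where "set_power ?P n \<subseteq> {\<zero>\<^bsub>R\<^esub>}" unfolding nilpotent_def by blast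
    then have "set_power K (2 * n) \<subseteq> {\<zero>\<^bsub>R\<^esub>}" using set_power_square[OF Kc, of n] by blast
    then show False using K(3) unfolding nilpotent_def by blast
  qed
  ultimately have HK: "?H = K" by (rule Kmin)
  \<comment> \<open>K cannot annihilate K x unless it annihilates x: otherwise the annihilator of x
    in K is a graded left ideal containing K K, hence all of K.\<close>
  have key: "\<exists>a\<in>K. \<exists>b\<in>K. a \<cdot> (b \<cdot> x) \<noteq> \<zero>\<^bsub>R\<^esub>"
    if x: "x \<in> A h" "h \<in> carrier G" and c: "c \<in> K" "c \<cdot> x \<noteq> \<zero>\<^bsub>R\<^esub>" for x h c
  proof (rule ccontr)
    assume "\<not> ?thesis"
    then have z: "a \<cdot> (b \<cdot> x) = \<zero>\<^bsub>R\<^esub>" if "a \<in> K" "b \<in> K" for a b using that by blast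
    have "?P \<subseteq> {c \<in> K. c \<cdot> x = \<zero>\<^bsub>R\<^esub>}"
    proof
      fix y assume yP: "y \<in> ?P"
      then obtain a b where ab: "y = a \<cdot> b" "a \<in> K" "b \<in> K" by blast
      then have "y \<cdot> x = a \<cdot> (b \<cdot> x)" using Kc A_closed[OF x] by (simp add: R.m_assoc subset_iff)
      then show "y \<in> {c \<in> K. c \<cdot> x = \<zero>\<^bsub>R\<^esub>}" using z[OF ab(2,3)] yP PK by auto
    qed
    then have "?H \<subseteq> {c \<in> K. c \<cdot> x = \<zero>\<^bsub>R\<^esub>}" using gr_left_ideal_ann[OF K(1) x] by (intro Inter_lower) simp
    then have "K \<subseteq> {c \<in> K. c \<cdot> x = \<zero>\<^bsub>R\<^esub>}" unfolding HK .
    then show False using c by blast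
  qed
  let ?F = "{I. gr_left_ideal I \<and> (\<exists>y\<in>I. \<exists>a\<in>K. a \<cdot> y \<noteq> \<zero>\<^bsub>R\<^esub>)}"
  have "K \<in> ?F"
  proof (rule ccontr)
    assume "K \<notin> ?F"
    then have z: "a \<cdot> y = \<zero>\<^bsub>R\<^esub>" if "a \<in> K" "y \<in> K" for a y using K(1) that by blast
    have "set_power K 2 \<subseteq> {\<zero>\<^bsub>R\<^esub>}"
    proof
      fix y assume "y \<in> set_power K 2"
      then obtain a b where y: "y = a \<cdot> (b \<cdot> \<one>\<^bsub>R\<^esub>)" "a \<in> K" "b \<in> K" by (auto simp: numeral_2_eq_2)
      then have "b \<in> carrier R" using Kc by blast
      then show "y \<in> {\<zero>\<^bsub>R\<^esub>}" using y z by simp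
    qed
    then show False using K(3) unfolding nilpotent_def by blast
  qed
  then obtain I where I: "I \<in> ?F" and Imin: "\<And>N. N \<in> ?F \<Longrightarrow> N \<subseteq> I \<Longrightarrow> N = I"
    using artin_minimal[of ?F] by blast
  have gI: "gr_left_ideal I" using I by blast
  obtain y c where y: "y \<in> I" and c: "c \<in> K" "c \<cdot> y \<noteq> \<zero>\<^bsub>R\<^esub>" using I by blast
  have cR: "c \<in> carrier R" using c Kc by blast
  have yR: "y \<in> carrier R" using y gr_left_idealD(1)[OF gI] by blast
  \<comment> \<open>Some homogeneous component of y is not killed by c either; it replaces y so that
    K x and the annihilator of x are graded.\<close>
  have "\<exists>h\<in>carrier G. c \<cdot> dR.c y h \<noteq> \<zero>\<^bsub>R\<^esub>"
  proof (rule ccontr)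
    assume "\<not> ?thesis"
    then have "c \<cdot> y = \<zero>\<^bsub>R\<^esub>"
      by (intro dR.component_induct[where Q = "\<lambda>z. c \<cdot> z = \<zero>\<^bsub>R\<^esub>", OF yR]) (use cR in \<open>auto simp: R.r_distr\<close>)
    then show False using c by blast
  qed
  then obtain h where h: "h \<in> carrier G" "c \<cdot> dR.c y h \<noteq> \<zero>\<^bsub>R\<^esub>" by blast
  define x where "x = dR.c y h"
  have x: "x \<in> A h" "x \<in> I" "c \<cdot> x \<noteq> \<zero>\<^bsub>R\<^esub>"
    using h yR y gr_left_idealD(5)[OF gI] by (auto simp: x_def dR.component_in)
  have xR: "x \<in> carrier R" using A_closed[OF x(1) h(1)] .
  have x0: "x \<noteq> \<zero>\<^bsub>R\<^esub>" using x(3) cR by auto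
  have "{a \<cdot> x |a. a \<in> K} \<in> ?F"
    using gr_left_ideal_mult_homog[OF K(1) x(1) h(1)] key[OF x(1) h(1) c(1) x(3)] by blast
  moreover have "{a \<cdot> x |a. a \<in> K} \<subseteq> I" using gr_left_idealD(4)[OF gI] Kc x(2) by blast
  ultimately have "{a \<cdot> x |a. a \<in> K} = I" by (rule Imin)
  then have "x \<in> {a \<cdot> x |a. a \<in> K}" using x(2) by simp
  then obtain a0 where "a0 \<in> K" "x = a0 \<cdot> x" by blast
  then have a0: "a0 \<in> K" "a0 \<cdot> x = x" by simp_all
  \<comment> \<open>Since x is homogeneous, comparing degrees in a0 x = x shows that the degree 1
    component of a0 alone already fixes x.\<close>
  let ?E = "{a. a \<in> K \<and> a \<in> A \<one>\<^bsub>G\<^esub> \<and> a \<cdot> x = x}"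
  have "dR.c a0 \<one>\<^bsub>G\<^esub> \<in> ?E"
  proof -
    have "a0 \<in> carrier R" using a0 Kc by blast
    moreover from this have "dR.c a0 \<one>\<^bsub>G\<^esub> \<cdot> x = x"
      using component_mult[OF x(1) G.one_closed h(1), of a0] a0 h(1) component_self1[OF x(1) h(1)] by simp
    ultimately show ?thesis using a0 gr_left_idealD(5)[OF K(1)] by (auto simp: dR.component_in)
  qed
  then have ne: "?E \<noteq> {}" by blast
  define b where "b a = a \<cdot> a \<ominus>\<^bsub>R\<^esub> a" for a
  let ?B = "(\<lambda>a. {r \<cdot> b a |r. r \<in> carrier R}) ` ?E"
  have bA: "b a \<in> A \<one>\<^bsub>G\<^esub>" if "a \<in> A \<one>\<^bsub>G\<^esub>" for a using that by (simp add: b_def A1_minus A1_mult)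
  obtain B where B: "B \<in> ?B" and Bmin: "\<And>N. N \<in> ?B \<Longrightarrow> N \<subseteq> B \<Longrightarrow> N = B"
  proof (rule artin_minimal[of ?B])
    show "gr_left_ideal L" if "L \<in> ?B" for L using that gr_left_ideal_principal[OF bA G.one_closed] by blast
  qed (use ne in blast)+
  then obtain a where a: "a \<in> K" "a \<in> A \<one>\<^bsub>G\<^esub>" "a \<cdot> x = x" and Ba: "B = {r \<cdot> b a |r. r \<in> carrier R}" by blast
  have aR: "a \<in> carrier R" using a by (simp add: A1_closed)
  have bR: "b a \<in> carrier R" using bA[OF a(2)] by (simp add: A1_closed)
  let ?N = "{c \<in> K. c \<cdot> x = \<zero>\<^bsub>R\<^esub>}"
  have gN: "gr_left_ideal ?N" by (rule gr_left_ideal_ann[OF K(1) x(1) h(1)])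
  \<comment> \<open>The annihilator of x in K is proper because c does not lie in it, so minimality
    of K makes it nilpotent.\<close>
  have nN: "nilpotent ?N"
  proof (rule ccontr)
    assume "\<not> nilpotent ?N"
    then have "?N = K" using Kmin[OF gN] by blast
    then show False using c(1) x(3) by blast
  qed
  have bN: "b a \<in> ?N"
  proof -
    have "b a \<cdot> x = a \<cdot> (a \<cdot> x) \<ominus>\<^bsub>R\<^esub> a \<cdot> x"
      using aR xR by (simp add: b_def a_minus_def R.l_distr R.l_minus R.m_assoc)
    also have "\<dots> = \<zero>\<^bsub>R\<^esub>" using a(3) xR by (simp add: a_minus_def R.r_neg)
    finally show ?thesis
      using a(1) aR gr_left_idealD(3,4,6)[OF K(1)] by (simp add: b_def a_minus_def)
  qed
  define a' where "a' = a \<oplus>\<^bsub>R\<^esub> (\<one>\<^bsub>R\<^esub> \<ominus>\<^bsub>R\<^esub> a \<ominus>\<^bsub>R\<^esub> a) \<cdot> b a"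
  obtain w where w: "w \<in> carrier R" "b a' = w \<cdot> b a \<cdot> b a"
    using idem_correction[OF aR] unfolding a'_def b_def by blast
  have s: "\<one>\<^bsub>R\<^esub> \<ominus>\<^bsub>R\<^esub> a \<ominus>\<^bsub>R\<^esub> a \<in> A \<one>\<^bsub>G\<^esub>" using a(2) one_homogeneous A1_minus by blast
  have "a' \<in> ?E"
  proof -
    have "a' \<in> A \<one>\<^bsub>G\<^esub>" using a(2) s bA unfolding a'_def by (intro A1_add A1_mult) auto
    moreover have "a' \<in> K"
      using a(1) bN gr_left_idealD(3,4)[OF K(1)] s unfolding a'_def by (auto simp: A1_closed)
    moreover have "a' \<cdot> x = x"
      using a bN aR xR bR s unfolding a'_def by (simp add: R.l_distr R.m_assoc A1_closed)
    ultimately show ?thesis by blast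
  qed
  then have "{r \<cdot> b a' |r. r \<in> carrier R} \<in> ?B" by blast
  moreover have "{r \<cdot> b a' |r. r \<in> carrier R} \<subseteq> B"
  proof -
    have "r \<cdot> b a' = (r \<cdot> (w \<cdot> b a)) \<cdot> b a" if "r \<in> carrier R" for r
      using w bR that by (simp add: R.m_assoc)
    then show ?thesis unfolding Ba using w(1) bR by blast
  qed
  ultimately have "{r \<cdot> b a' |r. r \<in> carrier R} = B" by (rule Bmin)
  moreover have "b a \<in> B"
  proof -
    have "b a = \<one>\<^bsub>R\<^esub> \<cdot> b a" using bR by simp
    then show ?thesis unfolding Ba by blast
  qed
  ultimately have "b a \<in> {r \<cdot> b a' |r. r \<in> carrier R}" by simp
  then obtain r where r: "r \<in> carrier R" "b a = r \<cdot> b a'" by blast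
  have "b a = \<zero>\<^bsub>R\<^esub>"
  proof (rule nilpotent_fix[OF nN])
    show "r \<cdot> (w \<cdot> b a) \<in> ?N" by (intro gr_left_idealD(4)[OF gN] r(1) w(1) bN)
    have "r \<cdot> (w \<cdot> b a) \<cdot> b a = r \<cdot> (w \<cdot> b a \<cdot> b a)" using r(1) w(1) bR by (simp add: R.m_assoc)
    also have "\<dots> = b a" unfolding w(2)[symmetric] by (rule r(2)[symmetric])
    finally show "r \<cdot> (w \<cdot> b a) \<cdot> b a = b a" .
  qed (use bR Kc in auto)
  then have "a \<cdot> a = a" using aR unfolding b_def by (simp add: R.minus_eq_zero_iff)
  moreover have "a \<noteq> \<zero>\<^bsub>R\<^esub>" using a(3) x0 xR by auto
  ultimately show ?thesis using that a K(2) by blast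
qed

text \<open>
  The graded Jacobson radical. That a sum of two nilpotent graded left ideals is nilpotent follows
  from \<open>nonnilpotent_idem\<close>: an idempotent \<open>e = a + b\<close> with \<open>e a e\<close> and \<open>e b e\<close> nilpotent is zero.
\<close>

definition J :: "'a set" where
  "J = \<Union>{L. gr_left_ideal L \<and> nilpotent L}"

lemma nilpotent_no_idem:
  assumes "nilpotent L" "gr_left_ideal L" "e \<in> L" "e \<cdot> e = e"
  shows "e = \<zero>\<^bsub>R\<^esub>"
  using nilpotent_fix[OF assms(1) gr_left_idealD(1)[OF assms(2)] assms(3) gr_left_idealD(7)[OF assms(2,3)] assms(4)] .

lemma nilpotent_sum:
  assumes L: "gr_left_ideal L" "nilpotent L" and K: "gr_left_ideal K" "nilpotent K"
  shows "nilpotent {x \<oplus>\<^bsub>R\<^esub> y |x y. x \<in> L \<and> y \<in> K}" (is "nilpotent ?S")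
proof (rule ccontr)
  \<comment> \<open>N is only a left ideal, so e a e need not lie in it. But e a does, and (e a
    e)^(k+1) = (e a)^(k+1) e.\<close>
  have pow: "\<exists>n::nat. (e \<cdot> a \<cdot> e) [^]\<^bsub>R\<^esub> n = \<zero>\<^bsub>R\<^esub>"
    if N: "gr_left_ideal N" "nilpotent N" and a: "a \<in> N" and e: "e \<in> carrier R" "e \<cdot> e = e" for N a e
  proof -
    let ?u = "e \<cdot> a"
    have aR: "a \<in> carrier R" using a gr_left_idealD(1)[OF N(1)] by blast
    have uN: "?u \<in> N" using gr_left_idealD(4)[OF N(1)] a e by blast
    obtain n :: nat where n: "?u [^]\<^bsub>R\<^esub> n = \<zero>\<^bsub>R\<^esub>" using nilpotent_pow[OF N(2) gr_left_idealD(1)[OF N(1)] uN] by blast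
    have eu: "e \<cdot> ?u = ?u" using aR e by (simp add: R.m_assoc[symmetric])
    have "(?u \<cdot> e) [^]\<^bsub>R\<^esub> Suc k = ?u [^]\<^bsub>R\<^esub> Suc k \<cdot> e" for k :: nat
    proof (induction k)
      case (Suc k)
      let ?p = "?u [^]\<^bsub>R\<^esub> Suc k"
      have p: "?p \<in> carrier R" using aR e by simp
      have "(?u \<cdot> e) [^]\<^bsub>R\<^esub> Suc (Suc k) = (?u \<cdot> e) [^]\<^bsub>R\<^esub> Suc k \<cdot> (?u \<cdot> e)" by (rule R.nat_pow_Suc)
      also have "\<dots> = ?p \<cdot> e \<cdot> (?u \<cdot> e)" using Suc by simp
      also have "\<dots> = ?p \<cdot> (e \<cdot> ?u) \<cdot> e" using p aR e by (simp add: R.m_assoc del: R.nat_pow_Suc)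
      also have "\<dots> = ?u [^]\<^bsub>R\<^esub> Suc (Suc k) \<cdot> e" unfolding eu by simp
      finally show ?case .
    qed (use aR e in simp)
    from this[of n] have "(?u \<cdot> e) [^]\<^bsub>R\<^esub> Suc n = \<zero>\<^bsub>R\<^esub>" using n aR e by simp
    then show ?thesis by blast
  qed
  assume "\<not> nilpotent ?S"
  then obtain e where e: "e \<in> ?S" "e \<in> A \<one>\<^bsub>G\<^esub>" "e \<noteq> \<zero>\<^bsub>R\<^esub>" "e \<cdot> e = e"
    using nonnilpotent_idem[OF gr_left_ideal_sum[OF L(1) K(1)]] by blast
  then obtain a b where ab: "e = a \<oplus>\<^bsub>R\<^esub> b" "a \<in> L" "b \<in> K" by blast
  have eR: "e \<in> carrier R" using e A1_closed by blast
  have aR: "a \<in> carrier R" and bR: "b \<in> carrier R" using ab gr_left_idealD(7)[OF L(1)] gr_left_idealD(7)[OF K(1)] by auto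
  have "e = e \<cdot> (a \<oplus>\<^bsub>R\<^esub> b) \<cdot> e" using e ab(1) by simp
  also have "\<dots> = e \<cdot> a \<cdot> e \<oplus>\<^bsub>R\<^esub> e \<cdot> b \<cdot> e" using eR aR bR by (simp add: R.l_distr R.r_distr)
  finally have sum: "e = e \<cdot> a \<cdot> e \<oplus>\<^bsub>R\<^esub> e \<cdot> b \<cdot> e" .
  have minus: "e \<cdot> b \<cdot> e = e \<ominus>\<^bsub>R\<^esub> e \<cdot> a \<cdot> e"
  proof -
    have "(p \<oplus>\<^bsub>R\<^esub> q) \<ominus>\<^bsub>R\<^esub> p = q" if "p \<in> carrier R" "q \<in> carrier R" for p q
      using that R.a_lcomm[of p q "\<ominus>\<^bsub>R\<^esub> p"] by (simp add: a_minus_def R.a_assoc R.r_neg)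
    from this[of "e \<cdot> a \<cdot> e" "e \<cdot> b \<cdot> e"] show ?thesis using sum eR aR bR by simp
  qed
  obtain n :: nat where n: "(e \<cdot> a \<cdot> e) [^]\<^bsub>R\<^esub> n = \<zero>\<^bsub>R\<^esub>" using pow[OF L ab(2) eR e(4)] by blast
  obtain m :: nat where m: "(e \<cdot> b \<cdot> e) [^]\<^bsub>R\<^esub> m = \<zero>\<^bsub>R\<^esub>" using pow[OF K ab(3) eR e(4)] by blast
  have "e = \<zero>\<^bsub>R\<^esub>"
  proof (rule left_zero_of_idem_sum[of "e \<cdot> a \<cdot> e"])
    show "(e \<ominus>\<^bsub>R\<^esub> e \<cdot> a \<cdot> e) [^]\<^bsub>R\<^esub> m = \<zero>\<^bsub>R\<^esub>" using m minus by simp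
    show "e \<cdot> a \<cdot> e \<cdot> e = e \<cdot> a \<cdot> e" using eR aR e(4) by (simp add: R.m_assoc)
    show "e \<cdot> (e \<cdot> a \<cdot> e) = e \<cdot> a \<cdot> e" using eR aR e(4) by (simp add: R.m_assoc[symmetric])
  qed (use n eR aR e in auto)
  then show False using e by blast
qed

lemma JI: "gr_left_ideal L \<Longrightarrow> nilpotent L \<Longrightarrow> x \<in> L \<Longrightarrow> x \<in> J"
  unfolding J_def by blast

lemma JE:
  assumes "x \<in> J" obtains L where "gr_left_ideal L" "nilpotent L" "x \<in> L"
  using assms unfolding J_def by blast

lemma J_add:
  assumes "x \<in> J" "y \<in> J"
  shows "x \<oplus>\<^bsub>R\<^esub> y \<in> J"
proof -
  obtain L where L: "gr_left_ideal L" "nilpotent L" "x \<in> L" using JE assms(1) .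
  obtain K where K: "gr_left_ideal K" "nilpotent K" "y \<in> K" using JE assms(2) .
  show ?thesis
    by (rule JI[OF gr_left_ideal_sum[OF L(1) K(1)] nilpotent_sum[OF L(1,2) K(1,2)]]) (use L(3) K(3) in blast)
qed

lemma gr_left_ideal_J: "gr_left_ideal J"
proof (rule gr_left_idealI)
  show "J \<subseteq> carrier R" unfolding J_def using gr_left_idealD(1) by blast
  have "gr_left_ideal {\<zero>\<^bsub>R\<^esub>}"
    by (rule gr_left_idealI) (use reg.component_zero in auto)
  moreover have "set_power {\<zero>\<^bsub>R\<^esub>} 1 \<subseteq> {\<zero>\<^bsub>R\<^esub>}" by auto
  ultimately show "\<zero>\<^bsub>R\<^esub> \<in> J" using JI nilpotent_def by blast
  show "a \<cdot> x \<in> J" if "a \<in> carrier R" "x \<in> J" for a x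
    using that(2) by (rule JE) (use that(1) gr_left_idealD(4) JI in blast)
  show "dR.c x g \<in> J" if "g \<in> carrier G" "x \<in> J" for g x
    using that(2) by (rule JE) (use that(1) gr_left_idealD(5) JI in blast)
qed (rule J_add)

text \<open>No common bound on the exponents is available in advance. If J were not nilpotent, it
  would contain a nonzero idempotent, and that idempotent would already lie in one of the nilpotent
  ideals whose union is J.\<close>

lemma nilpotent_J: "nilpotent J"
proof (rule ccontr)
  assume "\<not> nilpotent J"
  then obtain e where e: "e \<in> J" "e \<noteq> \<zero>\<^bsub>R\<^esub>" "e \<cdot> e = e" using nonnilpotent_idem[OF gr_left_ideal_J] by blast
  then show False using nilpotent_no_idem by (metis JE)
qed

lemma J_no_idem: "e \<in> J \<Longrightarrow> e \<cdot> e = e \<Longrightarrow> e = \<zero>\<^bsub>R\<^esub>"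
  using nilpotent_no_idem[OF nilpotent_J gr_left_ideal_J] .

text \<open>J r is a graded left ideal because r is homogeneous, and since r J lies in J, each (J
  r)^(n+1) lies in J^(n+1) r; so J r is nilpotent. The exponent starts at 1 because the empty
  product is 1, which need not be a multiple of r.\<close>

lemma J_right_homog:
  assumes x: "x \<in> J" and r: "r \<in> A h" "h \<in> carrier G"
  shows "x \<cdot> r \<in> J"
proof -
  have rR: "r \<in> carrier R" using r A_closed by blast
  let ?K = "{a \<cdot> r |a. a \<in> J}"
  have JR: "a \<in> carrier R" if "a \<in> J" for a using gr_left_idealD(7)[OF gr_left_ideal_J that] .
  have *: "\<exists>z\<in>set_power J (Suc n). y = z \<cdot> r" if "y \<in> set_power ?K (Suc n)" for n y
    using that
  proof (induction n arbitrary: y)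
    case 0
    then obtain a where "y = a \<cdot> r \<cdot> \<one>\<^bsub>R\<^esub>" "a \<in> J" by auto
    then show ?case using JR rR by (auto intro!: bexI[of _ a] exI[of _ a])
  next
    case (Suc n)
    then obtain a y' where y: "y = a \<cdot> r \<cdot> y'" "a \<in> J" "y' \<in> set_power ?K (Suc n)" by (simp only: set_power.simps(2)[of _ "Suc n"]) blast
    then obtain z where z: "z \<in> set_power J (Suc n)" "y' = z \<cdot> r" using Suc.IH by blast
    then obtain b z' where b: "b \<in> J" "z' \<in> set_power J n" "z = b \<cdot> z'" by auto
    have z'R: "z' \<in> carrier R" using b(2) set_power_closed[OF gr_left_idealD(1)[OF gr_left_ideal_J]] by blast
    have "y = (a \<cdot> ((r \<cdot> b) \<cdot> z')) \<cdot> r" using y z b z'R JR rR by (simp add: R.m_assoc)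
    moreover
    have "r \<cdot> b \<in> J" using gr_left_idealD(4)[OF gr_left_ideal_J rR b(1)] .
    then have "a \<cdot> ((r \<cdot> b) \<cdot> z') \<in> set_power J (Suc (Suc n))" using y(2) b(2) by (intro set_power_SucI)
    ultimately show ?case by blast
  qed
  obtain n where n: "set_power J n \<subseteq> {\<zero>\<^bsub>R\<^esub>}" using nilpotent_J unfolding nilpotent_def by blast
  have n1: "set_power J (Suc n) \<subseteq> {\<zero>\<^bsub>R\<^esub>}" by (rule set_power_zero_mono[OF n _ gr_left_idealD(1)[OF gr_left_ideal_J]]) simp
  have "set_power ?K (Suc n) \<subseteq> {\<zero>\<^bsub>R\<^esub>}"
  proof
    fix y assume "y \<in> set_power ?K (Suc n)"
    then obtain z where z: "z \<in> set_power J (Suc n)" "y = z \<cdot> r" using * by blast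
    then have "z = \<zero>\<^bsub>R\<^esub>" using n1 by blast
    then show "y \<in> {\<zero>\<^bsub>R\<^esub>}" using z rR by simp
  qed
  then have "nilpotent ?K" unfolding nilpotent_def by blast
  then show ?thesis using JI[OF gr_left_ideal_mult_homog[OF gr_left_ideal_J r]] x by blast
qed

lemma J_right:
  assumes x: "x \<in> J" and r: "r \<in> carrier R"
  shows "x \<cdot> r \<in> J"
  using r
proof (induction rule: hom_induct)
  case zero
  then show ?case using gr_left_idealD(2,7)[OF gr_left_ideal_J] x by simp
next
  case (homog g b)
  then show ?case using J_right_homog[OF x] by blast
next
  case (add b c)
  then show ?case using J_add gr_left_idealD(7)[OF gr_left_ideal_J x] by (simp add: R.r_distr)
qed

end

section \<open>Primitive idempotents and principal graded indecomposables\<close>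

context graded_ring
begin

definition cyclic_ideal :: "'a \<Rightarrow> 'a set" where
  "cyclic_ideal e = {a \<cdot> e |a. a \<in> carrier R}"

text \<open>Only idempotents f of degree 1 compete with e: they are the ones that cut out graded
  summands of R e.\<close>

definition primitive_idem :: "'a \<Rightarrow> bool" where
  "primitive_idem e \<longleftrightarrow> e \<in> A \<one>\<^bsub>G\<^esub> \<and> e \<cdot> e = e \<and> e \<noteq> \<zero>\<^bsub>R\<^esub> \<and>
     (\<forall>f\<in>A \<one>\<^bsub>G\<^esub>. f \<cdot> f = f \<and> e \<cdot> f = f \<and> f \<cdot> e = f \<longrightarrow> f = \<zero>\<^bsub>R\<^esub> \<or> f = e)"

lemma primitive_idemD:
  assumes "primitive_idem e"
  shows "e \<in> A \<one>\<^bsub>G\<^esub>" "e \<in> carrier R" "e \<cdot> e = e" "e \<noteq> \<zero>\<^bsub>R\<^esub>"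
    "\<And>f. f \<in> A \<one>\<^bsub>G\<^esub> \<Longrightarrow> f \<cdot> f = f \<Longrightarrow> e \<cdot> f = f \<Longrightarrow> f \<cdot> e = f \<Longrightarrow> f \<noteq> \<zero>\<^bsub>R\<^esub> \<Longrightarrow> f = e"
  using assms A1_closed unfolding primitive_idem_def by blast+

lemma cyclic_ideal_iff:
  assumes "e \<in> carrier R" "e \<cdot> e = e"
  shows "x \<in> cyclic_ideal e \<longleftrightarrow> x \<in> carrier R \<and> x \<cdot> e = x"
proof
  assume "x \<in> cyclic_ideal e"
  then obtain a where "a \<in> carrier R" "x = a \<cdot> e" unfolding cyclic_ideal_def by blast
  then show "x \<in> carrier R \<and> x \<cdot> e = x" using assms by (simp add: R.m_assoc)
next
  assume x: "x \<in> carrier R \<and> x \<cdot> e = x"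
  then have "x = x \<cdot> e" by simp
  then show "x \<in> cyclic_ideal e" unfolding cyclic_ideal_def using x by blast
qed

lemma gr_left_ideal_cyclic_ideal: "e \<in> A \<one>\<^bsub>G\<^esub> \<Longrightarrow> gr_left_ideal (cyclic_ideal e)"
  unfolding cyclic_ideal_def by (rule gr_left_ideal_principal) auto

lemma self_cyclic_ideal: assumes "e \<in> carrier R" shows "e \<in> cyclic_ideal e"
proof -
  have "e = \<one>\<^bsub>R\<^esub> \<cdot> e" using assms by simp
  then show ?thesis unfolding cyclic_ideal_def by blast
qed

lemma idem_complement:
  assumes e: "e \<in> carrier R" "e \<cdot> e = e" and f: "f \<in> carrier R" "f \<cdot> f = f" "e \<cdot> f = f" "f \<cdot> e = f"
  shows "(e \<ominus>\<^bsub>R\<^esub> f) \<cdot> f = \<zero>\<^bsub>R\<^esub>" "(e \<ominus>\<^bsub>R\<^esub> f) \<cdot> e = e \<ominus>\<^bsub>R\<^esub> f" "f \<oplus>\<^bsub>R\<^esub> (e \<ominus>\<^bsub>R\<^esub> f) = e"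
    "(e \<ominus>\<^bsub>R\<^esub> f) \<cdot> (e \<ominus>\<^bsub>R\<^esub> f) = e \<ominus>\<^bsub>R\<^esub> f"
proof -
  show 1: "(e \<ominus>\<^bsub>R\<^esub> f) \<cdot> f = \<zero>\<^bsub>R\<^esub>" using e f by (simp add: a_minus_def R.l_distr R.l_minus R.r_neg)
  show 2: "(e \<ominus>\<^bsub>R\<^esub> f) \<cdot> e = e \<ominus>\<^bsub>R\<^esub> f" using e f by (simp add: a_minus_def R.l_distr R.l_minus)
  show "f \<oplus>\<^bsub>R\<^esub> (e \<ominus>\<^bsub>R\<^esub> f) = e" using e f R.a_lcomm[of f e "\<ominus>\<^bsub>R\<^esub> f"] by (simp add: a_minus_def R.r_neg)
  have "(e \<ominus>\<^bsub>R\<^esub> f) \<cdot> (e \<ominus>\<^bsub>R\<^esub> f) = (e \<ominus>\<^bsub>R\<^esub> f) \<cdot> e \<ominus>\<^bsub>R\<^esub> (e \<ominus>\<^bsub>R\<^esub> f) \<cdot> f"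
    using e f by (simp add: a_minus_def R.r_distr R.r_minus)
  then show "(e \<ominus>\<^bsub>R\<^esub> f) \<cdot> (e \<ominus>\<^bsub>R\<^esub> f) = e \<ominus>\<^bsub>R\<^esub> f" using e f unfolding 1 2 by (simp add: a_minus_def)
qed

abbreviation "indecomposable_ideal U \<equiv> gr_indecomposable G R (gr_restrict (gr_regular R A) U)"

lemma indecomposable_ideal_iff:
  assumes "gr_left_ideal U"
  shows "indecomposable_ideal U \<longleftrightarrow> U \<noteq> {\<zero>\<^bsub>R\<^esub>} \<and>
    (\<forall>N N'. gr_left_ideal N \<and> gr_left_ideal N' \<and> {x \<oplus>\<^bsub>R\<^esub> y |x y. x \<in> N \<and> y \<in> N'} = U \<and> N \<inter> N' = {\<zero>\<^bsub>R\<^esub>} \<longrightarrow>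
       N = {\<zero>\<^bsub>R\<^esub>} \<or> N' = {\<zero>\<^bsub>R\<^esub>})"
  using reg.gr_indecomposable_restrict[of U] assms by (simp add: gsub_regular)

text \<open>An idempotent f of degree 1 with e f = f e = f splits R e into the graded left ideals R
  f and R (e - f), so one of f and e - f must vanish.\<close>

lemma primitive_idem_of_indecomposable_ideal:
  assumes e: "e \<in> A \<one>\<^bsub>G\<^esub>" "e \<cdot> e = e" and ind: "indecomposable_ideal (cyclic_ideal e)"
  shows "primitive_idem e"
proof -
  have eR: "e \<in> carrier R" using e A1_closed by blast
  note ind' = ind[unfolded indecomposable_ideal_iff[OF gr_left_ideal_cyclic_ideal[OF e(1)]]]
  have e0: "e \<noteq> \<zero>\<^bsub>R\<^esub>"
  proof
    assume e0: "e = \<zero>\<^bsub>R\<^esub>"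
    have "x = \<zero>\<^bsub>R\<^esub>" if "x \<in> cyclic_ideal e" for x
    proof -
      have "x \<in> carrier R" "x \<cdot> e = x" using cyclic_ideal_iff[OF eR e(2)] that by auto
      then show ?thesis unfolding e0 by simp
    qed
    then have "cyclic_ideal e = {\<zero>\<^bsub>R\<^esub>}" using gr_left_idealD(2)[OF gr_left_ideal_cyclic_ideal[OF e(1)]] by blast
    then show False using conjunct1[OF ind'] by simp
  qed
  have "f = \<zero>\<^bsub>R\<^esub> \<or> f = e" if f: "f \<in> A \<one>\<^bsub>G\<^esub>" "f \<cdot> f = f" "e \<cdot> f = f" "f \<cdot> e = f" for f
  proof -
    have fR: "f \<in> carrier R" using f A1_closed by blast
    define f' where "f' = e \<ominus>\<^bsub>R\<^esub> f"
    have f'A: "f' \<in> A \<one>\<^bsub>G\<^esub>" using A1_minus e f by (simp add: f'_def)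
    have f'R: "f' \<in> carrier R" using f'A A1_closed by blast
    note c = idem_complement[OF eR e(2) fR f(2-4), folded f'_def]
    have sum: "{x \<oplus>\<^bsub>R\<^esub> y |x y. x \<in> cyclic_ideal f \<and> y \<in> cyclic_ideal f'} = cyclic_ideal e"
    proof (intro equalityI subsetI)
      fix z assume "z \<in> {x \<oplus>\<^bsub>R\<^esub> y |x y. x \<in> cyclic_ideal f \<and> y \<in> cyclic_ideal f'}"
      then obtain x y where z: "z = x \<oplus>\<^bsub>R\<^esub> y" "x \<in> cyclic_ideal f" "y \<in> cyclic_ideal f'" by blast
      then obtain a b where ab: "x = a \<cdot> f" "y = b \<cdot> f'" "a \<in> carrier R" "b \<in> carrier R"
        unfolding cyclic_ideal_def by blast
      have "z \<cdot> e = z" using z(1) ab eR fR f'R f(4) c(2) by (simp add: R.l_distr R.m_assoc)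
      then show "z \<in> cyclic_ideal e" using z(1) ab fR f'R cyclic_ideal_iff[OF eR e(2)] by simp
    next
      fix z assume "z \<in> cyclic_ideal e"
      then have z: "z \<in> carrier R" "z \<cdot> e = z" using cyclic_ideal_iff[OF eR e(2)] by auto
      then have "z = z \<cdot> f \<oplus>\<^bsub>R\<^esub> z \<cdot> f'" using c(3) fR f'R by (metis R.r_distr)
      then show "z \<in> {x \<oplus>\<^bsub>R\<^esub> y |x y. x \<in> cyclic_ideal f \<and> y \<in> cyclic_ideal f'}"
        using z(1) unfolding cyclic_ideal_def by blast
    qed
    have int: "cyclic_ideal f \<inter> cyclic_ideal f' = {\<zero>\<^bsub>R\<^esub>}"
    proof (intro equalityI subsetI)
      fix z assume "z \<in> cyclic_ideal f \<inter> cyclic_ideal f'"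
      then have z: "z \<in> carrier R" "z \<cdot> f = z" "z \<cdot> f' = z"
        using cyclic_ideal_iff[OF fR f(2)] cyclic_ideal_iff[OF f'R c(4)] by auto
      then have "z = z \<cdot> f' \<cdot> f" by simp
      also have "\<dots> = \<zero>\<^bsub>R\<^esub>" using z(1) f'R fR c(1) by (simp add: R.m_assoc)
      finally show "z \<in> {\<zero>\<^bsub>R\<^esub>}" by simp
    qed (use gr_left_idealD(2)[OF gr_left_ideal_cyclic_ideal[OF f(1)]] gr_left_idealD(2)[OF gr_left_ideal_cyclic_ideal[OF f'A]] in auto)
    have "cyclic_ideal f = {\<zero>\<^bsub>R\<^esub>} \<or> cyclic_ideal f' = {\<zero>\<^bsub>R\<^esub>}"
      by (rule conjunct2[OF ind', rule_format]) (intro conjI gr_left_ideal_cyclic_ideal f(1) f'A sum int)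
    then have "f = \<zero>\<^bsub>R\<^esub> \<or> f' = \<zero>\<^bsub>R\<^esub>" using self_cyclic_ideal[OF fR] self_cyclic_ideal[OF f'R] by blast
    then show ?thesis using eR fR by (auto simp: f'_def R.minus_eq_zero_iff)
  qed
  then show ?thesis using e e0 unfolding primitive_idem_def by blast
qed

text \<open>The projection of R onto the summand V i is left linear, hence is right multiplication
  by its value e at 1 and has image R e. It preserves degrees, so e has degree 1 like the
  identity.\<close>

lemma principal_primitive_idem:
  assumes "principal_gr_indecomposable G R A U"
  obtains e where "primitive_idem e" "U = cyclic_ideal e"
proof -
  obtain n :: nat and V where V: "\<And>i. i < n \<Longrightarrow> gr_left_ideal (V i)" "\<And>i. i < n \<Longrightarrow> indecomposable_ideal (V i)"
    and ids: "internal_direct_sum (gr_regular R A) {..<n} V" and "\<exists>i<n. U = V i"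
    using assms unfolding principal_gr_indecomposable_def reg.gr_submodule_iff gsub_regular by blast
  then obtain i where i: "i < n" "U = V i" by blast
  interpret V: direct_sum_decomp "gr_regular R A" "{..<n}" V by unfold_locales (rule ids)
  have VR: "x \<in> carrier R" if "x \<in> V k" "k < n" for x k using gr_left_idealD(7)[OF V(1)[OF that(2)] that(1)] .
  have cR: "V.c x k \<in> carrier R" if "x \<in> carrier R" "k < n" for x k
    using V.component_closed[of x k] that by simp
  have c0: "V.c \<zero>\<^bsub>R\<^esub> k = \<zero>\<^bsub>R\<^esub>" if "k < n" for k
    using V.component_self[of "\<zero>\<^bsub>R\<^esub>" k k] gr_left_idealD(2)[OF V(1)[OF that]] that by simp
  have lin: "V.c (a \<cdot> x) k = a \<cdot> V.c x k" if a: "a \<in> carrier R" and x: "x \<in> carrier R" and k: "k < n" for a x k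
  proof (rule V.component_induct[of x])
    show "x \<in> carrier (gr_regular R A)" using x by simp
    show "V.c (a \<cdot> \<zero>\<^bsub>gr_regular R A\<^esub>) k = a \<cdot> V.c \<zero>\<^bsub>gr_regular R A\<^esub> k" using a k c0 by simp
    show "V.c (a \<cdot> V.c x j) k = a \<cdot> V.c (V.c x j) k" if "j \<in> {..<n}" for j
    proof -
      have v: "V.c x j \<in> V j" using V.component_in x that by simp
      then have "a \<cdot> V.c x j \<in> V j" using gr_left_idealD(4)[OF V(1)] a that by simp
      then show ?thesis using V.component_self[of _ j k] v that k a by simp
    qed
    show "V.c (a \<cdot> (y \<oplus>\<^bsub>gr_regular R A\<^esub> z)) k = a \<cdot> V.c (y \<oplus>\<^bsub>gr_regular R A\<^esub> z) k"
      if "y \<in> carrier (gr_regular R A)" "z \<in> carrier (gr_regular R A)"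
        "V.c (a \<cdot> y) k = a \<cdot> V.c y k" "V.c (a \<cdot> z) k = a \<cdot> V.c z k" for y z
      using that V.component_add[of "a \<cdot> y" "a \<cdot> z" k] V.component_add[of y z k] a k cR by (simp add: R.r_distr)
  qed
  have gr: "V.c (dR.c x g) k = dR.c (V.c x k) g" if x: "x \<in> carrier R" and g: "g \<in> carrier G" and k: "k < n" for x g k
  proof (rule V.component_induct[of x])
    show "x \<in> carrier (gr_regular R A)" using x by simp
    show "V.c (dR.c \<zero>\<^bsub>gr_regular R A\<^esub> g) k = dR.c (V.c \<zero>\<^bsub>gr_regular R A\<^esub> k) g"
      using g k c0 reg.component_zero[of g] by simp
    show "V.c (dR.c (V.c x j) g) k = dR.c (V.c (V.c x j) k) g" if "j \<in> {..<n}" for j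
    proof -
      have v: "V.c x j \<in> V j" using V.component_in x that by simp
      then have "dR.c (V.c x j) g \<in> V j" using gr_left_idealD(5)[OF V(1)] g that by simp
      then show ?thesis using V.component_self[of _ j k] v that k g reg.component_zero[of g] by simp
    qed
    show "V.c (dR.c (y \<oplus>\<^bsub>gr_regular R A\<^esub> z) g) k = dR.c (V.c (y \<oplus>\<^bsub>gr_regular R A\<^esub> z) k) g"
      if "y \<in> carrier (gr_regular R A)" "z \<in> carrier (gr_regular R A)"
        "V.c (dR.c y g) k = dR.c (V.c y k) g" "V.c (dR.c z g) k = dR.c (V.c z k) g" for y z
      using that V.component_add[of "dR.c y g" "dR.c z g" k] V.component_add[of y z k] g k cR
      by (simp add: dR.component_add dR.component_closed)
  qed
  define e where "e = V.c \<one>\<^bsub>R\<^esub> i"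
  have eV: "e \<in> V i" unfolding e_def using V.component_in i(1) by simp
  have eR: "e \<in> carrier R" using VR eV i by blast
  have ve: "v \<cdot> e = v" if v: "v \<in> V i" for v
    using lin[OF VR[OF v i(1)] R.one_closed i(1)] VR[OF v i(1)] V.component_self[of v i i] v i(1)
    by (simp add: e_def)
  have ee: "e \<cdot> e = e" using ve eV by blast
  have eA: "e \<in> A \<one>\<^bsub>G\<^esub>"
  proof -
    have "dR.c e \<one>\<^bsub>G\<^esub> = e"
      unfolding e_def using gr[OF R.one_closed G.one_closed i(1)] component_self1[OF one_homogeneous] by simp
    then show ?thesis using dR.component_in[OF eR G.one_closed] by simp
  qed
  have Ve: "V i = cyclic_ideal e"
    using ve VR[OF _ i(1)] gr_left_idealD(4)[OF V(1)[OF i(1)] _ eV] cyclic_ideal_iff[OF eR ee] by (metis (no_types) subsetI subset_antisym)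
  show ?thesis
    using that[OF primitive_idem_of_indecomposable_ideal[OF eA ee]] V(2)[OF i(1)] Ve i(2) by simp
qed

end

section \<open>Primitive idempotents over a graded left Artinian ring\<close>

context gr_artin
begin

text \<open>The graded module \<open>R e / J e\<close> is simple.\<close>

lemma primitive_idem_cancel:
  assumes e: "primitive_idem e" and r: "r \<in> A h" "h \<in> carrier G" and re: "r \<cdot> e \<notin> J"
  obtains s where "s \<in> A (inv\<^bsub>G\<^esub> h)" "s \<cdot> r \<cdot> e = e"
proof -
  note e' = primitive_idemD[OF e]
  have rR: "r \<in> carrier R" using r A_closed by blast
  have reA: "r \<cdot> e \<in> A h" using A_mult[OF r(1) e'(1) r(2)] r(2) by simp
  let ?L = "{a \<cdot> (r \<cdot> e) |a. a \<in> carrier R}"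
  have gL: "gr_left_ideal ?L" by (rule gr_left_ideal_principal[OF reA r(2)])
  have reL: "r \<cdot> e \<in> ?L" using self_cyclic_ideal[of "r \<cdot> e"] rR e'(2) unfolding cyclic_ideal_def by simp
  \<comment> \<open>A nilpotent R r e would be one of the ideals forming J and so put r e into
    J.\<close>
  have "\<not> nilpotent ?L" using JI[OF gL _ reL] re by blast
  then obtain f where f: "f \<in> ?L" "f \<in> A \<one>\<^bsub>G\<^esub>" "f \<noteq> \<zero>\<^bsub>R\<^esub>" "f \<cdot> f = f" using nonnilpotent_idem[OF gL] by blast
  then obtain t where t: "t \<in> carrier R" "f = t \<cdot> (r \<cdot> e)" by blast
  \<comment> \<open>In f = t r e the left side has degree 1 and r e has degree h, so only the
    component of t in degree h^-1 contributes.\<close>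
  define s where "s = dR.c t (inv\<^bsub>G\<^esub> h)"
  have sA: "s \<in> A (inv\<^bsub>G\<^esub> h)" unfolding s_def using dR.component_in t(1) r(2) by simp
  have sR: "s \<in> carrier R" using A_closed[OF sA] r(2) by simp
  have fR: "f \<in> carrier R" using f A1_closed by blast
  have fs: "f = s \<cdot> (r \<cdot> e)"
    using component_mult[OF reA _ r(2) t(1), of "inv\<^bsub>G\<^esub> h"] component_self1[OF f(2)] r(2) t(2) by (simp add: s_def)
  have fe: "f \<cdot> e = f" using fs sR rR e'(2,3) by (simp add: R.m_assoc)
  \<comment> \<open>f absorbs e on the right only. The product e f absorbs it on both sides, is
    again idempotent, and is nonzero because f (e f) = f; primitivity then gives e f = e.\<close>
  let ?g = "e \<cdot> f"
  have "?g \<cdot> ?g = e \<cdot> (f \<cdot> e) \<cdot> f" using e'(2) fR by (simp add: R.m_assoc)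
  then have gg: "?g \<cdot> ?g = ?g" using fe f(4) e'(2) fR by (simp add: R.m_assoc)
  have fg: "f \<cdot> ?g = f" using fe f(4) e'(2) fR by (simp add: R.m_assoc[symmetric])
  have "?g \<noteq> \<zero>\<^bsub>R\<^esub>" using fg f(3) fR by auto
  moreover have "?g \<in> A \<one>\<^bsub>G\<^esub>" using A1_mult e'(1) f(2) by blast
  moreover have "e \<cdot> ?g = ?g" using e'(2,3) fR by (simp add: R.m_assoc[symmetric])
  moreover have "?g \<cdot> e = ?g" using e'(2) fR fe by (simp add: R.m_assoc)
  ultimately have ge: "?g = e" using e'(5)[of ?g] gg by blast
  show ?thesis
  proof (rule that)
    show "e \<cdot> s \<in> A (inv\<^bsub>G\<^esub> h)" using A_mult[OF e'(1) sA] r(2) by simp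
    show "e \<cdot> s \<cdot> r \<cdot> e = e" using ge fs e'(2) sR rR by (simp add: R.m_assoc)
  qed
qed

lemma shifted_ideal_simps:
  "carrier (shifted_ideal G R A U \<sigma>) = U" "zero (shifted_ideal G R A U \<sigma>) = \<zero>\<^bsub>R\<^esub>"
  "add (shifted_ideal G R A U \<sigma>) = add R" "smult (shifted_ideal G R A U \<sigma>) = mult R"
  "hcomp (shifted_ideal G R A U \<sigma>) = (\<lambda>g. U \<inter> A (g \<otimes>\<^bsub>G\<^esub> \<sigma>))"
  by (simp_all add: shifted_ideal_def)

lemma graded_shifted_ideal:
  "gr_left_ideal U \<Longrightarrow> \<sigma> \<in> carrier G \<Longrightarrow> graded_module G R A (shifted_ideal G R A U \<sigma>)"
  unfolding shifted_ideal_def by (intro graded_shift reg.graded_restrict) (simp_all add: gsub_regular)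

text \<open>Degree g of the first shift is degree g \<sigma> of R, which right multiplication by an
  element of degree \<sigma>^-1 \<tau> carries to degree g \<tau>, that is, to degree g of the
  second shift.\<close>

lemma mult_hom_shifted:
  assumes e: "e \<in> carrier R" "e \<cdot> e = e" and f: "f \<in> carrier R" "f \<cdot> f = f"
    and s: "s \<in> A (inv\<^bsub>G\<^esub> \<sigma> \<otimes>\<^bsub>G\<^esub> \<tau>)" "s \<cdot> f = s" and G: "\<sigma> \<in> carrier G" "\<tau> \<in> carrier G"
  shows "(\<lambda>v. v \<cdot> s) \<in> gr_hom G R (shifted_ideal G R A (cyclic_ideal e) \<sigma>) (shifted_ideal G R A (cyclic_ideal f) \<tau>)"
proof -
  have sR: "s \<in> carrier R" using A_closed[OF s(1)] G by simp
  have in_f: "v \<cdot> s \<in> cyclic_ideal f" if "v \<in> cyclic_ideal e" for v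
    using that cyclic_ideal_iff[OF e] cyclic_ideal_iff[OF f] sR f s(2) by (simp add: R.m_assoc)
  have "v \<cdot> s \<in> A (g \<otimes>\<^bsub>G\<^esub> \<tau>)" if "v \<in> A (g \<otimes>\<^bsub>G\<^esub> \<sigma>)" "g \<in> carrier G" for v g
  proof -
    have "g \<otimes>\<^bsub>G\<^esub> \<sigma> \<otimes>\<^bsub>G\<^esub> (inv\<^bsub>G\<^esub> \<sigma> \<otimes>\<^bsub>G\<^esub> \<tau>) = g \<otimes>\<^bsub>G\<^esub> (\<sigma> \<otimes>\<^bsub>G\<^esub> inv\<^bsub>G\<^esub> \<sigma>) \<otimes>\<^bsub>G\<^esub> \<tau>"
      using G that(2) by (simp only: G.m_assoc G.m_closed G.inv_closed)
    also have "\<dots> = g \<otimes>\<^bsub>G\<^esub> \<tau>" using G that(2) by simp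
    finally show ?thesis using A_mult[OF that(1) s(1)] G that(2) by simp
  qed
  then show ?thesis
    using sR in_f cyclic_ideal_iff[OF e] by (intro gr_homI) (simp_all add: shifted_ideal_simps R.l_distr R.m_assoc)
qed

text \<open>Since \<rho> lies outside J, cancellation provides s with s \<rho> = e. Then \<rho> s is
  a nonzero idempotent of degree 1 below f, so it equals f by primitivity, and right multiplications
  by s and \<rho> are mutually inverse.\<close>

lemma shifted_iso:
  assumes e: "primitive_idem e" and f: "primitive_idem f" and G: "\<sigma> \<in> carrier G" "\<tau> \<in> carrier G"
    and \<rho>: "\<rho> \<in> A (inv\<^bsub>G\<^esub> \<tau> \<otimes>\<^bsub>G\<^esub> \<sigma>)" "f \<cdot> \<rho> = \<rho>" "\<rho> \<cdot> e = \<rho>" "\<rho> \<notin> J"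
  shows "gr_iso G R (shifted_ideal G R A (cyclic_ideal e) \<sigma>) (shifted_ideal G R A (cyclic_ideal f) \<tau>)"
proof -
  note e' = primitive_idemD[OF e] and f' = primitive_idemD[OF f]
  have \<rho>R: "\<rho> \<in> carrier R" using A_closed[OF \<rho>(1)] G by simp
  obtain s0 where s0: "s0 \<in> A (inv\<^bsub>G\<^esub> (inv\<^bsub>G\<^esub> \<tau> \<otimes>\<^bsub>G\<^esub> \<sigma>))" "s0 \<cdot> \<rho> \<cdot> e = e"
    using primitive_idem_cancel[OF e \<rho>(1)] \<rho>(3,4) G by auto
  have inv: "inv\<^bsub>G\<^esub> (inv\<^bsub>G\<^esub> \<tau> \<otimes>\<^bsub>G\<^esub> \<sigma>) = inv\<^bsub>G\<^esub> \<sigma> \<otimes>\<^bsub>G\<^esub> \<tau>" using G by (simp add: G.inv_mult_group)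
  have s0A: "s0 \<in> A (inv\<^bsub>G\<^esub> \<sigma> \<otimes>\<^bsub>G\<^esub> \<tau>)" using s0(1) unfolding inv .
  have s0R: "s0 \<in> carrier R" using A_closed[OF s0A] G by simp
  \<comment> \<open>The factors e and f place s0 in e R f, as a map between the two ideals requires.
    The product with \<rho> stays e because f \<rho> = \<rho> = \<rho> e.\<close>
  define s where "s = e \<cdot> s0 \<cdot> f"
  have sA: "s \<in> A (inv\<^bsub>G\<^esub> \<sigma> \<otimes>\<^bsub>G\<^esub> \<tau>)"
    using A_mult[OF A_mult[OF e'(1) s0A] f'(1)] G by (simp add: s_def)
  have sR: "s \<in> carrier R" using A_closed[OF sA] G by simp
  have es: "e \<cdot> s = s" and sf: "s \<cdot> f = s"
    using e'(2,3) f'(2,3) s0R by (simp_all add: s_def R.m_assoc) (simp add: R.m_assoc[symmetric])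
  have s\<rho>: "s \<cdot> \<rho> = e"
  proof -
    have "s \<cdot> \<rho> = e \<cdot> (s0 \<cdot> (\<rho> \<cdot> e))" using e'(2) f'(2) s0R \<rho>R \<rho>(2,3) by (simp add: s_def R.m_assoc)
    then show ?thesis using s0(2) e'(2,3) s0R \<rho>R by (simp add: R.m_assoc)
  qed
  have \<rho>s: "\<rho> \<cdot> s = f"
  proof (rule f'(5))
    show "\<rho> \<cdot> s \<in> A \<one>\<^bsub>G\<^esub>"
    proof -
      have "inv\<^bsub>G\<^esub> \<tau> \<otimes>\<^bsub>G\<^esub> \<sigma> \<otimes>\<^bsub>G\<^esub> (inv\<^bsub>G\<^esub> \<sigma> \<otimes>\<^bsub>G\<^esub> \<tau>) = \<one>\<^bsub>G\<^esub>"
        using G by (simp add: inv[symmetric])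
      then show ?thesis using A_mult[OF \<rho>(1) sA] G by simp
    qed
    have "\<rho> \<cdot> s \<cdot> (\<rho> \<cdot> s) = \<rho> \<cdot> (s \<cdot> \<rho>) \<cdot> s" using \<rho>R sR by (simp add: R.m_assoc)
    then show "\<rho> \<cdot> s \<cdot> (\<rho> \<cdot> s) = \<rho> \<cdot> s" using s\<rho> \<rho>(3) by simp
    show "f \<cdot> (\<rho> \<cdot> s) = \<rho> \<cdot> s" using f'(2) \<rho>R sR \<rho>(2) by (simp add: R.m_assoc[symmetric])
    show "\<rho> \<cdot> s \<cdot> f = \<rho> \<cdot> s" using f'(2) \<rho>R sR sf by (simp add: R.m_assoc)
    show "\<rho> \<cdot> s \<noteq> \<zero>\<^bsub>R\<^esub>"
    proof
      assume z: "\<rho> \<cdot> s = \<zero>\<^bsub>R\<^esub>"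
      have "e = s \<cdot> \<rho> \<cdot> (s \<cdot> \<rho>)" using s\<rho> e'(3) by simp
      also have "\<dots> = s \<cdot> (\<rho> \<cdot> s) \<cdot> \<rho>" using \<rho>R sR by (simp add: R.m_assoc)
      finally show False using z e'(4) \<rho>R sR by simp
    qed
  qed
  have "(\<lambda>v. v \<cdot> s) \<in> gr_hom G R (shifted_ideal G R A (cyclic_ideal e) \<sigma>) (shifted_ideal G R A (cyclic_ideal f) \<tau>)"
    by (rule mult_hom_shifted[OF e'(2,3) f'(2,3) sA sf G])
  moreover have "(\<lambda>v. v \<cdot> \<rho>) \<in> gr_hom G R (shifted_ideal G R A (cyclic_ideal f) \<tau>) (shifted_ideal G R A (cyclic_ideal e) \<sigma>)"
    by (rule mult_hom_shifted[OF f'(2,3) e'(2,3) \<rho>(1) \<rho>(3) G(2,1)])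
  moreover have "v \<cdot> s \<cdot> \<rho> = v" if "v \<in> cyclic_ideal e" for v
    using that cyclic_ideal_iff[OF e'(2,3)] sR \<rho>R s\<rho> by (simp add: R.m_assoc)
  moreover have "v \<cdot> \<rho> \<cdot> s = v" if "v \<in> cyclic_ideal f" for v
    using that cyclic_ideal_iff[OF f'(2,3)] sR \<rho>R \<rho>s by (simp add: R.m_assoc)
  ultimately show ?thesis unfolding gr_iso_def by (intro bexI) (simp_all add: shifted_ideal_simps)
qed

text \<open>Indecomposability of the ideals, rather than primitivity of the idempotents, is recorded
  because \<open>principal_gr_indecomposable\<close> asks for it; primitivity follows from
  it.\<close>

definition decomposes :: "'a \<Rightarrow> 'a set \<Rightarrow> bool" where
  "decomposes e S \<longleftrightarrow> finite S \<and> (\<forall>s\<in>S. s \<in> A \<one>\<^bsub>G\<^esub> \<and> s \<cdot> s = s \<and> indecomposable_ideal (cyclic_ideal s) \<and> s \<cdot> e = s \<and> e \<cdot> s = s) \<and>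
     (\<forall>s\<in>S. \<forall>t\<in>S. s \<noteq> t \<longrightarrow> s \<cdot> t = \<zero>\<^bsub>R\<^esub>) \<and> e = finsum R (\<lambda>s. s) S"

lemma decomposes_add:
  assumes f: "decomposes f S" and f': "decomposes f' S'"
    and c: "f \<in> carrier R" "f' \<in> carrier R" and "f \<cdot> f = f" "f' \<cdot> f' = f'" and o: "f \<cdot> f' = \<zero>\<^bsub>R\<^esub>" "f' \<cdot> f = \<zero>\<^bsub>R\<^esub>"
  shows "decomposes (f \<oplus>\<^bsub>R\<^esub> f') (S \<union> S')"
proof -
  note F = f[unfolded decomposes_def] and F' = f'[unfolded decomposes_def]
  have SR: "s \<in> carrier R" if "s \<in> S \<union> S'" for s using F F' that A1_closed by blast
  have z: "s \<cdot> t = \<zero>\<^bsub>R\<^esub>" if "s \<cdot> f = s" "f' \<cdot> t = t" "s \<in> carrier R" "t \<in> carrier R" for s t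
  proof -
    have "s \<cdot> t = s \<cdot> f \<cdot> (f' \<cdot> t)" using that by simp
    also have "\<dots> = s \<cdot> (f \<cdot> f') \<cdot> t" using that(3,4) c by (simp add: R.m_assoc)
    finally show ?thesis using o that(3,4) by simp
  qed
  have z': "s \<cdot> t = \<zero>\<^bsub>R\<^esub>" if "s \<cdot> f' = s" "f \<cdot> t = t" "s \<in> carrier R" "t \<in> carrier R" for s t
  proof -
    have "s \<cdot> t = s \<cdot> f' \<cdot> (f \<cdot> t)" using that by simp
    also have "\<dots> = s \<cdot> (f' \<cdot> f) \<cdot> t" using that(3,4) c by (simp add: R.m_assoc)
    finally show ?thesis using o that(3,4) by simp
  qed
  \<comment> \<open>The idempotents form a set, so a common summand would be counted once only. Such
    an s would satisfy s s = 0 through f f' = 0.\<close>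
  have disj: "S \<inter> S' = {}"
  proof (rule ccontr)
    assume "S \<inter> S' \<noteq> {}"
    then obtain s where s: "s \<in> S" "s \<in> S'" by blast
    then have "s \<cdot> s = \<zero>\<^bsub>R\<^esub>" using z[of s s] F F' SR by blast
    moreover have "primitive_idem s" using s F primitive_idem_of_indecomposable_ideal by blast
    ultimately show False using primitive_idemD(3,4) by metis
  qed
  have e: "s \<cdot> (f \<oplus>\<^bsub>R\<^esub> f') = s" "(f \<oplus>\<^bsub>R\<^esub> f') \<cdot> s = s" if "s \<in> S \<union> S'" for s
  proof -
    have s: "s \<in> carrier R" using SR that by blast
    consider "s \<cdot> f = s" "f \<cdot> s = s" | "s \<cdot> f' = s" "f' \<cdot> s = s" using F F' \<open>s \<in> S \<union> S'\<close> by blast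
    then have "s \<cdot> (f \<oplus>\<^bsub>R\<^esub> f') = s \<and> (f \<oplus>\<^bsub>R\<^esub> f') \<cdot> s = s"
    proof cases
      case 1
      have "s \<cdot> f' = \<zero>\<^bsub>R\<^esub>" "f' \<cdot> s = \<zero>\<^bsub>R\<^esub>" using z[of s f'] z'[of f' s] 1 s c assms(6) by auto
      then show ?thesis using 1 s c by (simp add: R.r_distr R.l_distr)
    next
      case 2
      have "s \<cdot> f = \<zero>\<^bsub>R\<^esub>" "f \<cdot> s = \<zero>\<^bsub>R\<^esub>" using z'[of s f] z[of f s] 2 s c assms(5) by auto
      then show ?thesis using 2 s c by (simp add: R.r_distr R.l_distr)
    qed
    then show "s \<cdot> (f \<oplus>\<^bsub>R\<^esub> f') = s" "(f \<oplus>\<^bsub>R\<^esub> f') \<cdot> s = s" by auto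
  qed
  have "f \<oplus>\<^bsub>R\<^esub> f' = finsum R (\<lambda>s. s) (S \<union> S')"
    using R.finsum_Un_disjoint[of S S' "\<lambda>s. s"] F F' disj SR by auto
  moreover have "s \<cdot> t = \<zero>\<^bsub>R\<^esub>" if "s \<in> S \<union> S'" "t \<in> S \<union> S'" "s \<noteq> t" for s t
    using that F F' z[of s t] z'[of s t] SR by blast
  ultimately show ?thesis using F F' e unfolding decomposes_def by blast
qed

text \<open>Take a counterexample e with R e minimal. R e splits as N + N', and the degree 1
  components of the two parts of e are orthogonal idempotents generating smaller ideals; both
  decompose, and their decompositions combine to one of e.\<close>

lemma idem_decomposes:
  assumes "e \<in> A \<one>\<^bsub>G\<^esub>" "e \<cdot> e = e"
  shows "\<exists>S. decomposes e S"
proof (rule ccontr)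
  let ?bad = "{e \<in> A \<one>\<^bsub>G\<^esub>. e \<cdot> e = e \<and> \<not> (\<exists>S. decomposes e S)}"
  assume "\<not> (\<exists>S. decomposes e S)"
  then have "e \<in> ?bad" using assms by blast
  then have ne: "cyclic_ideal ` ?bad \<noteq> {}" by blast
  obtain B where B: "B \<in> cyclic_ideal ` ?bad" and Bmin: "\<And>K. K \<in> cyclic_ideal ` ?bad \<Longrightarrow> K \<subseteq> B \<Longrightarrow> K = B"
    using artin_minimal[of "cyclic_ideal ` ?bad"] ne gr_left_ideal_cyclic_ideal by blast
  obtain e where e: "e \<in> A \<one>\<^bsub>G\<^esub>" "e \<cdot> e = e" and bad: "\<not> (\<exists>S. decomposes e S)" and Be: "B = cyclic_ideal e" using B by blast
  have eR: "e \<in> carrier R" using e A1_closed by blast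
  have e0: "e \<noteq> \<zero>\<^bsub>R\<^esub>"
  proof
    assume "e = \<zero>\<^bsub>R\<^esub>"
    then have "decomposes e {}" unfolding decomposes_def by simp
    then show False using bad by blast
  qed
  have "\<not> indecomposable_ideal (cyclic_ideal e)"
  proof
    assume "indecomposable_ideal (cyclic_ideal e)"
    then have "decomposes e {e}" unfolding decomposes_def using e eR by (simp add: R.finsum_insert[of "{}"])
    then show False using bad by blast
  qed
  moreover have "cyclic_ideal e \<noteq> {\<zero>\<^bsub>R\<^esub>}" using self_cyclic_ideal[OF eR] e0 by blast
  ultimately obtain N N' where N: "gr_left_ideal N" "gr_left_ideal N'" "{x \<oplus>\<^bsub>R\<^esub> y |x y. x \<in> N \<and> y \<in> N'} = cyclic_ideal e" "N \<inter> N' = {\<zero>\<^bsub>R\<^esub>}"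
      "N \<noteq> {\<zero>\<^bsub>R\<^esub>}" "N' \<noteq> {\<zero>\<^bsub>R\<^esub>}"
    using indecomposable_ideal_iff[OF gr_left_ideal_cyclic_ideal[OF e(1)]] by auto
  have NR: "x \<in> carrier R" if "x \<in> N \<or> x \<in> N'" for x using gr_left_idealD(7)[OF N(1)] gr_left_idealD(7)[OF N(2)] that by blast
  have NU: "N \<subseteq> cyclic_ideal e" "N' \<subseteq> cyclic_ideal e" using gr_left_ideal_sum_upper[OF N(1,2)] unfolding N(3) by auto
  have xe: "x \<cdot> e = x" if "x \<in> N \<or> x \<in> N'" for x using NU cyclic_ideal_iff[OF eR e(2)] that by blast
  have "e \<in> {x \<oplus>\<^bsub>R\<^esub> y |x y. x \<in> N \<and> y \<in> N'}" unfolding N(3) using self_cyclic_ideal[OF eR] .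
  then obtain x y where xy: "e = x \<oplus>\<^bsub>R\<^esub> y" "x \<in> N" "y \<in> N'" by blast
  define f where "f = dR.c x \<one>\<^bsub>G\<^esub>"
  define f' where "f' = dR.c y \<one>\<^bsub>G\<^esub>"
  have fA: "f \<in> A \<one>\<^bsub>G\<^esub>" "f' \<in> A \<one>\<^bsub>G\<^esub>" unfolding f_def f'_def using NR xy by (auto intro!: dR.component_in)
  have fR: "f \<in> carrier R" "f' \<in> carrier R" using fA A1_closed by auto
  have fN: "f \<in> N" "f' \<in> N'" unfolding f_def f'_def using xy gr_left_idealD(5)[OF N(1)] gr_left_idealD(5)[OF N(2)] by auto
  have eff: "e = f \<oplus>\<^bsub>R\<^esub> f'"
    using component_self1[OF e(1)] dR.component_add[of x y "\<one>\<^bsub>G\<^esub>"] NR xy by (simp add: f_def f'_def)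
  \<comment> \<open>From p = p e = p p + p q, the element p q = p - p p lies in K as well as in K',
    hence vanishes.\<close>
  have idem: "p \<cdot> p = p \<and> p \<cdot> q = \<zero>\<^bsub>R\<^esub>"
    if pq: "p \<in> K" "q \<in> K'" "e = p \<oplus>\<^bsub>R\<^esub> q" and K: "gr_left_ideal K" "gr_left_ideal K'" "K \<inter> K' = {\<zero>\<^bsub>R\<^esub>}" and pe: "p \<cdot> e = p" for p q K K'
  proof -
    have pR: "p \<in> carrier R" "q \<in> carrier R" using pq gr_left_idealD(7)[OF K(1)] gr_left_idealD(7)[OF K(2)] by auto
    have sum: "p = p \<cdot> p \<oplus>\<^bsub>R\<^esub> p \<cdot> q" using pe pq(3) pR by (simp add: R.r_distr)
    have "p \<cdot> q = p \<ominus>\<^bsub>R\<^esub> p \<cdot> p"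
    proof -
      have "(u \<oplus>\<^bsub>R\<^esub> v) \<ominus>\<^bsub>R\<^esub> u = v" if "u \<in> carrier R" "v \<in> carrier R" for u v
        using that R.a_lcomm[of u v "\<ominus>\<^bsub>R\<^esub> u"] by (simp add: a_minus_def R.a_assoc R.r_neg)
      from this[of "p \<cdot> p" "p \<cdot> q"] show ?thesis using sum pR by simp
    qed
    also have "\<dots> \<in> K" using pq(1) pR gr_left_idealD(3,4,6)[OF K(1)] by (simp add: a_minus_def)
    finally have "p \<cdot> q \<in> K" .
    moreover have "p \<cdot> q \<in> K'" using gr_left_idealD(4)[OF K(2) pR(1) pq(2)] .
    ultimately have "p \<cdot> q = \<zero>\<^bsub>R\<^esub>" using K(3) by blast
    then show ?thesis using sum pR by simp
  qed
  have f: "f \<cdot> f = f" "f \<cdot> f' = \<zero>\<^bsub>R\<^esub>" using idem[OF fN eff N(1,2,4)] xe fN by auto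
  have f': "f' \<cdot> f' = f'" "f' \<cdot> f = \<zero>\<^bsub>R\<^esub>"
    using idem[OF fN(2,1) _ N(2,1)] N(4) xe fN eff fR by (auto simp: R.a_comm Int_commute)
  \<comment> \<open>If R p were all of R e, then e p = e and so e = p; then K' = K' p would lie in
    K, forcing K' = 0. Hence R p is strictly smaller and minimality applies.\<close>
  have good: "\<exists>S. decomposes p S"
    if p: "p \<in> A \<one>\<^bsub>G\<^esub>" "p \<cdot> p = p" "p \<cdot> e = p" and ep: "e \<cdot> p = p" and pK: "p \<in> K" and K: "gr_left_ideal K"
      "K \<inter> K' = {\<zero>\<^bsub>R\<^esub>}" "K' \<noteq> {\<zero>\<^bsub>R\<^esub>}" and K': "gr_left_ideal K'" "\<And>x. x \<in> K' \<Longrightarrow> x \<cdot> e = x" for p K K'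
  proof (rule ccontr)
    have pR: "p \<in> carrier R" using p A1_closed by blast
    assume "\<not> (\<exists>S. decomposes p S)"
    then have "cyclic_ideal p \<in> cyclic_ideal ` ?bad" using p by blast
    moreover have "cyclic_ideal p \<subseteq> B"
    proof
      fix z assume "z \<in> cyclic_ideal p"
      then have z: "z \<in> carrier R" "z \<cdot> p = z" using cyclic_ideal_iff[OF pR p(2)] by auto
      have "z \<cdot> e = z \<cdot> p \<cdot> e" using z by simp
      also have "\<dots> = z \<cdot> (p \<cdot> e)" using z(1) pR eR by (rule R.m_assoc)
      also have "\<dots> = z" unfolding p(3) by (rule z(2))
      finally show "z \<in> B" unfolding Be using cyclic_ideal_iff[OF eR e(2)] z by simp
    qed
    ultimately have "cyclic_ideal p = B" by (rule Bmin)
    then have "e \<in> cyclic_ideal p" using self_cyclic_ideal[OF eR] unfolding Be by simp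
    then have ep': "e = p" using cyclic_ideal_iff[OF pR p(2)] ep by simp
    have "K' \<subseteq> {\<zero>\<^bsub>R\<^esub>}"
    proof
      fix y assume y: "y \<in> K'"
      then have "y = y \<cdot> p" using K'(2) ep' by simp
      moreover have "y \<cdot> p \<in> K" using gr_left_idealD(4)[OF K(1) gr_left_idealD(7)[OF K'(1) y] pK] .
      ultimately show "y \<in> {\<zero>\<^bsub>R\<^esub>}" using y K(2) by auto
    qed
    then show False using K(3) gr_left_idealD(2)[OF K'(1)] by blast
  qed
  have ef: "e \<cdot> f = f" "e \<cdot> f' = f'" using eff f f' fR by (simp_all add: R.l_distr)
  obtain S where S: "decomposes f S"
    using good[OF fA(1) f(1) _ ef(1) fN(1) N(1,4,6,2)] xe fN by blast
  obtain S' where S': "decomposes f' S'"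
    using good[OF fA(2) f'(1) _ ef(2) fN(2) N(2) _ N(5,1)] N(4) xe fN by (auto simp: Int_commute)
  have "decomposes e (S \<union> S')"
    unfolding eff by (rule decomposes_add[OF S S' fR f(1) f'(1) f(2) f'(2)])
  then show False using bad by blast
qed

text \<open>Decompose the identity; right multiplications by the resulting orthogonal idempotents
  are the component maps of R. The enumeration b is there because
  \<open>principal_gr_indecomposable\<close> indexes its summands by numbers.\<close>

lemma principal_decomposition:
  obtains S where "finite S" "\<And>s. s \<in> S \<Longrightarrow> primitive_idem s" "\<And>s. s \<in> S \<Longrightarrow> principal_gr_indecomposable G R A (cyclic_ideal s)"
    "\<one>\<^bsub>R\<^esub> = finsum R (\<lambda>s. s) S"
proof -
  obtain S where "decomposes \<one>\<^bsub>R\<^esub> S" using idem_decomposes[OF one_homogeneous] by auto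
  then have S: "finite S" "\<And>s. s \<in> S \<Longrightarrow> s \<in> A \<one>\<^bsub>G\<^esub>" "\<And>s. s \<in> S \<Longrightarrow> s \<cdot> s = s" "\<And>s. s \<in> S \<Longrightarrow> indecomposable_ideal (cyclic_ideal s)"
    "\<And>s t. s \<in> S \<Longrightarrow> t \<in> S \<Longrightarrow> s \<noteq> t \<Longrightarrow> s \<cdot> t = \<zero>\<^bsub>R\<^esub>" and sum: "\<one>\<^bsub>R\<^esub> = finsum R (\<lambda>s. s) S"
    unfolding decomposes_def by blast+
  have SR: "s \<in> carrier R" if "s \<in> S" for s using S(2) that A1_closed by blast
  define n where "n = card S"
  obtain b where "bij_betw b {0..<n} S" using ex_bij_betw_nat_finite[OF S(1)] unfolding n_def by blast
  then have b: "b ` {..<n} = S" "inj_on b {..<n}" by (auto simp: bij_betw_def lessThan_atLeast0)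
  have bS: "b i \<in> S" if "i < n" for i using b(1) that by blast
  have bb: "b j \<cdot> b i = (if i = j then b j else \<zero>\<^bsub>R\<^esub>)" if "i < n" "j < n" for i j
  proof (cases "i = j")
    case False
    then have "b j \<noteq> b i" using that b(2) by (auto simp: inj_on_def)
    then show ?thesis using S(5)[OF bS bS] that False by simp
  qed (use that S(3) bS in simp)
  have ids: "internal_direct_sum (gr_regular R A) {..<n} (\<lambda>i. cyclic_ideal (b i))"
  proof (rule reg.M.internal_direct_sumI[where d = "\<lambda>x i. x \<cdot> b i"])
    show "additive_subgroup (cyclic_ideal (b i)) (gr_regular R A)" if "i \<in> {..<n}" for i
      using that S(2) bS by (intro reg.gsub_additive_subgroup) (simp add: gsub_regular gr_left_ideal_cyclic_ideal)
    show "x \<cdot> b i \<in> cyclic_ideal (b i)" if "x \<in> carrier (gr_regular R A)" for x i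
      unfolding cyclic_ideal_def using that by auto
    show "(x \<oplus>\<^bsub>gr_regular R A\<^esub> y) \<cdot> b i = x \<cdot> b i \<oplus>\<^bsub>gr_regular R A\<^esub> y \<cdot> b i"
      if "x \<in> carrier (gr_regular R A)" "y \<in> carrier (gr_regular R A)" "i \<in> {..<n}" for x y i
      using that SR bS by (simp add: R.l_distr)
    show "x \<cdot> b i = (if i = j then x else \<zero>\<^bsub>gr_regular R A\<^esub>)"
      if "i \<in> {..<n}" "j \<in> {..<n}" "x \<in> cyclic_ideal (b j)" for x i j
    proof -
      have ij: "i < n" "j < n" using that by auto
      have x: "x \<in> carrier R" "x \<cdot> b j = x" using that(3) cyclic_ideal_iff[OF SR S(3), OF bS bS, OF ij(2,2)] by auto
      have "x \<cdot> b i = x \<cdot> b j \<cdot> b i" using x by simp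
      also have "\<dots> = x \<cdot> (b j \<cdot> b i)" using x(1) SR bS ij by (simp add: R.m_assoc)
      also have "\<dots> = (if i = j then x else \<zero>\<^bsub>R\<^esub>)" using bb[OF ij] x by auto
      finally show ?thesis by simp
    qed
    show "x = \<zero>\<^bsub>gr_regular R A\<^esub>" if x: "x \<in> carrier (gr_regular R A)"
      and z: "\<And>i. i \<in> {..<n} \<Longrightarrow> x \<cdot> b i = \<zero>\<^bsub>gr_regular R A\<^esub>" for x
    proof -
      have xs: "x \<cdot> s = \<zero>\<^bsub>R\<^esub>" if "s \<in> S" for s using z that b(1) by auto
      have "x = x \<cdot> finsum R (\<lambda>s. s) S" unfolding sum[symmetric] using x by simp
      also have "\<dots> = finsum R (\<lambda>s. x \<cdot> s) S" using x S(1) SR by (intro R.finsum_rdistr) auto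
      also have "\<dots> = finsum R (\<lambda>s. \<zero>\<^bsub>R\<^esub>) S" by (rule R.finsum_cong') (use xs in auto)
      finally show ?thesis by (simp add: R.finsum_zero)
    qed
  qed auto
  have "principal_gr_indecomposable G R A (cyclic_ideal s)" if s: "s \<in> S" for s
    unfolding principal_gr_indecomposable_def
  proof (rule exI[of _ n], rule exI[of _ "\<lambda>i. cyclic_ideal (b i)"], intro conjI allI impI)
    show "internal_direct_sum (gr_regular R A) {..<n} (\<lambda>i. cyclic_ideal (b i))" by (rule ids)
    obtain i where "i < n" "s = b i" using s b(1) by auto
    then show "\<exists>i<n. cyclic_ideal s = cyclic_ideal (b i)" by blast
  qed (use S(2,4) bS gr_left_ideal_cyclic_ideal in \<open>auto simp: reg.gr_submodule_iff gsub_regular\<close>)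
  then show ?thesis using that[OF S(1) primitive_idem_of_indecomposable_ideal[OF S(2-4)] _ sum] by simp
qed

end

section \<open>Pregeometries\<close>

text \<open>Closures need not stay inside E: in the application they are submodules, while E
  consists of selected atoms. One operator can thus serve several ground sets.\<close>

locale pregeometry =
  fixes E :: "'p set" and cl :: "'p set \<Rightarrow> 'p set"
  assumes cl_ext: "X \<subseteq> cl X"
    and cl_mono: "X \<subseteq> Y \<Longrightarrow> cl X \<subseteq> cl Y"
    and cl_idem: "Y \<subseteq> cl X \<Longrightarrow> cl Y \<subseteq> cl X"
    and cl_finitary: "X \<subseteq> E \<Longrightarrow> y \<in> cl X \<Longrightarrow> \<exists>F\<subseteq>X. finite F \<and> y \<in> cl F"
    and cl_exchange: "X \<subseteq> E \<Longrightarrow> x \<in> E \<Longrightarrow> y \<in> E \<Longrightarrow> y \<in> cl (insert x X) \<Longrightarrow> y \<notin> cl X \<Longrightarrow>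
      x \<in> cl (insert y X)"
begin

definition indep :: "'p set \<Rightarrow> bool" where
  "indep X \<longleftrightarrow> X \<subseteq> E \<and> (\<forall>x\<in>X. x \<notin> cl (X - {x}))"

lemma indep_subset:
  assumes "indep X" "Y \<subseteq> X"
  shows "indep Y"
proof -
  have "cl (Y - {y}) \<subseteq> cl (X - {y})" for y using assms(2) by (intro cl_mono) blast
  then show ?thesis using assms unfolding indep_def by blast
qed

text \<open>If adding y pulled an old x into the closure of the others, exchange would put y into
  the closure of X.\<close>

lemma indep_insert:
  assumes X: "indep X" and y: "y \<in> E" "y \<notin> cl X"
  shows "indep (insert y X)"
proof -
  have XE: "X \<subseteq> E" using X unfolding indep_def by blast
  have yX: "y \<notin> X" using y(2) cl_ext[of X] by blast
  have "x \<notin> cl (insert y X - {x})" if x: "x \<in> insert y X" for x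
  proof (cases "x = y")
    case True
    then show ?thesis using y yX by simp
  next
    case False
    then have xX: "x \<in> X" using x by blast
    show ?thesis
    proof
      assume "x \<in> cl (insert y X - {x})"
      then have "x \<in> cl (insert y (X - {x}))" using False by (simp add: insert_Diff_if)
      moreover have "x \<notin> cl (X - {x})" using X xX unfolding indep_def by blast
      ultimately have "y \<in> cl (insert x (X - {x}))" using cl_exchange[of "X - {x}" y x] XE xX y by blast
      then show False using y(2) unfolding insert_Diff[OF xX] by blast
    qed
  qed
  then show ?thesis using XE y unfolding indep_def by blast
qed

text \<open>Steinitz exchange. An x in F outside S is traded for some s in S that is not in the
  closure of F - {x}; such s exists, as otherwise that closure would contain cl S and hence x. The
  size of F is kept while F - S shrinks.\<close>

lemma indep_card_le:
  assumes "finite F" "indep F" "finite S" "S \<subseteq> E" "F \<subseteq> cl S"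
  shows "card F \<le> card S"
  using assms
proof (induction "card (F - S)" arbitrary: F)
  case 0
  then have "F \<subseteq> S" by auto
  then show ?case using 0 by (simp add: card_mono)
next
  case (Suc n)
  have "F - S \<noteq> {}" using Suc.hyps(2) by (metis card.empty nat.distinct(1))
  then obtain x where x: "x \<in> F" "x \<notin> S" by blast
  have xn: "x \<notin> cl (F - {x})" using Suc.prems(2) x unfolding indep_def by blast
  have "\<not> S \<subseteq> cl (F - {x})" using cl_idem[of S "F - {x}"] Suc.prems(5) x(1) xn by blast
  then obtain s where s: "s \<in> S" "s \<notin> cl (F - {x})" by blast
  then have sF: "s \<notin> F - {x}" using cl_ext[of "F - {x}"] by blast
  let ?F = "insert s (F - {x})"
  have "card ?F = card F" using card_Suc_Diff1[OF Suc.prems(1) x(1)] card_insert_disjoint[OF _ sF] Suc.prems(1) by simp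
  moreover have "card ?F \<le> card S"
  proof (rule Suc.hyps(1))
    have "?F - S = (F - S) - {x}" using s by blast
    then show "n = card (?F - S)" using Suc.hyps(2) x Suc.prems(1) by simp
    show "indep ?F" using s Suc.prems(4) by (intro indep_insert indep_subset[OF Suc.prems(2)]) auto
    show "?F \<subseteq> cl S" using s(1) cl_ext[of S] Suc.prems(5) by blast
  qed (use Suc.prems in auto)
  ultimately show ?case by simp
qed

text \<open>The finite case is Steinitz. For infinite X, each x depends on a finite part F x of Y;
  the union of these parts spans, so independence forces it to be all of Y, and a union of X many
  finite sets has at most the size of X.\<close>

lemma bases_card_le:
  includes cardinal_syntax
  assumes X: "indep X" "E \<subseteq> cl X" and Y: "indep Y" "E \<subseteq> cl Y"
  shows "|Y| \<le>o |X|"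
proof -
  have XE: "X \<subseteq> E" and YE: "Y \<subseteq> E" using X Y unfolding indep_def by auto
  show ?thesis
  proof (cases "finite X")
    case True
    have bound: "card F \<le> card X" if "finite F" "F \<subseteq> Y" for F
      using that X(2) YE by (intro indep_card_le indep_subset[OF Y(1)] True XE) auto
    have "finite Y"
    proof (rule ccontr)
      assume "infinite Y"
      then obtain F where "F \<subseteq> Y" "finite F" "card F = Suc (card X)" using infinite_arbitrarily_large by blast
      then show False using bound[of F] by simp
    qed
    then have "card Y \<le> card X" using bound by blast
    then show ?thesis using \<open>finite Y\<close> True by (metis card_of_ordLeq inj_on_iff_card_le)
  next
    case False
    have "\<forall>x\<in>X. \<exists>F\<subseteq>Y. finite F \<and> x \<in> cl F" using cl_finitary[OF YE] XE Y(2) by blast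
    then obtain F where F: "\<And>x. x \<in> X \<Longrightarrow> F x \<subseteq> Y" "\<And>x. x \<in> X \<Longrightarrow> finite (F x)" "\<And>x. x \<in> X \<Longrightarrow> x \<in> cl (F x)"
      by metis
    let ?U = "\<Union>x\<in>X. F x"
    have "X \<subseteq> cl ?U"
    proof
      fix x assume x: "x \<in> X"
      then have "cl (F x) \<subseteq> cl ?U" by (intro cl_mono) blast
      then show "x \<in> cl ?U" using F(3)[OF x] by blast
    qed
    then have all: "E \<subseteq> cl ?U" using cl_idem[of X ?U] X(2) by blast
    have "Y \<subseteq> ?U"
    proof (rule ccontr)
      assume "\<not> Y \<subseteq> ?U"
      then obtain y where y: "y \<in> Y" "y \<notin> ?U" by blast
      then have "?U \<subseteq> Y - {y}" using F(1) by blast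
      then have "cl ?U \<subseteq> cl (Y - {y})" by (rule cl_mono)
      then have "y \<in> cl (Y - {y})" using all y(1) YE by blast
      then show False using Y(1) y unfolding indep_def by blast
    qed
    then have "|Y| \<le>o |?U|" by (rule card_of_mono1)
    also have "|?U| \<le>o |X|"
    proof (rule card_of_UNION_ordLeq_infinite[OF False])
      show "|X| \<le>o |X|" by (rule card_of_mono1) simp
      show "\<forall>x\<in>X. |F x| \<le>o |X|"
        using F(2) False
        by (auto intro!: ordLess_imp_ordLeq finite_ordLess_infinite card_of_Well_order simp: Field_card_of)
    qed
    finally show ?thesis .
  qed
qed

lemma bases_equipotent:
  assumes "indep X" "E \<subseteq> cl X" "indep Y" "E \<subseteq> cl Y"
  shows "\<exists>f. bij_betw f X Y"
  using bases_card_le[OF assms] bases_card_le[OF assms(3,4,1,2)]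
  by (simp add: card_of_ordIso ordIso_iff_ordLeq)

text \<open>Zorn's lemma: a dependence in the union of a chain involves finitely many elements and
  so already occurs in one member of the chain.\<close>

lemma basis_exists: "\<exists>X. indep X \<and> E \<subseteq> cl X"
proof -
  have "\<exists>M\<in>{X. indep X}. \<forall>X\<in>{X. indep X}. M \<subseteq> X \<longrightarrow> X = M"
  proof (rule subset_Zorn_nonempty)
    have "indep {}" unfolding indep_def by simp
    then show "{X. indep X} \<noteq> {}" by blast
    fix C assume C: "C \<noteq> {}" "subset.chain {X. indep X} C"
    then have ind: "\<And>X. X \<in> C \<Longrightarrow> indep X" by (auto simp: subset.chain_def)
    have UE: "\<Union>C \<subseteq> E" using ind unfolding indep_def by blast
    have "x \<notin> cl (\<Union>C - {x})" if x: "x \<in> \<Union>C" for x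
    proof
      assume "x \<in> cl (\<Union>C - {x})"
      then obtain F where F: "F \<subseteq> \<Union>C - {x}" "finite F" "x \<in> cl F" using cl_finitary[of "\<Union>C - {x}" x] UE by blast
      have "insert x F \<subseteq> \<Union>C" using F x by blast
      then obtain X where X: "X \<in> C" "insert x F \<subseteq> X"
        using finite_subset_Union_chain[of "insert x F" C "{X. indep X}"] F(2) C by blast
      then have "cl F \<subseteq> cl (X - {x})" using F(1) by (intro cl_mono) blast
      then show False using F(3) ind[OF X(1)] X(2) unfolding indep_def by blast
    qed
    then show "\<Union>C \<in> {X. indep X}" using UE unfolding indep_def by blast
  qed
  then obtain X where X: "indep X" "\<And>Y. indep Y \<Longrightarrow> X \<subseteq> Y \<Longrightarrow> Y = X" by blast
  have "y \<in> cl X" if "y \<in> E" for y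
  proof (rule ccontr)
    assume n: "y \<notin> cl X"
    then have "insert y X = X" using X(2)[OF indep_insert[OF X(1) that n]] by blast
    then show False using n cl_ext[of X] by blast
  qed
  then show ?thesis using X(1) by blast
qed

end

text \<open>The bijections for equivalent values of c need not agree, so one representative is fixed
  for each class before they are glued.\<close>

lemma classwise_bij:
  assumes refl: "\<And>a. r a a" and sym: "\<And>a b. r a b \<Longrightarrow> r b a" and trans: "\<And>a b c. r a b \<Longrightarrow> r b c \<Longrightarrow> r a c"
    and bij: "\<And>c. \<exists>f. bij_betw f {i\<in>I. r (k i) c} {j\<in>J. r (l j) c}"
  shows "\<exists>\<pi>. bij_betw \<pi> I J \<and> (\<forall>i\<in>I. r (k i) (l (\<pi> i)))"
proof -
  define rep where "rep a = (SOME c. r a c)" for a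
  have rep: "r a (rep a)" for a unfolding rep_def by (rule someI[of "r a"]) (rule refl)
  \<comment> \<open>The predicate r a is the class of a; equivalent elements have equal predicates
    and therefore the same chosen representative.\<close>
  have "r a = r b" if "r a b" for a b using sym trans that by (intro ext) blast
  then have rep_eq: "rep a = rep b" if "r a b" for a b using that by (simp add: rep_def)
  obtain \<beta> where \<beta>: "\<And>c. bij_betw (\<beta> c) {i\<in>I. r (k i) c} {j\<in>J. r (l j) c}" using bij by metis
  define \<pi> where "\<pi> i = \<beta> (rep (k i)) i" for i
  have \<pi>: "\<pi> i \<in> J \<and> r (l (\<pi> i)) (rep (k i))" if "i \<in> I" for i
    using bij_betwE[OF \<beta>[of "rep (k i)"]] that rep unfolding \<pi>_def by blast
  have rel: "r (k i) (l (\<pi> i))" if "i \<in> I" for i using \<pi>[OF that] rep sym trans by blast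
  have "inj_on \<pi> I"
  proof (rule inj_onI)
    fix i i' assume i: "i \<in> I" "i' \<in> I" and eq: "\<pi> i = \<pi> i'"
    have "r (l (\<pi> i)) (k i')" using rel[OF i(2)] sym unfolding eq by blast
    then have "r (k i) (k i')" using rel[OF i(1)] trans by blast
    then have c: "rep (k i) = rep (k i')" by (rule rep_eq)
    have "inj_on (\<beta> (rep (k i))) {j\<in>I. r (k j) (rep (k i))}" using \<beta> unfolding bij_betw_def by blast
    moreover have "\<beta> (rep (k i)) i = \<beta> (rep (k i)) i'" using eq unfolding \<pi>_def c .
    moreover have "r (k i') (rep (k i))" unfolding c by (rule rep)
    ultimately show "i = i'" using i rep[of "k i"] unfolding inj_on_def by blast
  qed
  moreover have "\<exists>i\<in>I. \<pi> i = j" if j: "j \<in> J" for j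
  proof -
    have "j \<in> \<beta> (rep (l j)) ` {i\<in>I. r (k i) (rep (l j))}"
      using \<beta>[of "rep (l j)"] j rep unfolding bij_betw_def by blast
    then obtain i where i: "i \<in> I" "r (k i) (rep (l j))" "j = \<beta> (rep (l j)) i" by blast
    have "r (k i) (l j)" using i(2) rep[of "l j"] sym trans by blast
    then have "rep (k i) = rep (l j)" by (rule rep_eq)
    then have "\<pi> i = j" unfolding \<pi>_def using i(3) by simp
    then show ?thesis using i(1) by blast
  qed
  ultimately have "bij_betw \<pi> I J" unfolding bij_betw_def using \<pi> by blast
  then show ?thesis using rel by blast
qed

section \<open>Uniqueness: bases modulo the radical\<close>

locale gr_artin_module = gr_artin G R A + graded_module G R A P
  for G :: "('g, 'e) monoid_scheme" (structure) and R :: "('a, 'c) ring_scheme" (structure)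
    and A :: "'g \<Rightarrow> 'a set" and P :: "('a, 'b, 'g) gr_module"
begin

abbreviation act (infixl "\<star>" 70) where "a \<star> x \<equiv> a \<odot>\<^bsub>P\<^esub> x"
abbreviation padd (infixl "\<boxplus>" 65) where "x \<boxplus> y \<equiv> x \<oplus>\<^bsub>P\<^esub> y"

text \<open>
  For homogeneous \<open>X\<close>, the closure \<open>cl X\<close> is the graded submodule \<open>J P + R X\<close>. Since morphisms \<open>R e(\<sigma>) \<rightarrow> P\<close> correspond to
  the elements \<open>x\<close> of degree \<open>\<sigma>\<^sup>-\<^sup>1\<close> with \<open>e x = x\<close>, the atoms below are the generators of simple
  submodules of \<open>P / J P\<close>, and frames are the decompositions of \<open>P / J P\<close> into simple modules.
\<close>

definition cl :: "'b set \<Rightarrow> 'b set" where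
  "cl X = \<Inter>{N. gsub N \<and> (\<forall>a\<in>J. \<forall>x\<in>carrier P. a \<star> x \<in> N) \<and> X \<subseteq> N}"

lemma cl_least: "gsub N \<Longrightarrow> (\<And>a x. a \<in> J \<Longrightarrow> x \<in> carrier P \<Longrightarrow> a \<star> x \<in> N) \<Longrightarrow> X \<subseteq> N \<Longrightarrow> cl X \<subseteq> N"
  unfolding cl_def by (rule Inter_lower) blast

lemma cl_ext: "X \<subseteq> cl X"
  unfolding cl_def by (rule Inter_greatest) blast

lemma cl_mono: "X \<subseteq> Y \<Longrightarrow> cl X \<subseteq> cl Y"
  unfolding cl_def by (rule Inter_anti_mono) auto

lemma J_closed: "a \<in> J \<Longrightarrow> a \<in> carrier R"
  using gr_left_idealD(7)[OF gr_left_ideal_J] .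

lemma J_cl: "a \<in> J \<Longrightarrow> x \<in> carrier P \<Longrightarrow> a \<star> x \<in> cl X"
  unfolding cl_def by (rule InterI) blast

lemma gsub_carrier: "gsub (carrier P)"
  by (rule gsubI) (auto simp: smult_closed dM.component_closed A_closed)

lemma gsub_cl:
  assumes "X \<subseteq> carrier P"
  shows "gsub (cl X)"
proof (rule gsubI)
  show "cl X \<subseteq> carrier P"
    by (rule cl_least[OF gsub_carrier]) (use assms J_closed smult_closed in auto)
  show "\<zero>\<^bsub>P\<^esub> \<in> cl X" unfolding cl_def by (rule InterI) (use gsubD(2) in blast)
  show "x \<boxplus> y \<in> cl X" if "x \<in> cl X" "y \<in> cl X" for x y
    using that unfolding cl_def by (intro InterI) (use gsubD(3) in blast)
  show "a \<star> x \<in> cl X" if "g \<in> carrier G" "a \<in> A g" "x \<in> cl X" for g a x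
    using that(3) A_closed[OF that(2,1)] unfolding cl_def by (intro InterI) (use gsubD(4) in blast)
  show "dM.c x g \<in> cl X" if "g \<in> carrier G" "x \<in> cl X" for g x
    using that unfolding cl_def by (intro InterI) (use gsubD(5) in blast)
qed

lemma cl_idem:
  assumes "Y \<subseteq> cl X"
  shows "cl Y \<subseteq> cl X"
proof
  fix y assume y: "y \<in> cl Y"
  show "y \<in> cl X"
    unfolding cl_def
  proof (rule InterI)
    fix N assume N: "N \<in> {N. gsub N \<and> (\<forall>a\<in>J. \<forall>x\<in>carrier P. a \<star> x \<in> N) \<and> X \<subseteq> N}"
    then have "cl X \<subseteq> N" by (intro cl_least) auto
    then have "cl Y \<subseteq> N" using N assms by (intro cl_least) auto
    then show "y \<in> N" using y by blast
  qed
qed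

text \<open>Because x is homogeneous, R x + cl X is itself graded, so it is a graded submodule
  containing J P and all of the generators.\<close>

lemma cl_insert:
  assumes X: "X \<subseteq> carrier P" and x: "x \<in> hcomp P g" "g \<in> carrier G" and y: "y \<in> cl (insert x X)"
  shows "\<exists>r\<in>carrier R. \<exists>z\<in>cl X. y = r \<star> x \<boxplus> z"
proof -
  let ?N = "{r \<star> x \<boxplus> z |r z. r \<in> carrier R \<and> z \<in> cl X}"
  have xP: "x \<in> carrier P" using hcomp_closed x by blast
  note c = gsubD[OF gsub_cl[OF X]]
  have zP: "z \<in> carrier P" if "z \<in> cl X" for z using c(1) that by blast
  have in_cl: "z \<in> ?N" if "z \<in> cl X" for z
  proof -
    have "z = \<zero>\<^bsub>R\<^esub> \<star> x \<boxplus> z" using zP[OF that] xP by (simp add: smult_l_null)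
    then show ?thesis using that by blast
  qed
  have "gsub ?N"
  proof (rule gsubI)
    show "?N \<subseteq> carrier P" using xP zP smult_closed by blast
    show "\<zero>\<^bsub>P\<^esub> \<in> ?N" using in_cl c(2) by blast
    show "u \<boxplus> v \<in> ?N" if "u \<in> ?N" "v \<in> ?N" for u v
    proof -
      obtain r z where u: "u = r \<star> x \<boxplus> z" "r \<in> carrier R" "z \<in> cl X" using \<open>u \<in> ?N\<close> by blast
      obtain s w where v: "v = s \<star> x \<boxplus> w" "s \<in> carrier R" "w \<in> cl X" using \<open>v \<in> ?N\<close> by blast
      have "u \<boxplus> v = (r \<oplus>\<^bsub>R\<^esub> s) \<star> x \<boxplus> (z \<boxplus> w)"
        using u v xP zP[OF u(3)] zP[OF v(3)] by (simp add: smult_l_distr smult_closed M.a_ac)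
      then show ?thesis using u(2) v(2) c(3)[OF u(3) v(3)] by blast
    qed
    show "a \<star> u \<in> ?N" if a: "k \<in> carrier G" "a \<in> A k" and "u \<in> ?N" for k a u
    proof -
      have aR: "a \<in> carrier R" using A_closed a by blast
      obtain r z where u: "u = r \<star> x \<boxplus> z" "r \<in> carrier R" "z \<in> cl X" using \<open>u \<in> ?N\<close> by blast
      have "a \<star> u = (a \<cdot> r) \<star> x \<boxplus> a \<star> z"
        using u xP zP[OF u(3)] aR by (simp add: smult_r_distr smult_closed smult_assoc)
      then show ?thesis using u(2) aR c(4)[OF aR u(3)] by blast
    qed
    show "dM.c u k \<in> ?N" if k: "k \<in> carrier G" and "u \<in> ?N" for k u
    proof -
      obtain r z where u: "u = r \<star> x \<boxplus> z" "r \<in> carrier R" "z \<in> cl X" using \<open>u \<in> ?N\<close> by blast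
      let ?k = "k \<otimes>\<^bsub>G\<^esub> inv\<^bsub>G\<^esub> g"
      have kG: "?k \<in> carrier G" "?k \<otimes>\<^bsub>G\<^esub> g = k" using k x(2) by (simp_all add: G.m_assoc)
      have "dM.c u k = dM.c (r \<star> x) k \<boxplus> dM.c z k"
        using u xP zP[OF u(3)] k by (simp add: dM.component_add smult_closed)
      also have "dM.c (r \<star> x) k = dR.c r ?k \<star> x" using component_smult2[OF x(1) kG(1) x(2) u(2)] kG(2) by simp
      finally show ?thesis using dR.component_closed[OF u(2) kG(1)] c(5)[OF u(3) k] by blast
    qed
  qed
  moreover have "insert x X \<subseteq> ?N"
  proof -
    have "x = \<one>\<^bsub>R\<^esub> \<star> x \<boxplus> \<zero>\<^bsub>P\<^esub>" using xP by (simp add: smult_one)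
    then have "x \<in> ?N" using c(2) R.one_closed by blast
    then show ?thesis using in_cl cl_ext[of X] by blast
  qed
  ultimately have "cl (insert x X) \<subseteq> ?N" using in_cl[OF J_cl] by (intro cl_least) auto
  then have "y \<in> ?N" using y by (rule subsetD)
  then show ?thesis by blast
qed

text \<open>The closures of finite subsets of X form a directed family, so their union is a graded
  submodule; it contains J P and X.\<close>

lemma cl_finitary:
  assumes X: "X \<subseteq> carrier P" and y: "y \<in> cl X"
  shows "\<exists>F\<subseteq>X. finite F \<and> y \<in> cl F"
proof -
  let ?N = "{y. \<exists>F\<subseteq>X. finite F \<and> y \<in> cl F}"
  have g: "gsub (cl F)" if "F \<subseteq> X" for F using gsub_cl X that by blast
  have "gsub ?N"
  proof (rule gsubI)
    show "?N \<subseteq> carrier P" using gsubD(1)[OF g] by blast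
    show "\<zero>\<^bsub>P\<^esub> \<in> ?N" using gsubD(2)[OF g[of "{}"]] by blast
    show "u \<boxplus> v \<in> ?N" if "u \<in> ?N" "v \<in> ?N" for u v
    proof -
      obtain F where F: "F \<subseteq> X" "finite F" "u \<in> cl F" using \<open>u \<in> ?N\<close> by blast
      obtain F' where F': "F' \<subseteq> X" "finite F'" "v \<in> cl F'" using \<open>v \<in> ?N\<close> by blast
      have "u \<in> cl (F \<union> F')" "v \<in> cl (F \<union> F')"
        using F(3) F'(3) cl_mono[of F "F \<union> F'"] cl_mono[of F' "F \<union> F'"] by auto
      moreover have "F \<union> F' \<subseteq> X" using F(1) F'(1) by blast
      ultimately have "u \<boxplus> v \<in> cl (F \<union> F')" using gsubD(3)[OF g] by blast
      then show ?thesis using F F' by (intro CollectI exI[of _ "F \<union> F'"]) simp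
    qed
    show "a \<star> u \<in> ?N" if "k \<in> carrier G" "a \<in> A k" "u \<in> ?N" for k a u
      using that(3) gsubD(4)[OF g A_closed[OF that(2,1)]] by blast
    show "dM.c u k \<in> ?N" if "k \<in> carrier G" "u \<in> ?N" for k u
      using that(2) gsubD(5)[OF g _ that(1)] by blast
  qed
  moreover have "X \<subseteq> ?N"
  proof
    fix x assume "x \<in> X"
    then show "x \<in> ?N" using cl_ext[of "{x}"] by (intro CollectI exI[of _ "{x}"]) simp
  qed
  moreover have "a \<star> x \<in> ?N" if "a \<in> J" "x \<in> carrier P" for a x
    using J_cl[OF that, of "{}"] by blast
  ultimately have "cl X \<subseteq> ?N" by (intro cl_least)
  then show ?thesis using y by blast
qed

abbreviation "S e \<sigma> \<equiv> shifted_ideal G R A (cyclic_ideal e) \<sigma>"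

definition atom :: "'b \<Rightarrow> 'a \<Rightarrow> 'g \<Rightarrow> bool" where
  "atom x e \<sigma> \<longleftrightarrow> primitive_idem e \<and> \<sigma> \<in> carrier G \<and> x \<in> hcomp P (inv\<^bsub>G\<^esub> \<sigma>) \<and> e \<star> x = x \<and> x \<notin> cl {}"

lemma atomD:
  assumes "atom x e \<sigma>"
  shows "primitive_idem e" "\<sigma> \<in> carrier G" "x \<in> hcomp P (inv\<^bsub>G\<^esub> \<sigma>)" "e \<star> x = x" "x \<notin> cl {}" "x \<in> carrier P"
  using assms hcomp_closed unfolding atom_def by blast+

text \<open>Write y = r x + z, pass to the degree of y and multiply by f: this gives y = \<rho> x +
  \<zeta> with \<rho> in f R e of degree \<tau>^-1 \<sigma> and \<zeta> in cl Z. If \<rho> were in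
  J, then y would lie in cl Z. So \<rho> can be cancelled, which recovers x from y - \<zeta> and at
  the same time gives the isomorphism.\<close>

lemma atom_exchange:
  assumes x: "atom x e \<sigma>" and y: "atom y f \<tau>" and Z: "Z \<subseteq> carrier P"
    and yx: "y \<in> cl (insert x Z)" and yn: "y \<notin> cl Z"
  shows "x \<in> cl (insert y Z)" "gr_iso G R (S e \<sigma>) (S f \<tau>)"
proof -
  note X = atomD[OF x] and Y = atomD[OF y]
  note e = primitive_idemD[OF X(1)] and f = primitive_idemD[OF Y(1)]
  have gh: "inv\<^bsub>G\<^esub> \<sigma> \<in> carrier G" "inv\<^bsub>G\<^esub> \<tau> \<in> carrier G" using X(2) Y(2) by auto
  note c = gsubD[OF gsub_cl[OF Z]]
  obtain r z where r: "r \<in> carrier R" and z: "z \<in> cl Z" and yrz: "y = r \<star> x \<boxplus> z"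
    using cl_insert[OF Z X(3) gh(1) yx] by blast
  have zP: "z \<in> carrier P" using z c(1) by blast
  let ?h = "inv\<^bsub>G\<^esub> \<tau> \<otimes>\<^bsub>G\<^esub> \<sigma>"
  have hG: "?h \<in> carrier G" "?h \<otimes>\<^bsub>G\<^esub> inv\<^bsub>G\<^esub> \<sigma> = inv\<^bsub>G\<^esub> \<tau>" using X(2) Y(2) by (simp_all add: G.m_assoc)
  define r' where "r' = dR.c r ?h"
  have r': "r' \<in> A ?h" "r' \<in> carrier R" unfolding r'_def using r hG by (simp_all add: dR.component_in dR.component_closed)
  define z' where "z' = dM.c z (inv\<^bsub>G\<^esub> \<tau>)"
  have z': "z' \<in> cl Z" unfolding z'_def using c(5)[OF z gh(2)] .
  have z'P: "z' \<in> carrier P" using z' c(1) by blast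
  have "y = dM.c y (inv\<^bsub>G\<^esub> \<tau>)" using dM.component_self[OF Y(3) gh(2) gh(2)] by simp
  also have "\<dots> = dM.c (r \<star> x) (inv\<^bsub>G\<^esub> \<tau>) \<boxplus> z'"
    unfolding yrz z'_def by (rule dM.component_add) (use r X(6) zP gh smult_closed in auto)
  also have "dM.c (r \<star> x) (inv\<^bsub>G\<^esub> \<tau>) = r' \<star> x"
    using component_smult2[OF X(3) hG(1) gh(1) r] hG(2) by (simp add: r'_def)
  finally have y1: "y = r' \<star> x \<boxplus> z'" .
  define \<rho> where "\<rho> = f \<cdot> r' \<cdot> e"
  define \<zeta> where "\<zeta> = f \<star> z'"
  have \<rho>A: "\<rho> \<in> A ?h"
    unfolding \<rho>_def using A_mult[OF A_mult[OF f(1) r'(1)] e(1)] hG(1) by simp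
  have \<rho>R: "\<rho> \<in> carrier R" using A_closed[OF \<rho>A hG(1)] .
  have \<zeta>: "\<zeta> \<in> cl Z" unfolding \<zeta>_def by (rule c(4)[OF f(2) z'])
  have \<zeta>P: "\<zeta> \<in> carrier P" using \<zeta> c(1) by blast
  have "y = f \<star> y" using Y(4) by simp
  also have "\<dots> = f \<star> (r' \<star> x) \<boxplus> \<zeta>"
    unfolding \<zeta>_def by (subst y1) (use smult_r_distr f(2) r'(2) X(6) z'P smult_closed in auto)
  also have "f \<star> (r' \<star> x) = f \<star> (r' \<star> (e \<star> x))" using X(4) by simp
  also have "\<dots> = \<rho> \<star> x" unfolding \<rho>_def using f(2) r'(2) e(2) X(6) by (simp add: smult_assoc smult_closed)
  finally have y2: "y = \<rho> \<star> x \<boxplus> \<zeta>" .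
  have \<rho>J: "\<rho> \<notin> J"
  proof
    assume "\<rho> \<in> J"
    then have "\<rho> \<star> x \<in> cl Z" using J_cl X(6) by blast
    then have "y \<in> cl Z" unfolding y2 using c(3) \<zeta> by blast
    then show False using yn by blast
  qed
  have \<rho>e: "\<rho> \<cdot> e = \<rho>" and f\<rho>: "f \<cdot> \<rho> = \<rho>"
    unfolding \<rho>_def using e(2,3) f(2,3) r'(2) by (simp_all add: R.m_assoc) (simp add: R.m_assoc[symmetric])
  show "gr_iso G R (S e \<sigma>) (S f \<tau>)"
    by (rule shifted_iso[OF X(1) Y(1) X(2) Y(2) \<rho>A f\<rho> \<rho>e \<rho>J])
  obtain s where s: "s \<in> A (inv\<^bsub>G\<^esub> ?h)" "s \<cdot> \<rho> \<cdot> e = e"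
    using primitive_idem_cancel[OF X(1) \<rho>A hG(1)] \<rho>e \<rho>J by auto
  have sR: "s \<in> carrier R" using A_closed[OF s(1)] hG(1) by simp
  have YZ: "insert y Z \<subseteq> carrier P" using Z Y(6) by blast
  note d = gsubD[OF gsub_cl[OF YZ]]
  have \<rho>x: "\<rho> \<star> x = y \<boxplus> \<ominus>\<^bsub>P\<^esub> \<zeta>"
    using y2 \<zeta>P \<rho>R X(6) smult_closed by (simp add: M.a_assoc M.r_neg)
  have "x = (s \<cdot> \<rho> \<cdot> e) \<star> x" using s(2) X(4) by simp
  also have "\<dots> = s \<star> (\<rho> \<star> (e \<star> x))" using sR \<rho>R e(2) X(6) by (simp add: smult_assoc smult_closed)
  also have "\<dots> = s \<star> (y \<boxplus> \<ominus>\<^bsub>P\<^esub> \<zeta>)" using X(4) \<rho>x by simp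
  also have "\<dots> \<in> cl (insert y Z)"
  proof (rule d(4)[OF sR], rule d(3))
    show "y \<in> cl (insert y Z)" using cl_ext[of "insert y Z"] by blast
    have "\<zeta> \<in> cl (insert y Z)" using \<zeta> cl_mono[of Z "insert y Z"] by blast
    then show "\<ominus>\<^bsub>P\<^esub> \<zeta> \<in> cl (insert y Z)" by (rule d(6))
  qed
  finally show "x \<in> cl (insert y Z)" .
qed

text \<open>The ground set is left open: uniqueness takes the atoms of one isomorphism class,
  existence those belonging to principal indecomposables.\<close>

lemma atoms_pregeometry:
  assumes "\<And>x. x \<in> E \<Longrightarrow> \<exists>e \<sigma>. atom x e \<sigma>"
  shows "pregeometry E cl"
proof
  have EP: "E \<subseteq> carrier P" using assms atomD(6) by blast
  show "\<exists>F\<subseteq>X. finite F \<and> y \<in> cl F" if "X \<subseteq> E" "y \<in> cl X" for X y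
    using cl_finitary[OF _ that(2)] that(1) EP by blast
  show "x \<in> cl (insert y X)" if "X \<subseteq> E" "x \<in> E" "y \<in> E" "y \<in> cl (insert x X)" "y \<notin> cl X" for X x y
  proof -
    obtain e \<sigma> where x: "atom x e \<sigma>" using assms[OF \<open>x \<in> E\<close>] by blast
    obtain f \<tau> where y: "atom y f \<tau>" using assms[OF \<open>y \<in> E\<close>] by blast
    show ?thesis using atom_exchange(1)[OF x y _ that(4,5)] that(1) EP by blast
  qed
qed (rule cl_ext cl_mono cl_idem; assumption?)+

definition frame :: "'i set \<Rightarrow> ('i \<Rightarrow> 'a) \<Rightarrow> ('i \<Rightarrow> 'g) \<Rightarrow> ('i \<Rightarrow> 'b) \<Rightarrow> bool" where
  "frame I e \<sigma> x \<longleftrightarrow> inj_on x I \<and> (\<forall>i\<in>I. atom (x i) (e i) (\<sigma> i)) \<and> carrier P \<subseteq> cl (x ` I) \<and>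
     (\<forall>i\<in>I. x i \<notin> cl (x ` I - {x i}))"

text \<open>An atom y of the class lies in the closure of finitely many frame elements. Those of
  other classes can be removed one by one: if y depended on such an element, exchange would make the
  two summands isomorphic.\<close>

lemma frame_class_basis:
  fixes c :: "('a, 'a, 'g) gr_module"
  assumes fr: "frame I e \<sigma> x"
  defines "E \<equiv> {y. \<exists>f \<tau>. atom y f \<tau> \<and> gr_iso G R (S f \<tau>) c}"
  defines "X \<equiv> x ` {i \<in> I. gr_iso G R (S (e i) (\<sigma> i)) c}"
  shows "pregeometry E cl" "pregeometry.indep E cl X" "E \<subseteq> cl X"
proof -
  show pg: "pregeometry E cl" by (rule atoms_pregeometry) (auto simp: E_def)
  note fr' = fr[unfolded frame_def]
  have at: "atom (x i) (e i) (\<sigma> i)" if "i \<in> I" for i using fr' that by blast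
  have XP: "x ` I \<subseteq> carrier P" using at atomD(6) by blast
  have "X \<subseteq> E" unfolding X_def E_def using at by blast
  moreover have "y \<notin> cl (X - {y})" if y: "y \<in> X" for y
  proof -
    obtain i where i: "i \<in> I" "y = x i" using y unfolding X_def by blast
    have "cl (X - {y}) \<subseteq> cl (x ` I - {x i})" unfolding i(2) by (rule cl_mono) (auto simp: X_def)
    then show ?thesis using fr' i by blast
  qed
  ultimately show "pregeometry.indep E cl X" unfolding pregeometry.indep_def[OF pg] by blast
  have drop: "y \<in> cl Z"
    if "finite D" "D \<subseteq> x ` I - X" "Z \<subseteq> carrier P" "atom y f \<tau>" "gr_iso G R (S f \<tau>) c" "y \<in> cl (D \<union> Z)" for y f \<tau> D Z
    using that(1,2,6)
  proof (induction D rule: finite_induct)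
    case (insert d D)
    have DZ: "D \<union> Z \<subseteq> carrier P" using insert.prems(1) XP that(3) by blast
    have "y \<in> cl (D \<union> Z)"
    proof (rule ccontr)
      assume n: "y \<notin> cl (D \<union> Z)"
      obtain i where i: "i \<in> I" "d = x i" "d \<notin> X" using insert.prems(1) by blast
      have y': "y \<in> cl (insert (x i) (D \<union> Z))" using insert.prems(2) i(2) by simp
      have "gr_iso G R (S (e i) (\<sigma> i)) (S f \<tau>)" by (rule atom_exchange(2)[OF at[OF i(1)] that(4) DZ y' n])
      then have "gr_iso G R (S (e i) (\<sigma> i)) c" using that(5) by (rule gr_iso_trans)
      then show False using i unfolding X_def by blast
    qed
    then show ?case using insert by blast
  qed simp
  show "E \<subseteq> cl X"
  proof
    fix y assume "y \<in> E"
    then obtain f \<tau> where y: "atom y f \<tau>" "gr_iso G R (S f \<tau>) c" unfolding E_def by blast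
    have "y \<in> cl (x ` I)" using fr' atomD(6)[OF y(1)] by blast
    then obtain F where F: "F \<subseteq> x ` I" "finite F" "y \<in> cl F" using cl_finitary[OF XP] by blast
    have "y \<in> cl (F \<inter> X)"
    proof (rule drop[OF _ _ _ y])
      show "finite (F - X)" using F(2) by simp
      have "F - X \<union> F \<inter> X = F" by blast
      then show "y \<in> cl (F - X \<union> F \<inter> X)" using F(3) by simp
    qed (use F XP in auto)
    then show "y \<in> cl X" using cl_mono[of "F \<inter> X" X] by blast
  qed
qed

text \<open>For each class c, the members of the two frames in that class are bases of one
  pregeometry, whose ground set is defined without reference to a frame.\<close>

lemma frames_bij:
  assumes x: "frame I e \<sigma> x" and y: "frame I' e' \<sigma>' y"
  shows "\<exists>\<pi>. bij_betw \<pi> I I' \<and> (\<forall>i\<in>I. gr_iso G R (S (e i) (\<sigma> i)) (S (e' (\<pi> i)) (\<sigma>' (\<pi> i))))"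
proof (rule classwise_bij[where r = "gr_iso G R" and k = "\<lambda>i. S (e i) (\<sigma> i)" and l = "\<lambda>i. S (e' i) (\<sigma>' i)"])
  fix c :: "('a, 'a, 'g) gr_module"
  let ?E = "{y. \<exists>f \<tau>. atom y f \<tau> \<and> gr_iso G R (S f \<tau>) c}"
  let ?I = "{i \<in> I. gr_iso G R (S (e i) (\<sigma> i)) c}" and ?I' = "{i \<in> I'. gr_iso G R (S (e' i) (\<sigma>' i)) c}"
  obtain f where f: "bij_betw f (x ` ?I) (y ` ?I')"
    using pregeometry.bases_equipotent[OF frame_class_basis(1)[where c = c, OF x] frame_class_basis(2,3)[where c = c, OF x]
        frame_class_basis(2,3)[where c = c, OF y]] by blast
  have bx: "bij_betw x ?I (x ` ?I)" and "bij_betw y ?I' (y ` ?I')"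
    using x y unfolding frame_def bij_betw_def by (blast intro: inj_on_subset)+
  then have "bij_betw (inv_into ?I' y) (y ` ?I') ?I'" by (intro bij_betw_inv_into)
  then have "bij_betw (inv_into ?I' y \<circ> (f \<circ> x)) ?I ?I'" using bij_betw_trans[OF bij_betw_trans[OF bx f]] by blast
  then show "\<exists>f. bij_betw f ?I ?I'" by blast
qed (fact gr_iso_refl gr_iso_sym gr_iso_trans)+

end

section \<open>Frames obtained from direct sum decompositions\<close>

context gr_artin
begin

lemma graded_family_shifted:
  assumes "\<And>i. i \<in> I \<Longrightarrow> primitive_idem (e i)" "\<And>i. i \<in> I \<Longrightarrow> \<sigma> i \<in> carrier G"
  shows "graded_family G R A I (\<lambda>i. shifted_ideal G R A (cyclic_ideal (e i)) (\<sigma> i))"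
  by (rule graded_family.intro[OF graded_ring_axioms graded_family_axioms.intro])
    (rule graded_shifted_ideal[OF gr_left_ideal_cyclic_ideal[OF primitive_idemD(1)[OF assms(1)]] assms(2)])

lemma shifted_component:
  assumes U: "gr_left_ideal U" and \<sigma>: "\<sigma> \<in> carrier G" and x: "x \<in> U" and g: "g \<in> carrier G"
  shows "component (shifted_ideal G R A U \<sigma>) (carrier G) (hcomp (shifted_ideal G R A U \<sigma>)) x g = dR.c x (g \<otimes>\<^bsub>G\<^esub> \<sigma>)"
proof -
  interpret S: graded_module G R A "shifted_ideal G R A U \<sigma>" by (rule graded_shifted_ideal[OF U \<sigma>])
  have UR: "y \<in> carrier R" if "y \<in> U" for y using gr_left_idealD(7)[OF U that] .
  have "x \<in> carrier (shifted_ideal G R A U \<sigma>)" using x by (simp add: shifted_ideal_simps)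
  then show ?thesis
  proof (induction rule: S.mhom_induct)
    case zero
    then show ?case using S.component_zero[OF g] reg.component_zero[of "g \<otimes>\<^bsub>G\<^esub> \<sigma>"] g \<sigma>
      by (simp add: shifted_ideal_simps)
  next
    case (homog h y)
    have y: "y \<in> A (h \<otimes>\<^bsub>G\<^esub> \<sigma>)" using homog(2) by (simp add: shifted_ideal_simps)
    show ?case using S.dM.component_self[OF homog(2,1) g] dR.component_self[OF y, of "g \<otimes>\<^bsub>G\<^esub> \<sigma>"] homog(1) g \<sigma>
      by (simp add: shifted_ideal_simps)
  next
    case (add y z)
    have yz: "y \<in> carrier R" "z \<in> carrier R" using add(1,2) UR by (simp_all add: shifted_ideal_simps)
    show ?case using S.dM.component_add[OF add(1,2) g] dR.component_add[OF yz, of "g \<otimes>\<^bsub>G\<^esub> \<sigma>"] add(3,4) g \<sigma>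
      by (simp add: shifted_ideal_simps)
  qed
qed

end

context gr_artin_module
begin

text \<open>The generators e i of the summands are carried over to P. Independence is witnessed by W
  i, the elements whose coordinate at i lies in J: it contains J P because J is two-sided, and every
  x j with j \<noteq> i, but not x i, as J has no nonzero idempotent.\<close>

lemma frame_of_iso:
  assumes e: "\<And>i. i \<in> I \<Longrightarrow> primitive_idem (e i)" and \<sigma>: "\<And>i. i \<in> I \<Longrightarrow> \<sigma> i \<in> carrier G"
    and iso: "gr_iso G R P (gr_direct_sum I (\<lambda>i. S (e i) (\<sigma> i)))"
  shows "\<exists>x. frame I e \<sigma> x"
proof -
  let ?M = "\<lambda>i. S (e i) (\<sigma> i)"
  interpret F: graded_family G R A I ?M by (rule graded_family_shifted[OF e \<sigma>])
  obtain f h where f: "f \<in> gr_hom G R P F.F" and h: "h \<in> gr_hom G R F.F P"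
    and hf: "\<And>p. p \<in> carrier P \<Longrightarrow> h (f p) = p" and fh: "\<And>u. u \<in> carrier F.F \<Longrightarrow> f (h u) = u"
    using iso unfolding gr_iso_def by blast
  define x where "x i = h (F.single i (e i))" for i
  have eM: "e i \<in> carrier (?M i)" if "i \<in> I" for i
    using self_cyclic_ideal primitive_idemD(2)[OF e[OF that]] by (simp add: shifted_ideal_simps)
  have sF: "F.single i (e i) \<in> carrier F.F" if "i \<in> I" for i using F.single_closed[OF that eM[OF that]] .
  have xP: "x i \<in> carrier P" if "i \<in> I" for i unfolding x_def using gr_homD(1)[OF h sF[OF that]] .
  have fx: "f (x i) = F.single i (e i)" if "i \<in> I" for i unfolding x_def using fh[OF sF[OF that]] .
  have co: "f p i \<in> cyclic_ideal (e i)" "f p i \<in> carrier R" if "p \<in> carrier P" "i \<in> I" for p i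
    using F.carrierFD[OF gr_homD(1)[OF f that(1)] that(2)] gr_left_idealD(7)[OF gr_left_ideal_cyclic_ideal[OF primitive_idemD(1)[OF e[OF that(2)]]]]
    by (simp_all add: shifted_ideal_simps)
  define W where "W i = {p \<in> carrier P. f p i \<in> J}" for i
  have W: "gsub (W i)" "\<And>a p. a \<in> J \<Longrightarrow> p \<in> carrier P \<Longrightarrow> a \<star> p \<in> W i" if i: "i \<in> I" for i
  proof -
    have sm: "f (a \<star> p) i = a \<cdot> f p i" if "a \<in> carrier R" "p \<in> carrier P" for a p
      using gr_homD(3)[OF f that] i by (simp add: gr_direct_sum_simps(4) shifted_ideal_simps)
    show "gsub (W i)"
    proof (rule gsubI)
      show "W i \<subseteq> carrier P" unfolding W_def by blast
      show "\<zero>\<^bsub>P\<^esub> \<in> W i"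
        using gr_hom_zero[OF graded_module_axioms F.graded_direct_sum f] i gr_left_idealD(2)[OF gr_left_ideal_J]
        by (simp add: W_def gr_direct_sum_simps(2) shifted_ideal_simps)
      show "p \<boxplus> q \<in> W i" if "p \<in> W i" "q \<in> W i" for p q
        using that gr_homD(2)[OF f, of p q] i J_add by (simp add: W_def gr_direct_sum_simps(3) shifted_ideal_simps)
      show "a \<star> p \<in> W i" if "k \<in> carrier G" "a \<in> A k" "p \<in> W i" for k a p
        using that(3) A_closed[OF that(2,1)] sm[of a p] gr_left_idealD(4)[OF gr_left_ideal_J, of a "f p i"] by (simp add: W_def smult_closed)
      show "dM.c p k \<in> W i" if k: "k \<in> carrier G" and p: "p \<in> W i" for k p
      proof -
        have pP: "p \<in> carrier P" and pJ: "f p i \<in> J" using p by (auto simp: W_def)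
        have "f (dM.c p k) i = F.F.dM.c (f p) k i"
          using gr_hom_component[OF graded_module_axioms F.graded_direct_sum f pP k] by simp
        also have "\<dots> = dR.c (f p i) (k \<otimes>\<^bsub>G\<^esub> \<sigma> i)"
          unfolding F.F_component[OF gr_homD(1)[OF f pP] k i]
          by (rule shifted_component[OF gr_left_ideal_cyclic_ideal[OF primitive_idemD(1)[OF e[OF i]]] \<sigma>[OF i] co(1)[OF pP i] k])
        also have "\<dots> \<in> J" using gr_left_idealD(5)[OF gr_left_ideal_J pJ] k \<sigma>[OF i] by simp
        finally show ?thesis using dM.component_closed[OF pP k] by (simp add: W_def)
      qed
    qed
    show "a \<star> p \<in> W i" if "a \<in> J" "p \<in> carrier P" for a p
      using sm[of a p] J_closed[OF that(1)] J_right[OF that(1) co(2)[OF that(2) i]] that(2) smult_closed by (simp add: W_def)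
  qed
  have xW: "x j \<in> W i" if "i \<in> I" "j \<in> I" "j \<noteq> i" for i j
    using fx[OF that(2)] that xP gr_left_idealD(2)[OF gr_left_ideal_J] by (simp add: W_def F.single_apply shifted_ideal_simps)
  have xn: "x i \<notin> W i" if i: "i \<in> I" for i
  proof
    assume "x i \<in> W i"
    then have "e i \<in> J" using fx[OF i] i by (simp add: W_def F.single_apply)
    then show False using J_no_idem primitive_idemD(3,4)[OF e[OF i]] by blast
  qed
  have clW: "cl (x ` I - {x i}) \<subseteq> W i" if i: "i \<in> I" for i
    by (rule cl_least[OF W[OF i]]) (use xW[OF i] in auto)
  have "inj_on x I"
  proof (rule inj_onI, rule ccontr)
    fix i j assume ij: "i \<in> I" "j \<in> I" "x i = x j" "i \<noteq> j"
    then show False using xW[of i j] xn[of i] by simp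
  qed
  moreover have "x i \<notin> cl (x ` I - {x i})" if i: "i \<in> I" for i using clW[OF i] xn[OF i] by blast
  moreover have "atom (x i) (e i) (\<sigma> i)" if i: "i \<in> I" for i
    unfolding atom_def
  proof (intro conjI)
    have "e i \<in> hcomp (?M i) (inv\<^bsub>G\<^esub> (\<sigma> i))"
      using primitive_idemD(1,2)[OF e[OF i]] self_cyclic_ideal \<sigma>[OF i] by (simp add: shifted_ideal_simps)
    then have "F.single i (e i) \<in> hcomp F.F (inv\<^bsub>G\<^esub> (\<sigma> i))" using gr_homD(4)[OF F.single_hom[OF i]] \<sigma>[OF i] by simp
    then show "x i \<in> hcomp P (inv\<^bsub>G\<^esub> (\<sigma> i))" unfolding x_def using gr_homD(4)[OF h] \<sigma>[OF i] by simp
    have "e i \<star> x i = h (e i \<odot>\<^bsub>F.F\<^esub> F.single i (e i))"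
      unfolding x_def using gr_homD(3)[OF h primitive_idemD(2)[OF e[OF i]] sF[OF i]] by simp
    also have "e i \<odot>\<^bsub>F.F\<^esub> F.single i (e i) = F.single i (e i \<odot>\<^bsub>?M i\<^esub> e i)"
      using gr_homD(3)[OF F.single_hom[OF i] primitive_idemD(2)[OF e[OF i]] eM[OF i]] by simp
    also have "\<dots> = F.single i (e i)" using primitive_idemD(3)[OF e[OF i]] by (simp add: shifted_ideal_simps)
    finally show "e i \<star> x i = x i" unfolding x_def .
    show "x i \<notin> cl {}" using xn[OF i] clW[OF i] cl_mono[of "{}" "x ` I - {x i}"] by blast
  qed (use e \<sigma> i in auto)
  moreover have "p \<in> cl (x ` I)" if p: "p \<in> carrier P" for p
  proof -
    have g: "gsub (cl (x ` I))" using xP by (intro gsub_cl) blast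
    have "h (f p) \<in> cl (x ` I)"
    proof (rule F.F_induct[OF gr_homD(1)[OF f p]])
      show "h \<zero>\<^bsub>F.F\<^esub> \<in> cl (x ` I)" using gr_hom_zero[OF F.graded_direct_sum graded_module_axioms h] gsubD(2)[OF g] by simp
      show "h (u \<oplus>\<^bsub>F.F\<^esub> v) \<in> cl (x ` I)"
        if "u \<in> carrier F.F" "v \<in> carrier F.F" "h u \<in> cl (x ` I)" "h v \<in> cl (x ` I)" for u v
        using that gr_homD(2)[OF h] gsubD(3)[OF g] by simp
      fix i assume i: "i \<in> I"
      have r: "f p i \<cdot> e i = f p i" "f p i \<in> carrier R" using co[OF p i] cyclic_ideal_iff[OF primitive_idemD(2,3)[OF e[OF i]]] by auto
      have "F.single i (f p i) = f p i \<odot>\<^bsub>F.F\<^esub> F.single i (e i)"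
        using gr_homD(3)[OF F.single_hom[OF i] r(2) eM[OF i]] r(1) by (simp add: shifted_ideal_simps)
      then have "h (F.single i (f p i)) = f p i \<star> x i" unfolding x_def using gr_homD(3)[OF h r(2) sF[OF i]] by simp
      moreover have "x i \<in> cl (x ` I)" using cl_ext[of "x ` I"] i by blast
      ultimately show "h (F.single i (f p i)) \<in> cl (x ` I)" using gsubD(4)[OF g r(2)] by simp
    qed
    then show ?thesis using hf[OF p] by simp
  qed
  ultimately have "frame I e \<sigma> x" unfolding frame_def by blast
  then show ?thesis by blast
qed

lemma frame_exists:
  assumes K: "shifted_principal_family G R A K V \<rho>" "gr_iso G R P (gr_direct_sum K (\<lambda>i. shifted_ideal G R A (V i) (\<rho> i)))"
  shows "\<exists>e x. (\<forall>i\<in>K. V i = cyclic_ideal (e i)) \<and> frame K e \<rho> x"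
proof -
  have "\<forall>i\<in>K. \<exists>e. primitive_idem e \<and> V i = cyclic_ideal e" using K(1) principal_primitive_idem unfolding shifted_principal_family_def by metis
  then obtain e where e: "\<And>i. i \<in> K \<Longrightarrow> primitive_idem (e i)" "\<And>i. i \<in> K \<Longrightarrow> V i = cyclic_ideal (e i)" by metis
  have "gr_direct_sum K (\<lambda>i. shifted_ideal G R A (V i) (\<rho> i)) = gr_direct_sum K (\<lambda>i. S (e i) (\<rho> i))"
    unfolding gr_direct_sum_def using e(2) by (simp cong: PiE_cong restrict_cong conj_cong ball_cong)
  then show ?thesis using frame_of_iso[of K e \<rho>] e K unfolding shifted_principal_family_def by auto
qed

lemma principal_summands_unique:
  assumes I: "shifted_principal_family G R A I Q \<sigma>" "gr_iso G R P (gr_direct_sum I (\<lambda>i. shifted_ideal G R A (Q i) (\<sigma> i)))"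
    and I': "shifted_principal_family G R A I' Q' \<tau>" "gr_iso G R P (gr_direct_sum I' (\<lambda>i. shifted_ideal G R A (Q' i) (\<tau> i)))"
  shows "\<exists>\<pi>. bij_betw \<pi> I I' \<and>
    (\<forall>i\<in>I. gr_iso G R (shifted_ideal G R A (Q i) (\<sigma> i)) (shifted_ideal G R A (Q' (\<pi> i)) (\<tau> (\<pi> i))))"
proof -
  obtain e x where x: "\<forall>i\<in>I. Q i = cyclic_ideal (e i)" "frame I e \<sigma> x" using frame_exists[OF I] by blast
  obtain e' y where y: "\<forall>i\<in>I'. Q' i = cyclic_ideal (e' i)" "frame I' e' \<tau> y" using frame_exists[OF I'] by blast
  obtain \<pi> where \<pi>: "bij_betw \<pi> I I'" "\<forall>i\<in>I. gr_iso G R (S (e i) (\<sigma> i)) (S (e' (\<pi> i)) (\<tau> (\<pi> i)))"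
    using frames_bij[OF x(2) y(2)] by blast
  have "gr_iso G R (shifted_ideal G R A (Q i) (\<sigma> i)) (shifted_ideal G R A (Q' (\<pi> i)) (\<tau> (\<pi> i)))" if "i \<in> I" for i
    using \<pi> that x(1) y(1) bij_betwE[OF \<pi>(1)] by simp
  then show ?thesis using \<pi>(1) by blast
qed

end

section \<open>Existence: Nakayama and lifting\<close>

text \<open>\<open>set_power\<close> prepends factors on the left, whereas the descending inductions
  below need a new factor next to the module element.\<close>

lemma (in graded_ring) set_power_append:
  assumes "L \<subseteq> carrier R" "a \<in> L"
  shows "z \<in> set_power L n \<Longrightarrow> z \<cdot> a \<in> set_power L (Suc n)"
proof (induction n arbitrary: z)
  case 0
  then have "z \<cdot> a = a \<cdot> \<one>\<^bsub>R\<^esub>" using assms by auto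
  then show ?case using assms(2) by auto
next
  case (Suc n)
  then obtain b y where z: "z = b \<cdot> y" "b \<in> L" "y \<in> set_power L n" by auto
  have "b \<in> carrier R" "y \<in> carrier R" "a \<in> carrier R" using z(2,3) assms set_power_closed[OF assms(1)] by blast+
  then have "z \<cdot> a = b \<cdot> (y \<cdot> a)" using z(1) by (simp add: R.m_assoc)
  then show ?case using set_power_SucI[OF z(2) Suc.IH[OF z(3)]] by simp
qed

context gr_artin_module
begin

text \<open>
  Products of homogeneous elements of \<open>J\<close> are used below so that the submodule \<open>{x. z x \<in> N for all z}\<close> is graded.
\<close>

definition Jh :: "'a set" where
  "Jh = {a \<in> J. \<exists>g\<in>carrier G. a \<in> A g}"

lemma Jh_sub: "Jh \<subseteq> J" "Jh \<subseteq> carrier R"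
  unfolding Jh_def using J_closed by blast+

lemma set_power_Jh_homog: "z \<in> set_power Jh n \<Longrightarrow> \<exists>g\<in>carrier G. z \<in> A g"
proof (induction n arbitrary: z)
  case 0
  then show ?case using one_homogeneous by auto
next
  case (Suc n)
  then obtain b y where z: "z = b \<cdot> y" "b \<in> Jh" "y \<in> set_power Jh n" by auto
  obtain g where "g \<in> carrier G" "b \<in> A g" using z(2) unfolding Jh_def by blast
  moreover obtain h where "h \<in> carrier G" "y \<in> A h" using Suc.IH[OF z(3)] by blast
  ultimately show ?case using A_mult z(1) G.m_closed by blast
qed

lemma set_power_Jh_right:
  assumes r: "r \<in> A k" "k \<in> carrier G"
  shows "z \<in> set_power Jh (Suc n) \<Longrightarrow> z \<cdot> r \<in> set_power Jh (Suc n)"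
proof (induction n arbitrary: z)
  have rR: "r \<in> carrier R" using A_closed r by blast
  {
    case 0
    then obtain b where z: "z = b \<cdot> \<one>\<^bsub>R\<^esub>" "b \<in> Jh" by auto
    obtain g where g: "g \<in> carrier G" "b \<in> A g" "b \<in> J" using z(2) unfolding Jh_def by blast
    have "b \<cdot> r \<in> Jh" unfolding Jh_def using J_right[OF g(3) rR] A_mult[OF g(2) r(1) g(1) r(2)] g(1) r(2) by auto
    moreover have "z \<cdot> r = (b \<cdot> r) \<cdot> \<one>\<^bsub>R\<^esub>" using z(1) J_closed[OF g(3)] rR by simp
    ultimately show ?case by auto
  next
    case (Suc n)
    then obtain b y where z: "z = b \<cdot> y" "b \<in> Jh" "y \<in> set_power Jh (Suc n)" by (simp only: set_power.simps(2)[of _ "Suc n"]) blast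
    have "b \<in> carrier R" "y \<in> carrier R" using z(2,3) set_power_closed[OF Jh_sub(2)] Jh_sub(2) by blast+
    then have "z \<cdot> r = b \<cdot> (y \<cdot> r)" using z(1) rR by (simp add: R.m_assoc)
    then show ?case using set_power_SucI[OF z(2) Suc.IH[OF z(3)]] by simp
  }
qed

text \<open>Let M k be the set of x whose multiples by all k-fold products lie in N. If P = M (k +
  1), then J P lies in M k, as does X, so P = cl X lies in M k. Start at k = m with J^m = 0 and
  descend to M 0 = N.\<close>

lemma nakayama:
  assumes N: "gsub N" and X: "X \<subseteq> N" and all: "carrier P \<subseteq> cl X"
  shows "carrier P \<subseteq> N"
proof -
  note n = gsubD[OF N]
  define M where "M k = {x \<in> carrier P. \<forall>z\<in>set_power Jh k. z \<star> x \<in> N}" for k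
  have zR: "z \<in> carrier R" if "z \<in> set_power Jh k" for z k using set_power_closed[OF Jh_sub(2)] that by blast
  have gM: "gsub (M k)" for k
  proof (rule gsubI)
    show "M k \<subseteq> carrier P" unfolding M_def by blast
    show "\<zero>\<^bsub>P\<^esub> \<in> M k" unfolding M_def using zR n(2) by (simp add: smult_r_null)
    show "x \<boxplus> y \<in> M k" if "x \<in> M k" "y \<in> M k" for x y
      using that zR n(3) unfolding M_def by (simp add: smult_r_distr)
    show "a \<star> x \<in> M k" if a: "g \<in> carrier G" "a \<in> A g" and x: "x \<in> M k" for g a x
    proof -
      have aR: "a \<in> carrier R" and xP: "x \<in> carrier P" using A_closed a x by (auto simp: M_def)
      have "z \<star> (a \<star> x) \<in> N" if z: "z \<in> set_power Jh k" for z
      \<comment> \<open>The only product of length 0 is 1, which right multiplication by a does not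
        preserve; there the closure of N under scalars is used instead.\<close>
      proof (cases k)
        case 0
        then have "z = \<one>\<^bsub>R\<^esub>" "\<one>\<^bsub>R\<^esub> \<star> x \<in> N" using z x by (auto simp: M_def)
        then show ?thesis using n(4)[OF aR] aR xP by (simp add: smult_one smult_closed)
      next
        case (Suc j)
        have "z \<star> (a \<star> x) = (z \<cdot> a) \<star> x" using zR[OF z] aR xP by (simp add: smult_assoc)
        then show ?thesis using set_power_Jh_right[OF a(2,1)] z x unfolding Suc M_def by simp
      qed
      then show ?thesis using aR xP smult_closed unfolding M_def by simp
    qed
    show "dM.c x g \<in> M k" if g: "g \<in> carrier G" and x: "x \<in> M k" for g x
    proof -
      have xP: "x \<in> carrier P" using x by (simp add: M_def)
      have "z \<star> dM.c x g \<in> N" if z: "z \<in> set_power Jh k" for z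
      proof -
        obtain h where h: "h \<in> carrier G" "z \<in> A h" using set_power_Jh_homog[OF z] by blast
        have "z \<star> x \<in> N" using x z by (simp add: M_def)
        then show ?thesis using component_smult[OF h(2,1) g xP] n(5) g h(1) by (metis G.m_closed)
      qed
      then show ?thesis using dM.component_closed[OF xP g] unfolding M_def by simp
    qed
  qed
  have step: "carrier P \<subseteq> M k" if "carrier P \<subseteq> M (Suc k)" for k
  proof -
    have "cl X \<subseteq> M k"
    proof (rule cl_least[OF gM])
      show "X \<subseteq> M k"
      proof
        fix x assume "x \<in> X"
        then have "x \<in> N" using X by blast
        then show "x \<in> M k" unfolding M_def using n(1) n(4)[OF zR] by blast
      qed
      show "a \<star> x \<in> M k" if a: "a \<in> J" and x: "x \<in> carrier P" for a x
      proof (rule dR.component_induct[where Q = "\<lambda>a. a \<star> x \<in> M k", OF J_closed[OF a]])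
        show "\<zero>\<^bsub>R\<^esub> \<star> x \<in> M k" using gsubD(2)[OF gM] x by (simp add: smult_l_null)
        show "(b \<oplus>\<^bsub>R\<^esub> c) \<star> x \<in> M k" if "b \<in> carrier R" "c \<in> carrier R" "b \<star> x \<in> M k" "c \<star> x \<in> M k" for b c
          using that x gsubD(3)[OF gM] by (simp add: smult_l_distr)
        fix g assume g: "g \<in> carrier G"
        let ?a = "dR.c a g"
        have aJ: "?a \<in> Jh"
          unfolding Jh_def using gr_left_idealD(5)[OF gr_left_ideal_J a g] dR.component_in[OF J_closed[OF a] g] g by blast
        have aR: "?a \<in> carrier R" using aJ Jh_sub(2) by blast
        have "z \<star> (?a \<star> x) \<in> N" if z: "z \<in> set_power Jh k" for z
        proof -
          have "z \<star> (?a \<star> x) = (z \<cdot> ?a) \<star> x" using zR[OF z] aR x by (simp add: smult_assoc)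
          moreover have "z \<cdot> ?a \<in> set_power Jh (Suc k)" using set_power_append[OF Jh_sub(2) aJ z] .
          moreover have "x \<in> M (Suc k)" using \<open>carrier P \<subseteq> M (Suc k)\<close> x by blast
          ultimately show ?thesis unfolding M_def by simp
        qed
        then show "?a \<star> x \<in> M k" using aR x smult_closed unfolding M_def by simp
      qed
    qed
    then show ?thesis using all by blast
  qed
  obtain m where m: "set_power J m \<subseteq> {\<zero>\<^bsub>R\<^esub>}" using nilpotent_J unfolding nilpotent_def by blast
  have "carrier P \<subseteq> M (m - k)" for k
  proof (induction k)
    case 0
    have "set_power Jh m \<subseteq> {\<zero>\<^bsub>R\<^esub>}" using set_power_mono[OF Jh_sub(1), of m] m by (rule subset_trans)
    then have "z \<star> x \<in> N" if "z \<in> set_power Jh m" "x \<in> carrier P" for z x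
    proof -
      have "z = \<zero>\<^bsub>R\<^esub>" using \<open>set_power Jh m \<subseteq> _\<close> that(1) by blast
      then show ?thesis using n(2) smult_l_null[OF that(2)] by simp
    qed
    then show ?case unfolding M_def by auto
  next
    case (Suc k)
    show ?case
    proof (cases "k < m")
      case True
      then have "Suc (m - Suc k) = m - k" by simp
      then show ?thesis using step[of "m - Suc k"] Suc.IH by simp
    qed (use Suc in simp)
  qed
  from this[of m] have "carrier P \<subseteq> M 0" by simp
  then show ?thesis unfolding M_def by (auto simp: smult_one)
qed

lemma gsub_image:
  assumes M: "graded_module G R A M" and f: "f \<in> gr_hom G R M P"
  shows "gsub (f ` carrier M)"
proof -
  interpret M: graded_module G R A M by (rule M)
  note h = gr_homD[OF f]
  show ?thesis
  proof (rule gsubI)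
    show "f ` carrier M \<subseteq> carrier P" using h(1) by blast
    show "\<zero>\<^bsub>P\<^esub> \<in> f ` carrier M"
      using gr_hom_zero[OF M graded_module_axioms f] M.M.zero_closed by (metis imageI)
    show "x \<boxplus> y \<in> f ` carrier M" if xy: "x \<in> f ` carrier M" "y \<in> f ` carrier M" for x y
    proof -
      obtain u v where "x = f u" "y = f v" "u \<in> carrier M" "v \<in> carrier M" using xy by blast
      then show ?thesis using h(2) by (intro image_eqI[of _ _ "u \<oplus>\<^bsub>M\<^esub> v"]) simp_all
    qed
    show "a \<star> x \<in> f ` carrier M" if a: "g \<in> carrier G" "a \<in> A g" and x: "x \<in> f ` carrier M" for g a x
    proof -
      obtain u where "x = f u" "u \<in> carrier M" using x by blast
      then show ?thesis using h(3) A_closed[OF a(2,1)] M.smult_closed by (intro image_eqI[of _ _ "a \<odot>\<^bsub>M\<^esub> u"]) simp_all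
    qed
    show "dM.c x g \<in> f ` carrier M" if g: "g \<in> carrier G" and x: "x \<in> f ` carrier M" for g x
    proof -
      obtain u where u: "x = f u" "u \<in> carrier M" using x by blast
      show ?thesis unfolding u(1) gr_hom_component[OF M graded_module_axioms f u(2) g]
        by (rule imageI) (rule M.dM.component_closed[OF u(2) g])
    qed
  qed
qed

text \<open>Admitting only atoms of principal indecomposables loses nothing: with 1 written as a sum
  of principal idempotents s, a homogeneous y is the sum of the s y, and an s y outside the closure
  would be an atom of the ground set.\<close>

lemma principal_frame_exists:
  obtains X e \<sigma> where "frame X e \<sigma> (\<lambda>x. x)" "\<And>x. x \<in> X \<Longrightarrow> principal_gr_indecomposable G R A (cyclic_ideal (e x))"
proof -
  define E where "E = {x. \<exists>e \<sigma>. atom x e \<sigma> \<and> principal_gr_indecomposable G R A (cyclic_ideal e)}"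
  have pg: "pregeometry E cl" by (rule atoms_pregeometry) (auto simp: E_def)
  obtain X where X: "pregeometry.indep E cl X" "E \<subseteq> cl X" using pregeometry.basis_exists[OF pg] by blast
  note ind = X(1)[unfolded pregeometry.indep_def[OF pg]]
  have "\<forall>x\<in>X. \<exists>e \<sigma>. atom x e \<sigma> \<and> principal_gr_indecomposable G R A (cyclic_ideal e)"
    using ind unfolding E_def by blast
  then obtain e \<sigma> where at: "\<And>x. x \<in> X \<Longrightarrow> atom x (e x) (\<sigma> x)"
    and pr: "\<And>x. x \<in> X \<Longrightarrow> principal_gr_indecomposable G R A (cyclic_ideal (e x))" by metis
  have XP: "X \<subseteq> carrier P" using at atomD(6) by blast
  note c = gsubD[OF gsub_cl[OF XP]]
  obtain T where T: "finite T" "\<And>s. s \<in> T \<Longrightarrow> primitive_idem s" "\<And>s. s \<in> T \<Longrightarrow> principal_gr_indecomposable G R A (cyclic_ideal s)"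
    and one: "\<one>\<^bsub>R\<^esub> = finsum R (\<lambda>s. s) T" using principal_decomposition by blast
  have homog: "y \<in> cl X" if y: "y \<in> hcomp P h" "h \<in> carrier G" for y h
  proof -
    have yP: "y \<in> carrier P" using hcomp_closed y by blast
    have sy: "s \<star> y \<in> cl X" if s: "s \<in> T" for s
    proof (rule ccontr)
      assume n: "s \<star> y \<notin> cl X"
      note s' = primitive_idemD[OF T(2)[OF s]]
      have "s \<star> y \<in> hcomp P h" using module_grading_smult[OF G.one_closed y(2) s'(1) y(1)] y(2) by simp
      moreover have "s \<star> (s \<star> y) = s \<star> y" using s'(2,3) yP by (simp add: smult_assoc[symmetric])
      moreover have "s \<star> y \<notin> cl {}" using n cl_mono[of "{}" X] by blast
      ultimately have "atom (s \<star> y) s (inv\<^bsub>G\<^esub> h)" unfolding atom_def using T(2)[OF s] y(2) by simp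
      then have "s \<star> y \<in> E" unfolding E_def using T(3)[OF s] by blast
      then show False using X(2) n by blast
    qed
    have TR: "s \<in> carrier R" if "s \<in> T" for s using primitive_idemD(2)[OF T(2)[OF that]] .
    have "finsum R (\<lambda>s. s) D \<in> carrier R \<and> finsum R (\<lambda>s. s) D \<star> y \<in> cl X" if "finite D" "D \<subseteq> T" for D
      using that
    proof (induction D rule: finite_induct)
      case empty
      then show ?case using c(2) yP by (simp add: smult_l_null)
    next
      case (insert s D)
      have s: "s \<in> T" "D \<subseteq> T" using insert.prems by auto
      have "finsum R (\<lambda>s. s) (insert s D) = s \<oplus>\<^bsub>R\<^esub> finsum R (\<lambda>s. s) D"
        using insert.hyps TR s by (intro R.finsum_insert) auto
      then show ?case using insert.IH[OF s(2)] TR[OF s(1)] sy[OF s(1)] yP c(3) by (simp add: smult_l_distr)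
    qed
    from this[OF T(1) subset_refl] have "\<one>\<^bsub>R\<^esub> \<star> y \<in> cl X" unfolding one[symmetric] by blast
    then show ?thesis using yP by (simp add: smult_one)
  qed
  have "y \<in> cl X" if "y \<in> carrier P" for y
    using that by (induction rule: mhom_induct) (use c(2,3) homog in blast)+
  then have "frame X e \<sigma> (\<lambda>x. x)" unfolding frame_def using at ind by auto
  then show ?thesis using that pr by blast
qed

section \<open>The projective cover attached to a frame\<close>

context
  fixes I :: "'i set" and e \<sigma> x
  assumes frame: "frame I e \<sigma> x"
begin

lemma frame_atom:
  assumes "i \<in> I"
  shows "primitive_idem (e i)" "\<sigma> i \<in> carrier G" "x i \<in> hcomp P (inv\<^bsub>G\<^esub> (\<sigma> i))" "e i \<star> x i = x i" "x i \<in> carrier P"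
    "e i \<in> carrier R" "e i \<cdot> e i = e i" "e i \<in> A \<one>\<^bsub>G\<^esub>"
  using frame assms atomD[of "x i" "e i" "\<sigma> i"] primitive_idemD[of "e i"] unfolding frame_def by blast+

interpretation F: graded_family G R A I "\<lambda>i. S (e i) (\<sigma> i)"
  by (rule graded_family_shifted[OF frame_atom(1,2)])

text \<open>This is the projective cover of P: it is onto by \<open>frame_map_surj\<close>, and its
  kernel lies in J F by \<open>frame_map_kernel\<close>.\<close>

definition frame_map :: "('i \<Rightarrow> 'a) \<Rightarrow> 'b" where
  "frame_map = F.cotuple P (\<lambda>i v. v \<star> x i)"

lemma frame_summand_hom:
  assumes i: "i \<in> I"
  shows "(\<lambda>v. v \<star> x i) \<in> gr_hom G R (S (e i) (\<sigma> i)) P"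
proof (rule gr_homI)
  note f = frame_atom[OF i]
  have vR: "v \<in> carrier R" if "v \<in> carrier (S (e i) (\<sigma> i))" for v
    using that gr_left_idealD(7)[OF gr_left_ideal_cyclic_ideal[OF f(8)]] by (simp add: shifted_ideal_simps)
  show "v \<star> x i \<in> carrier P" if "v \<in> carrier (S (e i) (\<sigma> i))" for v using vR[OF that] f(5) smult_closed by blast
  show "(v \<oplus>\<^bsub>S (e i) (\<sigma> i)\<^esub> w) \<star> x i = v \<star> x i \<boxplus> w \<star> x i"
    if "v \<in> carrier (S (e i) (\<sigma> i))" "w \<in> carrier (S (e i) (\<sigma> i))" for v w
    using vR[OF that(1)] vR[OF that(2)] f(5) by (simp add: shifted_ideal_simps smult_l_distr)
  show "(a \<odot>\<^bsub>S (e i) (\<sigma> i)\<^esub> v) \<star> x i = a \<star> (v \<star> x i)" if "a \<in> carrier R" "v \<in> carrier (S (e i) (\<sigma> i))" for a v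
    using vR[OF that(2)] that(1) f(5) by (simp add: shifted_ideal_simps smult_assoc)
  show "v \<star> x i \<in> hcomp P g" if g: "g \<in> carrier G" and v: "v \<in> hcomp (S (e i) (\<sigma> i)) g" for g v
  proof -
    have "v \<in> A (g \<otimes>\<^bsub>G\<^esub> \<sigma> i)" using v by (simp add: shifted_ideal_simps)
    then have "v \<star> x i \<in> hcomp P (g \<otimes>\<^bsub>G\<^esub> \<sigma> i \<otimes>\<^bsub>G\<^esub> inv\<^bsub>G\<^esub> (\<sigma> i))"
      using module_grading_smult f(2,3) g by blast
    then show ?thesis using g f(2) by (simp add: G.m_assoc)
  qed
qed

lemma frame_map_hom: "frame_map \<in> gr_hom G R F.F P"
  unfolding frame_map_def by (rule F.cotuple_hom[OF graded_module_axioms frame_summand_hom])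

lemma frame_map_single:
  assumes "i \<in> I" "r \<in> cyclic_ideal (e i)"
  shows "frame_map (F.single i r) = r \<star> x i"
  unfolding frame_map_def using assms
  by (intro F.cotuple_single[OF graded_module_axioms frame_summand_hom]) (simp_all add: shifted_ideal_simps)

lemma frame_map_surj: "frame_map ` carrier F.F = carrier P"
proof
  show "frame_map ` carrier F.F \<subseteq> carrier P" using gr_homD(1)[OF frame_map_hom] by blast
  show "carrier P \<subseteq> frame_map ` carrier F.F"
  proof (rule nakayama[OF gsub_image[OF F.graded_direct_sum frame_map_hom]])
    show "x ` I \<subseteq> frame_map ` carrier F.F"
    proof
      fix y assume "y \<in> x ` I"
      then obtain i where i: "i \<in> I" "y = x i" by blast
      note f = frame_atom[OF i(1)]
      have "e i \<in> cyclic_ideal (e i)" using self_cyclic_ideal f(6) .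
      then have "frame_map (F.single i (e i)) = y" "F.single i (e i) \<in> carrier F.F"
        using frame_map_single[OF i(1)] f(4) i F.single_closed[OF i(1)] by (simp_all add: shifted_ideal_simps)
      then show "y \<in> frame_map ` carrier F.F" by blast
    qed
    show "carrier P \<subseteq> cl (x ` I)" using frame unfolding frame_def by blast
  qed
qed

lemma F_coord:
  assumes "u \<in> carrier F.F" "i \<in> I"
  shows "u i \<in> cyclic_ideal (e i)" "u i \<in> carrier R" "u i \<cdot> e i = u i"
  using F.carrierFD[OF assms] cyclic_ideal_iff[OF frame_atom(6,7)[OF assms(2)]] by (simp_all add: shifted_ideal_simps)

text \<open>Suppose the coordinate of u at i is outside J. The kernel is graded, so u may be cut to
  one degree in which that coordinate, w i, stays outside J. Then w i x i is a combination of the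
  other x j, and cancelling w i puts x i into their closure, against independence.\<close>

lemma frame_map_kernel:
  assumes u: "u \<in> carrier F.F" and z: "frame_map u = \<zero>\<^bsub>P\<^esub>" and i: "i \<in> I"
  shows "u i \<in> J"
proof (rule ccontr)
  note f = frame_atom[OF i]
  note co = F_coord
  assume n: "u i \<notin> J"
  have "\<exists>k\<in>carrier G. dR.c (u i) k \<notin> J"
  proof (rule ccontr)
    assume "\<not> ?thesis"
    then have "u i \<in> J"
      by (intro dR.component_induct[where Q = "\<lambda>a. a \<in> J", OF co(2)[OF u i]]) (use gr_left_idealD(2)[OF gr_left_ideal_J] J_add in blast)+
    then show False using n by blast
  qed
  then obtain k where k: "k \<in> carrier G" "dR.c (u i) k \<notin> J" by blast
  \<comment> \<open>Degree k of R e is degree k \<sigma>^-1 of its shift by \<sigma>.\<close>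
  define g where "g = k \<otimes>\<^bsub>G\<^esub> inv\<^bsub>G\<^esub> (\<sigma> i)"
  have g: "g \<in> carrier G" "g \<otimes>\<^bsub>G\<^esub> \<sigma> i = k" using k(1) f(2) by (simp_all add: g_def G.m_assoc)
  define w where "w = F.F.dM.c u g"
  have w: "w \<in> carrier F.F" unfolding w_def using F.F.dM.component_closed u g(1) .
  have \<Phi>w: "frame_map w = \<zero>\<^bsub>P\<^esub>"
    unfolding w_def gr_hom_component[OF F.graded_direct_sum graded_module_axioms frame_map_hom u g(1), symmetric] z
    by (rule component_zero[OF g(1)])
  have wi: "w i = dR.c (u i) k"
    unfolding w_def F.F_component[OF u g(1) i]
      shifted_component[OF gr_left_ideal_cyclic_ideal[OF f(8)] f(2) co(1)[OF u i] g(1)] g(2) ..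
  have wJ: "w i \<notin> J" using k(2) wi by simp
  have wA: "w i \<in> A k" unfolding wi using dR.component_in co(2)[OF u i] k(1) .
  let ?C = "cl (x ` I - {x i})"
  have IP: "x ` I - {x i} \<subseteq> carrier P" using frame_atom(5) by blast
  note c = gsubD[OF gsub_cl[OF IP]]
  have wM: "w i \<in> carrier (S (e i) (\<sigma> i))" using co(1)[OF w i] by (simp add: shifted_ideal_simps)
  define v where "v = F.single i (w i)"
  have v: "v \<in> carrier F.F" unfolding v_def by (rule F.single_closed[OF i wM])
  have \<Phi>v: "frame_map v = w i \<star> x i" unfolding v_def by (rule frame_map_single[OF i co(1)[OF w i]])
  \<comment> \<open>w with its coordinate at i removed; its image involves only the other frame
    elements.\<close>
  define w' where "w' = w \<oplus>\<^bsub>F.F\<^esub> \<ominus>\<^bsub>F.F\<^esub> v"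
  have w': "w' \<in> carrier F.F" unfolding w'_def using w v by simp
  have w'i: "w' i = \<zero>\<^bsub>R\<^esub>"
  proof -
    have "(v \<oplus>\<^bsub>F.F\<^esub> \<ominus>\<^bsub>F.F\<^esub> v) i = \<zero>\<^bsub>F.F\<^esub> i" using v by (simp add: F.F.M.r_neg)
    then show ?thesis using i
      by (simp add: w'_def gr_direct_sum_simps(2,3) shifted_ideal_simps v_def F.single_apply)
  qed
  have "frame_map w' \<in> ?C"
  proof (rule F.F_induct[OF w'])
    show "frame_map \<zero>\<^bsub>F.F\<^esub> \<in> ?C"
      using gr_hom_zero[OF F.graded_direct_sum graded_module_axioms frame_map_hom] c(2) by simp
    show "frame_map (p \<oplus>\<^bsub>F.F\<^esub> q) \<in> ?C"
      if "p \<in> carrier F.F" "q \<in> carrier F.F" "frame_map p \<in> ?C" "frame_map q \<in> ?C" for p q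
      using that gr_homD(2)[OF frame_map_hom] c(3) by simp
    fix j assume j: "j \<in> I"
    have eq: "frame_map (F.single j (w' j)) = w' j \<star> x j" by (rule frame_map_single[OF j co(1)[OF w' j]])
    show "frame_map (F.single j (w' j)) \<in> ?C"
    proof (cases "j = i")
      case True
      then show ?thesis using eq w'i f(5) c(2) by (simp add: smult_l_null)
    next
      case False
      then have "x j \<in> x ` I - {x i}" using frame i j unfolding frame_def inj_on_def by blast
      then have "x j \<in> ?C" using cl_ext[of "x ` I - {x i}"] by blast
      then show ?thesis unfolding eq using c(4)[OF co(2)[OF w' j]] by blast
    qed
  qed
  moreover have "w = w' \<oplus>\<^bsub>F.F\<^esub> v" unfolding w'_def using w v by (simp add: F.F.M.a_assoc F.F.M.l_neg)
  then have "\<zero>\<^bsub>P\<^esub> = frame_map w' \<boxplus> w i \<star> x i"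
    using gr_homD(2)[OF frame_map_hom w' v] \<Phi>w \<Phi>v by simp
  then have "w i \<star> x i \<boxplus> frame_map w' = \<zero>\<^bsub>P\<^esub>"
    using gr_homD(1)[OF frame_map_hom w'] smult_closed[OF co(2)[OF w i] f(5)] by (simp add: M.a_comm)
  then have "w i \<star> x i = \<ominus>\<^bsub>P\<^esub> frame_map w'"
    using M.minus_equality gr_homD(1)[OF frame_map_hom w'] smult_closed[OF co(2)[OF w i] f(5)] by simp
  ultimately have wx: "w i \<star> x i \<in> ?C" using c(6) by simp
  obtain s where s: "s \<in> A (inv\<^bsub>G\<^esub> k)" "s \<cdot> w i \<cdot> e i = e i"
    using primitive_idem_cancel[OF f(1) wA k(1)] wJ co(3)[OF w i] by auto
  have sR: "s \<in> carrier R" using A_closed[OF s(1)] k(1) by simp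
  have "x i = (s \<cdot> w i \<cdot> e i) \<star> x i" using s(2) f(4) by simp
  also have "\<dots> = s \<star> (w i \<star> (e i \<star> x i))"
    using sR co(2)[OF w i] f(5,6) by (simp add: smult_assoc smult_closed)
  also have "\<dots> = s \<star> (w i \<star> x i)" using f(4) by simp
  also have "\<dots> \<in> ?C" by (rule c(4)[OF sR wx])
  finally show False using frame i unfolding frame_def by blast
qed

text \<open>
  With \<open>\<Phi> = frame_map\<close>, the map \<open>p = 1 - v \<Phi>\<close> is a projection of \<open>F\<close> onto \<open>ker \<Phi> \<subseteq> J F\<close>. Hence \<open>p(F) \<subseteq> p(J F) = J p(F)\<close>,
  and \<open>p = 0\<close> because \<open>J\<close> is nilpotent.
\<close>

lemma frame_map_iso:
  assumes v: "v \<in> gr_hom G R P F.F" and \<Phi>v: "\<And>p. p \<in> carrier P \<Longrightarrow> frame_map (v p) = p"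
  shows "gr_iso G R P F.F"
proof -
  note h = gr_homD[OF v] and \<Phi> = gr_homD[OF frame_map_hom]
  define p where "p u = u \<oplus>\<^bsub>F.F\<^esub> \<ominus>\<^bsub>F.F\<^esub> (v (frame_map u))" for u
  have pF: "p u \<in> carrier F.F" if "u \<in> carrier F.F" for u
    unfolding p_def using that h(1)[OF \<Phi>(1)[OF that]] by simp
  have padd: "p (u \<oplus>\<^bsub>F.F\<^esub> w) = p u \<oplus>\<^bsub>F.F\<^esub> p w" if "u \<in> carrier F.F" "w \<in> carrier F.F" for u w
    unfolding p_def using that \<Phi>(1)[OF that(1)] \<Phi>(1)[OF that(2)] h(1)
    by (simp add: \<Phi>(2) h(2) F.F.M.minus_add F.F.M.a_ac)
  have psm: "p (a \<odot>\<^bsub>F.F\<^esub> u) = a \<odot>\<^bsub>F.F\<^esub> p u" if "a \<in> carrier R" "u \<in> carrier F.F" for a u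
    unfolding p_def using that \<Phi>(1)[OF that(2)] h(1)
    by (simp add: \<Phi>(3) h(3) F.F.smult_r_distr F.F.smult_r_minus)
  have \<Phi>0: "frame_map \<zero>\<^bsub>F.F\<^esub> = \<zero>\<^bsub>P\<^esub>"
    by (rule gr_hom_zero[OF F.graded_direct_sum graded_module_axioms frame_map_hom])
  have v0: "v \<zero>\<^bsub>P\<^esub> = \<zero>\<^bsub>F.F\<^esub>" by (rule gr_hom_zero[OF graded_module_axioms F.graded_direct_sum v])
  have p0: "p \<zero>\<^bsub>F.F\<^esub> = \<zero>\<^bsub>F.F\<^esub>" unfolding p_def \<Phi>0 v0 by (simp add: F.F.M.r_neg)
  have \<Phi>p: "frame_map (p u) = \<zero>\<^bsub>P\<^esub>" if u: "u \<in> carrier F.F" for u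
  proof -
    let ?w = "v (frame_map u)"
    have w: "?w \<in> carrier F.F" using h(1)[OF \<Phi>(1)[OF u]] .
    have "frame_map u = frame_map (p u \<oplus>\<^bsub>F.F\<^esub> ?w)"
      unfolding p_def using u w by (simp add: F.F.M.a_assoc F.F.M.l_neg)
    also have "\<dots> = frame_map (p u) \<boxplus> frame_map u" using \<Phi>(2)[OF pF[OF u] w] \<Phi>v[OF \<Phi>(1)[OF u]] by simp
    finally show ?thesis using \<Phi>(1)[OF u] \<Phi>(1)[OF pF[OF u]] M.add.r_cancel_one' by blast
  qed
  have pp: "p (p u) = p u" if u: "u \<in> carrier F.F" for u
    unfolding p_def[of "p u"] \<Phi>p[OF u] v0 using pF[OF u] by simp
  have JR: "set_power J n \<subseteq> carrier R" for n by (rule set_power_closed) (use J_closed in blast)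
  \<comment> \<open>Linearity and p (p u) = p u give p (z u) = p (z (p u)). The coordinates of p u
    lie in J, so z (p u) is a sum of generators with coefficients in the next power of J, where the
    hypothesis applies.\<close>
  have step: "\<forall>z\<in>set_power J n. \<forall>u\<in>carrier F.F. p (z \<odot>\<^bsub>F.F\<^esub> u) = \<zero>\<^bsub>F.F\<^esub>"
    if IH: "\<forall>z\<in>set_power J (Suc n). \<forall>u\<in>carrier F.F. p (z \<odot>\<^bsub>F.F\<^esub> u) = \<zero>\<^bsub>F.F\<^esub>" for n
  proof (intro ballI)
    fix z u assume z: "z \<in> set_power J n" and u: "u \<in> carrier F.F"
    have zR: "z \<in> carrier R" using z JR by blast
    let ?k = "p u"
    have k: "?k \<in> carrier F.F" by (rule pF[OF u])
    have "p (z \<odot>\<^bsub>F.F\<^esub> ?k) = \<zero>\<^bsub>F.F\<^esub>"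
    proof (rule F.F_induct[OF k])
      show "p (z \<odot>\<^bsub>F.F\<^esub> \<zero>\<^bsub>F.F\<^esub>) = \<zero>\<^bsub>F.F\<^esub>" using zR p0 by (simp add: F.F.smult_r_null)
      show "p (z \<odot>\<^bsub>F.F\<^esub> (y \<oplus>\<^bsub>F.F\<^esub> w)) = \<zero>\<^bsub>F.F\<^esub>"
        if "y \<in> carrier F.F" "w \<in> carrier F.F" "p (z \<odot>\<^bsub>F.F\<^esub> y) = \<zero>\<^bsub>F.F\<^esub>" "p (z \<odot>\<^bsub>F.F\<^esub> w) = \<zero>\<^bsub>F.F\<^esub>" for y w
        using that zR by (simp add: F.F.smult_r_distr padd F.F.smult_closed)
      fix i assume i: "i \<in> I"
      note f = frame_atom[OF i]
      have kJ: "?k i \<in> J" by (rule frame_map_kernel[OF k \<Phi>p[OF u] i])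
      have eM: "e i \<in> carrier (S (e i) (\<sigma> i))" using self_cyclic_ideal[OF f(6)] by (simp add: shifted_ideal_simps)
      have sF: "F.single i (e i) \<in> carrier F.F" by (rule F.single_closed[OF i eM])
      have "F.single i (?k i) = ?k i \<odot>\<^bsub>F.F\<^esub> F.single i (e i)"
        using gr_homD(3)[OF F.single_hom[OF i] J_closed[OF kJ] eM] F_coord(3)[OF k i] by (simp add: shifted_ideal_simps)
      then have "z \<odot>\<^bsub>F.F\<^esub> F.single i (?k i) = (z \<cdot> ?k i) \<odot>\<^bsub>F.F\<^esub> F.single i (e i)"
        using F.F.smult_assoc[OF zR J_closed[OF kJ] sF] by simp
      moreover have "z \<cdot> ?k i \<in> set_power J (Suc n)" by (rule set_power_append[OF _ kJ z]) (use J_closed in blast)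
      ultimately show "p (z \<odot>\<^bsub>F.F\<^esub> F.single i (?k i)) = \<zero>\<^bsub>F.F\<^esub>" using IH sF by simp
    qed
    then show "p (z \<odot>\<^bsub>F.F\<^esub> u) = \<zero>\<^bsub>F.F\<^esub>" using psm[OF zR k] psm[OF zR u] pp[OF u] by simp
  qed
  obtain m where m: "set_power J m \<subseteq> {\<zero>\<^bsub>R\<^esub>}" using nilpotent_J unfolding nilpotent_def by blast
  have "\<forall>z\<in>set_power J (m - k). \<forall>u\<in>carrier F.F. p (z \<odot>\<^bsub>F.F\<^esub> u) = \<zero>\<^bsub>F.F\<^esub>" for k
  proof (induction k)
    case 0
    have "p (z \<odot>\<^bsub>F.F\<^esub> u) = \<zero>\<^bsub>F.F\<^esub>" if "z \<in> set_power J m" "u \<in> carrier F.F" for z u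
    proof -
      have "z = \<zero>\<^bsub>R\<^esub>" using m that(1) by blast
      then show ?thesis using F.F.smult_l_null[OF that(2)] p0 by simp
    qed
    then show ?case by simp
  next
    case (Suc k)
    show ?case
    proof (cases "k < m")
      case True
      then have "Suc (m - Suc k) = m - k" by simp
      then show ?thesis using step[of "m - Suc k"] Suc.IH by simp
    qed (use Suc in simp)
  qed
  from this[of m] have all: "p (\<one>\<^bsub>R\<^esub> \<odot>\<^bsub>F.F\<^esub> u) = \<zero>\<^bsub>F.F\<^esub>" if "u \<in> carrier F.F" for u using that by simp
  have "v (frame_map u) = u" if u: "u \<in> carrier F.F" for u
  proof -
    have "u \<oplus>\<^bsub>F.F\<^esub> \<ominus>\<^bsub>F.F\<^esub> (v (frame_map u)) = \<zero>\<^bsub>F.F\<^esub>"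
      using all[OF u] F.F.smult_one[OF u] unfolding p_def by simp
    then show ?thesis
      using u h(1)[OF \<Phi>(1)[OF u]] F.F.M.minus_eq_zero_iff[of u "v (frame_map u)"] by (simp add: a_minus_def)
  qed
  then show ?thesis unfolding gr_iso_def using v frame_map_hom \<Phi>v by blast
qed

end

text \<open>The identity of P is lifted along \<open>frame_map\<close>, which
  \<open>frame_map_iso\<close> turns into an isomorphism. The basis itself serves as the final index
  set, hence a set of elements of P.\<close>

lemma projective_decomposition:
  assumes proj: "gr_projective G R A P"
  shows "\<exists>(I :: 'b set) Q \<sigma>. shifted_principal_family G R A I Q \<sigma> \<and>
            gr_iso G R P (gr_direct_sum I (\<lambda>i. shifted_ideal G R A (Q i) (\<sigma> i)))"
proof -
  obtain X e \<sigma> where X: "frame X e \<sigma> (\<lambda>x. x)"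
    and pr: "\<And>x. x \<in> X \<Longrightarrow> principal_gr_indecomposable G R A (cyclic_ideal (e x))" using principal_frame_exists by blast
  \<comment> \<open>Pairs, since \<open>gr_projective\<close> tests lifting on modules whose elements are functions on \<open>'b \<times> 'g\<close>.\<close>
  let ?I = "X \<times> {\<one>\<^bsub>G\<^esub>}"
  have fst_bij: "bij_betw fst ?I X" by (auto simp: bij_betw_def inj_on_def)
  have fr: "frame ?I (\<lambda>i. e (fst i)) (\<lambda>i. \<sigma> (fst i)) fst"
    using X fst_bij unfolding frame_def bij_betw_def by auto
  let ?M = "\<lambda>x. S (e x) (\<sigma> x)"
  let ?F = "gr_direct_sum ?I (\<lambda>i. ?M (fst i))"
  let ?\<Phi> = "frame_map ?I (\<lambda>i. e (fst i)) (\<lambda>i. \<sigma> (fst i)) fst"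
  interpret F: graded_family G R A ?I "\<lambda>i. ?M (fst i)"
    by (rule graded_family_shifted[OF frame_atom(1,2)[OF fr]])
  have "\<exists>v\<in>gr_hom G R P ?F. \<forall>p\<in>carrier P. ?\<Phi> (v p) = p"
    using proj F.graded_direct_sum graded_module_axioms frame_map_hom[OF fr] frame_map_surj[OF fr] gr_hom_id[of G R P]
    unfolding gr_projective_def by blast
  then obtain v where "v \<in> gr_hom G R P ?F" "\<And>p. p \<in> carrier P \<Longrightarrow> ?\<Phi> (v p) = p" by blast
  then have "gr_iso G R P ?F" by (rule frame_map_iso[OF fr])
  then have "gr_iso G R P (gr_direct_sum X ?M)"
    using gr_direct_sum_reindex[OF fst_bij, of G R ?M] gr_iso_trans by blast
  moreover have "shifted_principal_family G R A X (\<lambda>x. cyclic_ideal (e x)) \<sigma>"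
    unfolding shifted_principal_family_def using pr frame_atom(2)[OF X] by blast
  ultimately show ?thesis by blast
qed

end

theorem theorem4p7:
  fixes G :: "('g, 'e) monoid_scheme"
    and R :: "('a, 'c) ring_scheme"
    and A :: "'g \<Rightarrow> 'a set"
    and P :: "('a, 'p, 'g) gr_module"
  assumes "graded_ring G R A"
    and "gr_left_artinian G R A"
    and "gr_projective G R A P"
  shows "(\<exists>(I :: 'p set) Q \<sigma>.
            shifted_principal_family G R A I Q \<sigma> \<and>
            gr_iso G R P (gr_direct_sum I (\<lambda>i. shifted_ideal G R A (Q i) (\<sigma> i)))) \<and>
         (\<forall>(I :: 'i set) Q \<sigma> (J :: 'j set) Q' \<tau>.
            shifted_principal_family G R A I Q \<sigma> \<and>
            gr_iso G R P (gr_direct_sum I (\<lambda>i. shifted_ideal G R A (Q i) (\<sigma> i))) \<and>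
            shifted_principal_family G R A J Q' \<tau> \<and>
            gr_iso G R P (gr_direct_sum J (\<lambda>j. shifted_ideal G R A (Q' j) (\<tau> j))) \<longrightarrow>
            (\<exists>\<pi>. bij_betw \<pi> I J \<and>
                 (\<forall>i\<in>I. gr_iso G R (shifted_ideal G R A (Q i) (\<sigma> i))
                                   (shifted_ideal G R A (Q' (\<pi> i)) (\<tau> (\<pi> i))))))"
proof -
  have P: "graded_module G R A P" using assms(3) unfolding gr_projective_def by blast
  interpret gr_artin_module G R A P
    by (intro gr_artin_module.intro gr_artin.intro gr_artin_axioms.intro assms P)
  show ?thesis
    using projective_decomposition[OF assms(3)] principal_summands_unique by blast
qed

end
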